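(* Let $H$ be a (complex) Hilbert space. Then the assignment $\phi(c)=\mathrm{cl}_{\sigma w}(c)$ (the ultraweak closure in $\mathcal{B}(H)$) defines a Girard couple $$\mathrm{Max}_1\,\mathcal{C}_1(H)\xrightarrow{\phi}\mathrm{Max}_{\sigma w}\,\mathcal{B}(H)$$ with a cyclic dualizing element $$d=\{C\in\mathcal{C}_1(H)\mid \mathrm{tr}\,C=0\}.$$
   Context: A sup-lattice is a complete lattice; a sup-homomorphism is a map preserving arbitrary suprema. A quantale is a sup-lattice with an associative multiplication distributing over arbitrary joins in each variable (no unit required). For a quantale $Q$, a $Q$-bimodule is a sup-lattice $M$ with left and right actions of $Q$ preserving joins in both variables, with $(ab)m=a(bm)$, $m(ab)=(ma)b$, $(am)b=a(mb)$. A $Q$-bimodule homomorphism is a sup-homomorphism commuting with both actions. A couple $C\xrightarrow{\phi}Q$ consists of two quantales $C,Q$, a $Q$-bimodule structure on $C$, and a $Q$-bimodule homomorphism $\phi:C\to Q$ with $\phi(c_1)c_2=c_1\phi(c_2)=c_1c_2$ for all $c_1,c_2\in C$. For $d\in C$, $a\in Q$, $c\in C$ put $a\rightarrow d=\bigvee\{c\in C\mid ca\le d\}$, $d\leftarrow a=\bigvee\{c\in C\mid ac\le d\}$, $c\rightarrow d=\bigvee\{a\in Q\mid ac\le d\}$, $d\leftarrow c=\bigvee\{a\in Q\mid ca\le d\}$. The element $d$ is cyclic if $ac\le d\iff ca\le d$ for all $a\in Q,c\in C$; it is dualizing if $d\leftarrow(a\rightarrow d)=(d\leftarrow a)\rightarrow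 d=a$ for all $a\in Q$ and $d\leftarrow(c\rightarrow d)=(d\leftarrow c)\rightarrow d=c$ for all $c\in C$. The couple is Girard if it has a cyclic dualizing element. $\mathcal{B}(H)$ is the algebra of bounded operators on $H$ and $\mathcal{C}_1(H)$ its two-sided ideal of trace-class operators, with norm $\|C\|_1=\mathrm{tr}\sqrt{C^*C}$. $\mathrm{Max}_{\sigma w}\mathcal{B}(H)$ is the set of ultraweakly closed linear subspaces of $\mathcal{B}(H)$ and $\mathrm{Max}_1\mathcal{C}_1(H)$ the set of $\|\cdot\|_1$-closed linear subspaces of $\mathcal{C}_1(H)$, each ordered by inclusion. They are quantales in which the product of two subspaces $a,b$ is the closure, in the respective topology, of the linear span of $\{AB\mid A\in a,B\in b\}$. $\mathrm{Max}_1\mathcal{C}_1(H)$ is a $\mathrm{Max}_{\sigma w}\mathcal{B}(H)$-bimodule with $ac$ (resp. $ca$) the $\|\cdot\|_1$-closure of the linear span of $\{AC\mid A\in a,C\in c\}$ (resp. $\{CA\mid A\in a,C\in c\}$). *)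

theory Defs
  imports "HOL-Analysis.Analysis" "HOL-Algebra.Complete_Lattice"
begin

section \<open>Quantales, bimodules and Girard couples\<close>

text \<open>
  A sup-lattice is a carrier-based complete lattice, and \<^const>\<open>sup_pres\<close> is preservation of
  arbitrary (also empty) suprema.  Quantales are not required to have a unit.
\<close>

record 'q quantale = "'q gorder" +
  qmult :: "'q \<Rightarrow> 'q \<Rightarrow> 'q"  (infixl \<open>\<odot>\<index>\<close> 70)

locale quantale = complete_lattice Q for Q :: "('q, 'r) quantale_scheme" (structure) +
  assumes qmult_closed: "\<lbrakk>a \<in> carrier Q; b \<in> carrier Q\<rbrakk> \<Longrightarrow> a \<odot> b \<in> carrier Q"
    and qmult_assoc:
      "\<lbrakk>a \<in> carrier Q; b \<in> carrier Q; c \<in> carrier Q\<rbrakk> \<Longrightarrow> (a \<odot> b) \<odot> c = a \<odot> (b \<odot> c)"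
    and qmult_sup_right: "a \<in> carrier Q \<Longrightarrow> sup_pres Q Q (\<lambda>b. a \<odot> b)"
    and qmult_sup_left: "b \<in> carrier Q \<Longrightarrow> sup_pres Q Q (\<lambda>a. a \<odot> b)"

locale quantale_bimodule =
  Q: quantale Q + M: complete_lattice M
  for Q :: "('q, 'r) quantale_scheme" and M :: "('m, 's) gorder_scheme" +
  fixes lact :: "'q \<Rightarrow> 'm \<Rightarrow> 'm" and ract :: "'m \<Rightarrow> 'q \<Rightarrow> 'm"
  assumes lact_closed: "\<lbrakk>a \<in> carrier Q; m \<in> carrier M\<rbrakk> \<Longrightarrow> lact a m \<in> carrier M"
    and ract_closed: "\<lbrakk>m \<in> carrier M; a \<in> carrier Q\<rbrakk> \<Longrightarrow> ract m a \<in> carrier M"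
    and lact_sup_right: "a \<in> carrier Q \<Longrightarrow> sup_pres M M (\<lambda>m. lact a m)"
    and lact_sup_left: "m \<in> carrier M \<Longrightarrow> sup_pres Q M (\<lambda>a. lact a m)"
    and ract_sup_right: "m \<in> carrier M \<Longrightarrow> sup_pres Q M (\<lambda>a. ract m a)"
    and ract_sup_left: "a \<in> carrier Q \<Longrightarrow> sup_pres M M (\<lambda>m. ract m a)"
    and lact_lact: "\<lbrakk>a \<in> carrier Q; b \<in> carrier Q; m \<in> carrier M\<rbrakk>
      \<Longrightarrow> lact (a \<odot>\<^bsub>Q\<^esub> b) m = lact a (lact b m)"
    and ract_ract: "\<lbrakk>a \<in> carrier Q; b \<in> carrier Q; m \<in> carrier M\<rbrakk>
      \<Longrightarrow> ract m (a \<odot>\<^bsub>Q\<^esub> b) = ract (ract m a) b"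
    and lact_ract: "\<lbrakk>a \<in> carrier Q; b \<in> carrier Q; m \<in> carrier M\<rbrakk>
      \<Longrightarrow> ract (lact a m) b = lact a (ract m b)"

locale couple =
  C: quantale C + quantale_bimodule Q C lact ract
  for C :: "('c, 's) quantale_scheme" and Q :: "('q, 'r) quantale_scheme"
    and lact :: "'q \<Rightarrow> 'c \<Rightarrow> 'c" and ract :: "'c \<Rightarrow> 'q \<Rightarrow> 'c" +
  fixes \<phi> :: "'c \<Rightarrow> 'q"
  assumes phi_closed: "c \<in> carrier C \<Longrightarrow> \<phi> c \<in> carrier Q"
    and phi_sup: "sup_pres C Q \<phi>"
    and phi_lact: "\<lbrakk>a \<in> carrier Q; c \<in> carrier C\<rbrakk> \<Longrightarrow> \<phi> (lact a c) = a \<odot>\<^bsub>Q\<^esub> \<phi> c"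
    and phi_ract: "\<lbrakk>a \<in> carrier Q; c \<in> carrier C\<rbrakk> \<Longrightarrow> \<phi> (ract c a) = \<phi> c \<odot>\<^bsub>Q\<^esub> a"
    and lact_phi:
      "\<lbrakk>c\<^sub>1 \<in> carrier C; c\<^sub>2 \<in> carrier C\<rbrakk> \<Longrightarrow> lact (\<phi> c\<^sub>1) c\<^sub>2 = c\<^sub>1 \<odot>\<^bsub>C\<^esub> c\<^sub>2"
    and ract_phi:
      "\<lbrakk>c\<^sub>1 \<in> carrier C; c\<^sub>2 \<in> carrier C\<rbrakk> \<Longrightarrow> ract c\<^sub>1 (\<phi> c\<^sub>2) = c\<^sub>1 \<odot>\<^bsub>C\<^esub> c\<^sub>2"
begin

text \<open>
  The four residuals of \<open>d \<in> C\<close>.  The prefix \<open>r\<close> stands for \<open>x \<rightarrow> d\<close>, the prefix \<open>l\<close> for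
  \<open>d \<leftarrow> x\<close>; the suffix tells whether \<open>x\<close> is an element of \<open>Q\<close> (the residual is then in \<open>C\<close>)
  or of \<open>C\<close> (the residual is then in \<open>Q\<close>).
\<close>

definition rres_Q :: "'q \<Rightarrow> 'c \<Rightarrow> 'c"
  where "rres_Q a d = \<Squnion>\<^bsub>C\<^esub> {c \<in> carrier C. ract c a \<sqsubseteq>\<^bsub>C\<^esub> d}"

definition lres_Q :: "'c \<Rightarrow> 'q \<Rightarrow> 'c"
  where "lres_Q d a = \<Squnion>\<^bsub>C\<^esub> {c \<in> carrier C. lact a c \<sqsubseteq>\<^bsub>C\<^esub> d}"

definition rres_C :: "'c \<Rightarrow> 'c \<Rightarrow> 'q"
  where "rres_C c d = \<Squnion>\<^bsub>Q\<^esub> {a \<in> carrier Q. lact a c \<sqsubseteq>\<^bsub>C\<^esub> d}"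

definition lres_C :: "'c \<Rightarrow> 'c \<Rightarrow> 'q"
  where "lres_C d c = \<Squnion>\<^bsub>Q\<^esub> {a \<in> carrier Q. ract c a \<sqsubseteq>\<^bsub>C\<^esub> d}"

definition cyclic :: "'c \<Rightarrow> bool"
  where "cyclic d \<longleftrightarrow> d \<in> carrier C \<and>
    (\<forall>a\<in>carrier Q. \<forall>c\<in>carrier C. lact a c \<sqsubseteq>\<^bsub>C\<^esub> d \<longleftrightarrow> ract c a \<sqsubseteq>\<^bsub>C\<^esub> d)"

definition dualizing :: "'c \<Rightarrow> bool"
  where "dualizing d \<longleftrightarrow> d \<in> carrier C \<and>
    (\<forall>a\<in>carrier Q. lres_C d (rres_Q a d) = a \<and> rres_C (lres_Q d a) d = a) \<and>
    (\<forall>c\<in>carrier C. lres_Q d (rres_C c d) = c \<and> rres_Q (lres_C d c) d = c)"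

end

locale girard_couple = couple +
  assumes ex_cyclic_dualizing: "\<exists>d. cyclic d \<and> dualizing d"


section \<open>Complex Hilbert spaces and bounded operators\<close>

class complex_vector = ab_group_add +
  fixes scaleC :: "complex \<Rightarrow> 'a \<Rightarrow> 'a"  (infixr \<open>*\<^sub>C\<close> 75)
  assumes scaleC_add_right: "c *\<^sub>C (x + y) = c *\<^sub>C x + c *\<^sub>C y"
    and scaleC_add_left: "(b + c) *\<^sub>C x = b *\<^sub>C x + c *\<^sub>C x"
    and scaleC_scaleC: "b *\<^sub>C c *\<^sub>C x = (b * c) *\<^sub>C x"
    and scaleC_one: "1 *\<^sub>C x = x"

global_interpretation complex_vector:
  vector_space "scaleC :: complex \<Rightarrow> 'a \<Rightarrow> 'a::complex_vector"
  by unfold_locales (simp_all add: scaleC_add_right scaleC_add_left scaleC_scaleC scaleC_one)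

text \<open>
  The inner product is linear in the first argument.  Completeness is part of \<^class>\<open>banach\<close>;
  no separability is assumed, and the zero space is allowed.
\<close>

class chilbert_space = complex_vector + banach +
  fixes cinner :: "'a \<Rightarrow> 'a \<Rightarrow> complex"
  assumes scaleR_scaleC: "r *\<^sub>R x = complex_of_real r *\<^sub>C x"
    and cinner_commute: "cinner x y = cnj (cinner y x)"
    and cinner_add_left: "cinner (x + y) z = cinner x z + cinner y z"
    and cinner_scaleC_left: "cinner (c *\<^sub>C x) y = c * cinner x y"
    and cinner_nonneg: "cinner x x \<in> \<real>\<^sub>\<ge>\<^sub>0"
    and cinner_eq_zero_iff: "cinner x x = 0 \<longleftrightarrow> x = 0"
    and norm_eq_sqrt_cinner: "norm x = sqrt (Re (cinner x x))"

lemma norm_scaleC: "norm (c *\<^sub>C x) = cmod c * norm (x::'a::chilbert_space)"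
proof -
  have "cinner (c *\<^sub>C x) (c *\<^sub>C x) = c * cnj (c * cinner x x)"
    by (metis cinner_commute cinner_scaleC_left)
  also have "\<dots> = (c * cnj c) * cinner x x"
    by (metis cinner_commute complex_cnj_mult mult.assoc)
  also have "\<dots> = complex_of_real ((cmod c)\<^sup>2) * cinner x x"
    by (simp only: complex_norm_square)
  finally show ?thesis
    by (simp add: norm_eq_sqrt_cinner real_sqrt_mult)
qed

lemma bounded_linear_scaleC: "bounded_linear (\<lambda>x::'a::chilbert_space. c *\<^sub>C x)"
proof (rule bounded_linear_intro[where K = "cmod c"])
  show "c *\<^sub>C (r *\<^sub>R x) = r *\<^sub>R (c *\<^sub>C x)" for r and x :: 'a
    by (simp add: scaleR_scaleC scaleC_scaleC mult.commute)
qed (simp_all add: scaleC_add_right norm_scaleC mult.commute)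

typedef (overloaded) 'h bop =
  "{f :: 'h::chilbert_space \<Rightarrow> 'h. bounded_linear f \<and> (\<forall>c x. f (c *\<^sub>C x) = c *\<^sub>C f x)}"
  morphisms bop_apply Bop
  by (rule exI[of _ "\<lambda>_. 0"]) (simp add: bounded_linear_zero)

setup_lifting type_definition_bop

instantiation bop :: (chilbert_space) "{ring, complex_vector}"
begin

lift_definition zero_bop :: "'a bop" is "\<lambda>_. 0"
  by (simp add: bounded_linear_zero)

lift_definition plus_bop :: "'a bop \<Rightarrow> 'a bop \<Rightarrow> 'a bop" is "\<lambda>f g x. f x + g x"
  by (simp add: bounded_linear_add scaleC_add_right)

lift_definition minus_bop :: "'a bop \<Rightarrow> 'a bop \<Rightarrow> 'a bop" is "\<lambda>f g x. f x - g x"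
  by (simp add: bounded_linear_sub complex_vector.scale_right_diff_distrib)

lift_definition uminus_bop :: "'a bop \<Rightarrow> 'a bop" is "\<lambda>f x. - f x"
  by (simp add: bounded_linear_minus)

lift_definition times_bop :: "'a bop \<Rightarrow> 'a bop \<Rightarrow> 'a bop" is "\<lambda>f g x. f (g x)"
  by (simp add: bounded_linear_compose)

lift_definition scaleC_bop :: "complex \<Rightarrow> 'a bop \<Rightarrow> 'a bop" is "\<lambda>c f x. c *\<^sub>C f x"
  by (simp add: bounded_linear_compose[OF bounded_linear_scaleC] scaleC_scaleC mult.commute)

instance
  by standard
    (transfer, force simp: fun_eq_iff algebra_simps linear_add bounded_linear.linear
      scaleC_add_right scaleC_add_left scaleC_scaleC scaleC_one)+

end

definition is_onb :: "'h::chilbert_space set \<Rightarrow> bool"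
  where "is_onb E \<longleftrightarrow> (\<forall>x\<in>E. norm x = 1) \<and> (\<forall>x\<in>E. \<forall>y\<in>E. x \<noteq> y \<longrightarrow> cinner x y = 0) \<and>
    closure (complex_vector.span E) = UNIV"

definition cadjoint :: "'h::chilbert_space bop \<Rightarrow> 'h bop"
  where "cadjoint A = (THE B. \<forall>x y. cinner (bop_apply A x) y = cinner x (bop_apply B y))"

definition positive_op :: "'h::chilbert_space bop \<Rightarrow> bool"
  where "positive_op A \<longleftrightarrow> (\<forall>x. cinner (bop_apply A x) x \<in> \<real>\<^sub>\<ge>\<^sub>0)"

definition sqrt_op :: "'h::chilbert_space bop \<Rightarrow> 'h bop"
  where "sqrt_op A = (THE B. positive_op B \<and> B * B = A)"

definition abs_op :: "'h::chilbert_space bop \<Rightarrow> 'h bop"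
  where "abs_op A = sqrt_op (cadjoint A * A)"


section \<open>Trace-class operators and topologies\<close>

text \<open>
  Trace, trace class and trace norm are computed in one arbitrarily chosen orthonormal basis;
  by the standard theory they do not depend on this choice.
\<close>

definition some_onb :: "'h::chilbert_space set"
  where "some_onb = (SOME E. is_onb E)"

definition tr :: "'h::chilbert_space bop \<Rightarrow> complex"
  where "tr A = (\<Sum>\<^sub>\<infinity>e\<in>some_onb. cinner (bop_apply A e) e)"

definition trace_class :: "'h::chilbert_space bop set"
  where "trace_class = {A. (\<lambda>e. cinner (bop_apply (abs_op A) e) e) summable_on some_onb}"

definition trace_norm :: "'h::chilbert_space bop \<Rightarrow> real"
  where "trace_norm A = Re (tr (abs_op A))"

definition trace_norm_topology :: "'h::chilbert_space bop topology"
  where "trace_norm_topology = Metric_space.mtopology trace_class (\<lambda>A B. trace_norm (A - B))"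

text \<open>
  The ultraweak topology is the weak-* topology of \<open>\<B>(H)\<close> as the dual of the trace-class
  operators: the coarsest one making all functionals \<open>A \<mapsto> tr (A C)\<close>, \<open>C\<close> trace class, continuous.
\<close>

definition ultraweak_topology :: "'h::chilbert_space bop topology"
  where "ultraweak_topology =
    topology_generated_by {{A. tr (A * C) \<in> U} | C U. C \<in> trace_class \<and> open U}"


section \<open>The quantales of closed subspaces\<close>

definition span_prod :: "'h::chilbert_space bop set \<Rightarrow> 'h bop set \<Rightarrow> 'h bop set"
  where "span_prod a b = complex_vector.span {A * B | A B. A \<in> a \<and> B \<in> b}"

definition Max_closed :: "'h::chilbert_space bop topology \<Rightarrow> 'h bop set quantale"
  where "Max_closed T =
    \<lparr>carrier = {a. complex_vector.subspace a \<and> closedin T a}, eq = (=), le = (\<subseteq>),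
     qmult = (\<lambda>a b. T closure_of span_prod a b)\<rparr>"

definition Max_sw :: "'h::chilbert_space bop set quantale"
  where "Max_sw = Max_closed ultraweak_topology"

text \<open>Members of the carrier are sets of trace-class operators, since these form the whole space
  of \<^const>\<open>trace_norm_topology\<close>.\<close>

definition Max_1 :: "'h::chilbert_space bop set quantale"
  where "Max_1 = Max_closed trace_norm_topology"

text \<open>Both actions, \<open>a c\<close> and \<open>c a\<close>, are the trace norm closure of the span of the products.\<close>

definition Max_act :: "'h::chilbert_space bop set \<Rightarrow> 'h bop set \<Rightarrow> 'h bop set"
  where "Max_act a b = trace_norm_topology closure_of span_prod a b"

end

theory Submission
  imports Defs
begin

text \<open>
  Everything is governed by the trace pairing \<open>\<langle>A, C\<rangle> = tr (A C)\<close> of bounded operators \<open>A\<close> with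
  trace-class operators \<open>C\<close>.  Since \<open>\<B>(H)\<close> is the dual of \<open>\<C>\<^sub>1(H)\<close>, the closure of a subspace in
  either topology is its bipolar for this pairing, so the two lattices consist of the polar-closed
  sets.  The trace property \<open>tr (A C) = tr (C A)\<close> moves closures through products, which yields the
  quantale, bimodule and couple laws.  A product of \<open>A\<close> and \<open>C\<close> has trace zero iff \<open>A\<close> and \<open>C\<close> are
  orthogonal; hence all residuals into \<open>d\<close> are polars, and \<open>d\<close> being dualizing is again the bipolar
  theorem.
\<close>

section \<open>Hilbert spaces\<close>

text \<open>The definitions provide one basis \<open>some_onb\<close> and an absolute value
  described by \<open>THE\<close>, so the calculus of the trace has to be built from these. The key
  is that the trace-class operators are exactly the products of two Hilbert-Schmidt operators: polar
  decomposition and the square root of |A| give the factors and, conversely, turn |S T| into such a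
  product. Sums over the basis are then controlled by Cauchy-Schwarz, and the ideal property and
  cyclicity of the trace are read off from the factors. The two bipolar theorems differ in nature.
  In the trace norm, a point outside a closed subspace is separated from it by Hahn-Banach, and the
  separating functional must be shown to be the trace against a bounded operator. An ultraweak
  neighbourhood involves only finitely many trace-class operators, so there the matter is exact
  interpolation, that is, finite-dimensional linear algebra.\<close>

notation bop_apply (infixr \<open>\<cdot>\<close> 75)

lemma cinner_add_right: "cinner (x::'h::chilbert_space) (y + z) = cinner x y + cinner x z"
  by (metis cinner_add_left cinner_commute complex_cnj_add)

lemma cinner_scaleC_right: "cinner (x::'h::chilbert_space) (c *\<^sub>C y) = cnj c * cinner x y"
  by (metis cinner_commute cinner_scaleC_left complex_cnj_mult)

lemma cinner_scaleR_left: "cinner (r *\<^sub>R x::'h::chilbert_space) y = r * cinner x y"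
  by (simp add: scaleR_scaleC cinner_scaleC_left)

lemma cinner_scaleR_right: "cinner (x::'h::chilbert_space) (r *\<^sub>R y) = r * cinner x y"
  by (simp add: scaleR_scaleC cinner_scaleC_right)

lemma power2_norm_eq_cinner: "complex_of_real ((norm (x::'h::chilbert_space))\<^sup>2) = cinner x x"
proof -
  obtain r where "cinner x x = of_real r" "r \<ge> 0"
    using cinner_nonneg[of x] nonneg_Reals_cases by blast
  then show ?thesis by (simp add: norm_eq_sqrt_cinner)
qed

lemma power2_norm_eq_Re_cinner: "(norm (x::'h::chilbert_space))\<^sup>2 = Re (cinner x x)"
  by (metis power2_norm_eq_cinner Re_complex_of_real)

text \<open>Stated for semidefinite forms, since a positive operator A gives a form
  \<open>cinner (A \<cdot> x) y\<close> that may vanish at nonzero vectors. It is the discriminant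
  condition for a real quadratic in t, which degenerates to a linear function when
  \<open>Re (B y y) = 0\<close>.\<close>

lemma sesquilinear_Cauchy_Schwarz:
  fixes B :: "'v::complex_vector \<Rightarrow> 'v \<Rightarrow> complex"
  assumes add: "\<And>x y z. B (x + y) z = B x z + B y z"
    and scale: "\<And>c x z. B (c *\<^sub>C x) z = c * B x z"
    and herm: "\<And>x y. B x y = cnj (B y x)"
    and nonneg: "\<And>x. 0 \<le> Re (B x x)"
  shows "(cmod (B x y))\<^sup>2 \<le> Re (B x x) * Re (B y y)"
proof -
  define m where "m = (cmod (B x y))\<^sup>2"
  have "m \<ge> 0" by (simp add: m_def)
  have add_right: "B x (y + z) = B x y + B x z" for x y z
    by (metis add herm complex_cnj_add)
  have scale_right: "B x (c *\<^sub>C y) = cnj c * B x y" for c x y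
    by (metis scale herm complex_cnj_mult)
  have ineq: "0 \<le> Re (B x x) - 2 * t * m + t\<^sup>2 * m * Re (B y y)" for t :: real
  proof -
    \<comment> \<open>With the phase of \<open>B x y\<close> in c, both cross terms become the real
      number \<open>- (t * m)\<close>.\<close>
    define c where "c = - (complex_of_real t * B x y)"
    have yx: "B y x = cnj (B x y)" by (rule herm)
    have eq: "B (x + c *\<^sub>C y) (x + c *\<^sub>C y)
      = B x x + (cnj c * B x y + c * B y x) + (c * cnj c) * B y y"
      by (simp add: add scale add_right scale_right algebra_simps)
    have m: "complex_of_real m = B x y * cnj (B x y)"
      by (simp only: m_def complex_norm_square)
    have 1: "c * B y x = complex_of_real (- (t * m))"
      by (simp add: c_def yx m)
    have 2: "cnj c * B x y = complex_of_real (- (t * m))"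
      by (simp add: c_def m)
    have 3: "c * cnj c = complex_of_real (t\<^sup>2 * m)"
      by (simp add: c_def m power2_eq_square)
    show ?thesis
      using nonneg[of "x + c *\<^sub>C y"] unfolding eq 1 2 3 by (simp add: mult_ac)
  qed
  show ?thesis
  proof (cases "Re (B y y) = 0")
    case True
    have "m = 0"
    proof (rule ccontr)
      assume "m \<noteq> 0"
      \<comment> \<open>At this t the right-hand side of \<open>ineq\<close> equals -1.\<close>
      with ineq[of "(Re (B x x) + 1) / (2 * m)"] True show False
        by (simp add: field_simps)
    qed
    then show ?thesis using True by (simp add: m_def)
  next
    case False
    then have pos: "Re (B y y) > 0" using nonneg[of y] by simp
    \<comment> \<open>The quadratic is evaluated at its minimiser.\<close>
    have "0 \<le> Re (B x x) - m / Re (B y y)"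
      using ineq[of "1 / Re (B y y)"] pos by (simp add: power2_eq_square)
    then show ?thesis using pos by (simp add: m_def field_simps)
  qed
qed

lemma norm_cinner_le: "cmod (cinner x y) \<le> norm (x::'h::chilbert_space) * norm y"
proof -
  have "(cmod (cinner x y))\<^sup>2 \<le> Re (cinner x x) * Re (cinner y y)"
    by (rule sesquilinear_Cauchy_Schwarz)
      (auto simp: cinner_add_left cinner_scaleC_left simp flip: power2_norm_eq_Re_cinner intro: cinner_commute)
  also have "\<dots> = (norm x * norm y)\<^sup>2"
    by (simp add: power2_norm_eq_Re_cinner power_mult_distrib)
  finally show ?thesis by (rule power2_le_imp_le) simp
qed

text \<open>Conjugate-linearity in the second argument is linearity over the reals, so the general
  facts on bounded bilinear maps apply.\<close>

lemma bounded_bilinear_cinner: "bounded_bilinear (cinner :: 'h::chilbert_space \<Rightarrow> 'h \<Rightarrow> complex)"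
proof
  show "\<exists>K. \<forall>a b::'h. cmod (cinner a b) \<le> norm a * norm b * K"
    using norm_cinner_le by (metis mult.right_neutral)
qed (simp_all add: cinner_add_left cinner_add_right cinner_scaleR_left cinner_scaleR_right
    scaleR_conv_of_real)

lemmas cinner_simps =
  cinner_add_left cinner_add_right
  bounded_bilinear.diff_left[OF bounded_bilinear_cinner]
  bounded_bilinear.diff_right[OF bounded_bilinear_cinner]
  bounded_bilinear.minus_left[OF bounded_bilinear_cinner]
  bounded_bilinear.minus_right[OF bounded_bilinear_cinner]
  cinner_scaleC_left cinner_scaleC_right

lemmas cinner_zero_left [simp] = bounded_bilinear.zero_left[OF bounded_bilinear_cinner]
lemmas cinner_zero_right [simp] = bounded_bilinear.zero_right[OF bounded_bilinear_cinner]
lemmas cinner_sum_left = bounded_bilinear.sum_left[OF bounded_bilinear_cinner]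
lemmas tendsto_cinner [tendsto_intros] = bounded_bilinear.tendsto[OF bounded_bilinear_cinner]

lemma Re_cinner_commute: "Re (cinner x y) = Re (cinner y (x::'h::chilbert_space))"
  by (metis cinner_commute complex_cnj_cnj cnj.sel(1))

lemma cmod_cinner_commute: "cmod (cinner x y) = cmod (cinner y (x::'h::chilbert_space))"
  by (metis cinner_commute complex_mod_cnj)

lemma power2_norm_add:
  "(norm (x + y::'h::chilbert_space))\<^sup>2 = (norm x)\<^sup>2 + 2 * Re (cinner x y) + (norm y)\<^sup>2"
  using Re_cinner_commute[of y x] by (simp add: power2_norm_eq_Re_cinner cinner_simps)

lemma power2_norm_diff:
  "(norm (x - y::'h::chilbert_space))\<^sup>2 = (norm x)\<^sup>2 - 2 * Re (cinner x y) + (norm y)\<^sup>2"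
  using Re_cinner_commute[of y x] by (simp add: power2_norm_eq_Re_cinner cinner_simps)

lemma cinner_ext_left:
  assumes "\<And>z. cinner x z = cinner (y::'h::chilbert_space) z"
  shows "x = y"
proof -
  have "cinner (x - y) (x - y) = 0"
    unfolding bounded_bilinear.diff_left[OF bounded_bilinear_cinner] assms by simp
  then show ?thesis by (simp add: cinner_eq_zero_iff)
qed

lemma subspace_scaleR:
  "complex_vector.subspace S \<Longrightarrow> (x::'h::chilbert_space) \<in> S \<Longrightarrow> r *\<^sub>R x \<in> S"
  by (simp add: scaleR_scaleC complex_vector.subspace_scale)

lemma orthogonal_closure:
  assumes "\<And>x. x \<in> S \<Longrightarrow> cinner x (u::'h::chilbert_space) = 0" "y \<in> closure S"
  shows "cinner y u = 0"
proof -
  obtain f where f: "\<And>n. f n \<in> S" "f \<longlonglongrightarrow> y"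
    using assms(2) closure_sequential by blast
  have "(\<lambda>n. cinner (f n) u) \<longlonglongrightarrow> cinner y u"
    by (intro tendsto_intros f(2))
  then show ?thesis
    using f(1) assms(1) by (simp add: LIMSEQ_const_iff)
qed

text \<open>The functional is only given on a subspace that need not be closed, so that the lemma also
  provides orthogonal projections and, below, the polar decomposition.  The representing vector is
  the limit of a minimising sequence for \<open>q v = \<parallel>v\<parallel>\<^sup>2 - 2 Re (f v)\<close>.\<close>

lemma Riesz_subspace:
  fixes S :: "'h::chilbert_space set" and f :: "'h \<Rightarrow> complex"
  assumes S: "complex_vector.subspace S"
    and add: "\<And>x y. x \<in> S \<Longrightarrow> y \<in> S \<Longrightarrow> f (x + y) = f x + f y"
    and scale: "\<And>c x. x \<in> S \<Longrightarrow> f (c *\<^sub>C x) = c * f x"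
    and bound: "\<And>x. x \<in> S \<Longrightarrow> cmod (f x) \<le> K * norm x"
    and K: "0 \<le> K"
  obtains u where "u \<in> closure S" "\<And>x. x \<in> S \<Longrightarrow> f x = cinner x u" "norm u \<le> K"
proof -
  \<comment> \<open>If f is represented by u, then
    \<open>q v = (norm (v - u))\<^sup>2 - (norm u)\<^sup>2\<close>, so a minimiser of q is the
    vector sought.\<close>
  define q where "q v = (norm v)\<^sup>2 - 2 * Re (f v)" for v
  define m where "m = (INF v\<in>S. q v)"
  have S0: "0 \<in> S" using S by (rule complex_vector.subspace_0)
  have q_ge: "- K\<^sup>2 \<le> q v" if "v \<in> S" for v
  proof -
    have "Re (f v) \<le> K * norm v" using bound[OF that] complex_Re_le_cmod order_trans by blast
    moreover have "0 \<le> (norm v - K)\<^sup>2" by simp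
    ultimately show ?thesis unfolding q_def power2_diff by (simp add: mult.commute)
  qed
  have bdd: "bdd_below (q ` S)" using q_ge by (auto intro: bdd_belowI[of _ "- K\<^sup>2"])
  have m_le: "m \<le> q v" if "v \<in> S" for v
    unfolding m_def using bdd that by (rule cINF_lower)
  have "\<exists>v\<in>S. q v < m + 1 / Suc n" for n :: nat
    unfolding m_def using bdd S0 by (subst cINF_less_iff[symmetric]) auto
  then obtain v where vS: "\<And>n. v n \<in> S" and qv: "\<And>n. q (v n) < m + 1 / Suc n" by metis
  \<comment> \<open>The parallelogram law, with the midpoint z of x and y as a competitor for the
    infimum m.\<close>
  have dist2: "(norm (x - y))\<^sup>2 \<le> 2 * (q x + q y - 2 * m)" if "x \<in> S" "y \<in> S" for x y
  proof -
    define z where "z = (1/2) *\<^sub>R (x + y)"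
    have zS: "z \<in> S" unfolding z_def
      by (intro subspace_scaleR[OF S] complex_vector.subspace_add[OF S] that)
    have "f z = of_real (1/2) * (f x + f y)" unfolding z_def scaleR_scaleC
      by (simp add: scale add that complex_vector.subspace_add[OF S])
    then have "Re (f z) = (Re (f x) + Re (f y)) / 2"
      by (simp only: Re_complex_of_real times_complex.sel Im_complex_of_real plus_complex.sel)
    moreover have "4 * (norm z)\<^sup>2 = (norm (x + y))\<^sup>2"
      by (simp add: z_def power_divide)
    ultimately have "4 * q z = (norm (x + y))\<^sup>2 - 4 * (Re (f x) + Re (f y))"
      by (simp add: q_def)
    then show ?thesis
      using m_le[OF zS] power2_norm_add[of x y] power2_norm_diff[of x y] by (simp add: q_def)
  qed
  have "Cauchy v"
  proof (rule metric_CauchyI)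
    fix e :: real assume "e > 0"
    then obtain N where N: "1 / Suc N < e\<^sup>2 / 4"
      using nat_approx_posE[of "e\<^sup>2 / 4"] by (metis zero_less_divide_iff zero_less_numeral zero_less_power)
    have "dist (v i) (v j) < e" if "i \<ge> N" "j \<ge> N" for i j
    proof -
      have "1 / Suc i \<le> 1 / Suc N" "1 / Suc j \<le> 1 / Suc N"
        using that by (simp_all add: frac_le)
      then have "q (v i) - m < e\<^sup>2 / 4" "q (v j) - m < e\<^sup>2 / 4"
        using qv[of i] qv[of j] N by auto
      then have "(norm (v i - v j))\<^sup>2 < e\<^sup>2"
        using dist2[OF vS[of i] vS[of j]] by argo
      then show ?thesis using \<open>e > 0\<close> by (simp add: dist_norm power_less_imp_less_base)
    qed
    then show "\<exists>M. \<forall>m\<ge>M. \<forall>n\<ge>M. dist (v m) (v n) < e" by blast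
  qed
  then obtain u where u: "v \<longlonglongrightarrow> u" using Cauchy_convergent_iff convergent_def by blast
  have uS: "u \<in> closure S" using vS u closure_sequential by blast
  have rep: "f x = cinner x u" if x: "x \<in> S" for x
  proof (rule ccontr)
    define g where "g = cinner x u - f x"
    assume "f x \<noteq> cinner x u"
    then have g: "(cmod g)\<^sup>2 > 0" by (simp add: g_def)
    have "0 \<le> t\<^sup>2 * (cmod g)\<^sup>2 * (norm x)\<^sup>2 - 2 * t * (cmod g)\<^sup>2" for t :: real
    proof -
      \<comment> \<open>In the limit along \<open>v n\<close>, a step by
        \<open>c *\<^sub>C x\<close> changes q to first order by -2 t |g|^2, so it would fall below
        the infimum for small positive t.\<close>
      define c where "c = - (complex_of_real t * cnj g)"
      have "m - 1 / Suc n \<le> q (v n + c *\<^sub>C x) - q (v n) + m - 1 / Suc n + (q (v n) - m)" for n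
        using m_le[of "v n + c *\<^sub>C x"] vS[of n] x S
        by (simp add: complex_vector.subspace_add complex_vector.subspace_scale)
      then have "- (1 / Suc n) \<le> q (v n + c *\<^sub>C x) - q (v n)" for n
        using qv[of n] m_le[of "v n + c *\<^sub>C x"] vS[of n] x S
        by (smt (verit) complex_vector.subspace_add complex_vector.subspace_scale)
      moreover have "q (v n + c *\<^sub>C x) - q (v n)
          = (cmod c)\<^sup>2 * (norm x)\<^sup>2 + 2 * Re (c * cinner x (v n)) - 2 * Re (c * f x)" for n
        unfolding q_def power2_norm_add Re_cinner_commute[of "v n" "c *\<^sub>C x"]
        by (simp add: add scale vS x S complex_vector.subspace_scale norm_scaleC power_mult_distrib
            cinner_simps)
      ultimately have le: "- (1 / Suc n)
          \<le> (cmod c)\<^sup>2 * (norm x)\<^sup>2 + 2 * Re (c * cinner x (v n)) - 2 * Re (c * f x)" for n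
        by simp
      have "(\<lambda>n. - (1 / real (Suc n))) \<longlonglongrightarrow> - 0"
        by (intro tendsto_minus LIMSEQ_Suc[OF lim_1_over_n])
      moreover have "(\<lambda>n. (cmod c)\<^sup>2 * (norm x)\<^sup>2 + 2 * Re (c * cinner x (v n)) - 2 * Re (c * f x))
        \<longlonglongrightarrow> (cmod c)\<^sup>2 * (norm x)\<^sup>2 + 2 * Re (c * cinner x u) - 2 * Re (c * f x)"
        by (intro tendsto_intros u)
      ultimately have "- 0 \<le> (cmod c)\<^sup>2 * (norm x)\<^sup>2 + 2 * Re (c * cinner x u) - 2 * Re (c * f x)"
        using le LIMSEQ_le by blast
      also have "\<dots> = (cmod c)\<^sup>2 * (norm x)\<^sup>2 + 2 * Re (c * g)"
        by (simp add: g_def right_diff_distrib)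
      also have "c * g = of_real (- t * (cmod g)\<^sup>2)"
        unfolding c_def of_real_mult complex_norm_square by (simp add: mult_ac)
      finally show ?thesis by (simp add: c_def norm_mult power_mult_distrib)
    qed
    \<comment> \<open>This t is small enough to make the quadratic negative, and the summand 1 keeps
      the denominator positive.\<close>
    from this[of "1 / (1 + (norm x)\<^sup>2)"]
    have "0 \<le> (1 / (1 + (norm x)\<^sup>2)) * (cmod g)\<^sup>2 * ((1 / (1 + (norm x)\<^sup>2)) * (norm x)\<^sup>2 - 2)"
      by (simp add: algebra_simps power2_eq_square)
    moreover have "(1 / (1 + (norm x)\<^sup>2)) * (norm x)\<^sup>2 \<le> 1" by (simp add: field_simps add_pos_nonneg)
    moreover have "(1 / (1 + (norm x)\<^sup>2)) * (cmod g)\<^sup>2 > 0" using g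
      by (simp add: add_pos_nonneg)
    ultimately show False by (smt (verit) zero_le_mult_iff)
  qed
  \<comment> \<open>The vector u lies only in the closure of S, where nothing is known about f, so
    the bound is taken along \<open>v n\<close> and passed to the limit.\<close>
  have "norm u * norm u \<le> K * norm u"
  proof (rule LIMSEQ_le)
    show "(\<lambda>n. cmod (cinner (v n) u)) \<longlonglongrightarrow> norm u * norm u"
      using tendsto_norm[OF tendsto_cinner[OF u tendsto_const[of u]]]
      by (metis norm_of_real power2_norm_eq_cinner power2_eq_square abs_of_nonneg zero_le_power2)
    show "(\<lambda>n. K * norm (v n)) \<longlonglongrightarrow> K * norm u" by (intro tendsto_intros u)
    show "\<exists>N. \<forall>n\<ge>N. cmod (cinner (v n) u) \<le> K * norm (v n)" by (metis bound rep vS)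
  qed
  then have "norm u \<le> K" using K by (cases "u = 0") auto
  then show ?thesis using uS rep that by blast
qed

lemma subspace_closure:
  fixes S :: "'h::chilbert_space set"
  assumes S: "complex_vector.subspace S"
  shows "complex_vector.subspace (closure S)"
proof (rule complex_vector.subspaceI)
  show "0 \<in> closure S"
    using complex_vector.subspace_0[OF S] closure_subset by blast
  fix x y c assume "x \<in> closure S"
  then obtain f where f: "\<forall>n. f n \<in> S" "f \<longlonglongrightarrow> x" unfolding closure_sequential by blast
  show "c *\<^sub>C x \<in> closure S"
    unfolding closure_sequential
    by (rule exI[of _ "\<lambda>n. c *\<^sub>C f n"])
      (use f S in \<open>auto intro: bounded_linear.tendsto[OF bounded_linear_scaleC] complex_vector.subspace_scale\<close>)
  assume "y \<in> closure S"
  then obtain g where g: "\<forall>n. g n \<in> S" "g \<longlonglongrightarrow> y" unfolding closure_sequential by blast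
  show "x + y \<in> closure S"
    unfolding closure_sequential
    by (rule exI[of _ "\<lambda>n. f n + g n"])
      (use f g S in \<open>auto intro: tendsto_add complex_vector.subspace_add\<close>)
qed

section \<open>Bounded operators\<close>

lemma bounded_linear_bop: "bounded_linear (bop_apply A)"
  using bop_apply by blast

lemma bop_scaleC [simp]: "A \<cdot> (c *\<^sub>C x) = c *\<^sub>C (A \<cdot> x)"
  using bop_apply by blast

lemmas bop_add = linear_add[OF bounded_linear.linear[OF bounded_linear_bop]]
lemmas bop_diff = linear_diff[OF bounded_linear.linear[OF bounded_linear_bop]]
lemmas bop_zero [simp] = linear_0[OF bounded_linear.linear[OF bounded_linear_bop]]
lemmas bop_sum = linear_sum[OF bounded_linear.linear[OF bounded_linear_bop]]
lemmas tendsto_bop [tendsto_intros] = bounded_linear.tendsto[OF bounded_linear_bop]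

lemmas bop_rep_eq [simp] =
  zero_bop.rep_eq plus_bop.rep_eq minus_bop.rep_eq uminus_bop.rep_eq times_bop.rep_eq scaleC_bop.rep_eq

lemma bop_eqI: "(\<And>x. A \<cdot> x = B \<cdot> x) \<Longrightarrow> A = B"
  by (simp add: bop_apply_inject[symmetric] fun_eq_iff)

lemma bop_eqI_cinner: "(\<And>x y. cinner (A \<cdot> x) y = cinner (B \<cdot> x) y) \<Longrightarrow> A = B"
  by (blast intro: bop_eqI cinner_ext_left)

lemma bop_bounded:
  obtains K where "0 \<le> K" "\<And>x. norm (A \<cdot> x) \<le> K * norm x"
  using bounded_linear.nonneg_bounded[OF bounded_linear_bop, of A] by (metis mult.commute)

lemma ex_bop:
  fixes f :: "'h::chilbert_space \<Rightarrow> 'h"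
  assumes "\<And>x y. f (x + y) = f x + f y" "\<And>c x. f (c *\<^sub>C x) = c *\<^sub>C f x"
    "\<And>x. norm (f x) \<le> K * norm x"
  obtains A where "\<And>x. A \<cdot> x = f x"
proof -
  have "bounded_linear f"
    by (rule bounded_linear_intro[where K = K]) (simp_all add: assms scaleR_scaleC mult.commute)
  then show ?thesis using that[of "Bop f"] assms(2) by (simp add: Bop_inverse)
qed

text \<open>Riesz representation in the second argument, applied to \<open>cnj (B x y)\<close>
  because B is conjugate-linear there. It supplies the adjoints and, later, the operators that
  represent functionals on the trace class.\<close>

lemma ex_bop_form:
  fixes B :: "'h::chilbert_space \<Rightarrow> 'h \<Rightarrow> complex"
  assumes "\<And>x y z. B (x + y) z = B x z + B y z" "\<And>c x y. B (c *\<^sub>C x) y = c * B x y"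
    "\<And>x y z. B x (y + z) = B x y + B x z" "\<And>c x y. B x (c *\<^sub>C y) = cnj c * B x y"
    "\<And>x y. cmod (B x y) \<le> K * norm x * norm y" and K: "0 \<le> K"
  obtains A where "\<And>x y. cinner (A \<cdot> x) y = B x y" "\<And>x. norm (A \<cdot> x) \<le> K * norm x"
proof -
  have "\<exists>u. (\<forall>y. B x y = cinner u y) \<and> norm u \<le> K * norm x" for x
  proof -
    obtain u where "\<And>y. y \<in> UNIV \<Longrightarrow> cnj (B x y) = cinner y u" "norm u \<le> K * norm x"
      by (rule Riesz_subspace[of UNIV "\<lambda>y. cnj (B x y)" "K * norm x"]) (use assms in auto)
    then show ?thesis by (metis cinner_commute complex_cnj_cnj UNIV_I)
  qed
  then obtain f where f: "\<And>x y. B x y = cinner (f x) y" "\<And>x. norm (f x) \<le> K * norm x" by metis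
  have "f (x + y) = f x + f y" for x y
    by (rule cinner_ext_left) (simp add: f(1)[symmetric] cinner_simps assms)
  moreover have "f (c *\<^sub>C x) = c *\<^sub>C f x" for c x
    by (rule cinner_ext_left) (simp add: f(1)[symmetric] cinner_simps assms)
  ultimately obtain A where "\<And>x. A \<cdot> x = f x" using ex_bop f(2) by metis
  then show ?thesis using f that by metis
qed

lemma bop_mult_scaleC:
  fixes A B :: "'h::chilbert_space bop"
  shows "A * (c *\<^sub>C B) = c *\<^sub>C (A * B)" "(c *\<^sub>C A) * B = c *\<^sub>C (A * B)"
proof -
  show "A * (c *\<^sub>C B) = c *\<^sub>C (A * B)" by (rule bop_eqI) simp
  show "(c *\<^sub>C A) * B = c *\<^sub>C (A * B)" by (rule bop_eqI) simp
qed

text \<open>On the zero space the identity equals 0, so \<open>bop\<close> cannot be an instance of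
  \<open>ring_1\<close>; the identity is obtained locally wherever it is used.\<close>

lemma ex_bop_id: obtains I :: "'h::chilbert_space bop" where "\<And>x. I \<cdot> x = x" "\<And>A. I * A = A" "\<And>A. A * I = A"
proof -
  obtain I :: "'h bop" where I: "\<And>x. I \<cdot> x = x" by (rule ex_bop[of "\<lambda>x. x" 1]) auto
  then show ?thesis using that by (metis bop_eqI times_bop.rep_eq)
qed

lemma bop_sum_apply: "(\<Sum>i\<in>F. A i) \<cdot> x = (\<Sum>i\<in>F. A i \<cdot> x)"
  by (induction F rule: infinite_finite_induct) auto

section \<open>Adjoints\<close>

lemma cadjoint_ex1: "\<exists>!B. \<forall>x y. cinner (A \<cdot> x) y = cinner x (B \<cdot> (y::'h::chilbert_space))"
proof -
  obtain K where K: "0 \<le> K" "\<And>x. norm (A \<cdot> x) \<le> K * norm x" using bop_bounded by blast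
  have bound: "cmod (cinner x (A \<cdot> y)) \<le> K * norm x * norm y" for x y
    using norm_cinner_le[of x "A \<cdot> y"] mult_left_mono[OF K(2)[of y], of "norm x"] by (simp add: mult_ac)
  obtain B where B: "\<And>x y. cinner (B \<cdot> x) y = cinner x (A \<cdot> y)"
    by (rule ex_bop_form[of "\<lambda>x y. cinner x (A \<cdot> y)" K])
      (auto simp: cinner_simps bop_add K bound)
  have "cinner (A \<cdot> x) y = cinner x (B \<cdot> y)" for x y
    by (metis B cinner_commute)
  moreover have "C = B" if "\<forall>x y. cinner (A \<cdot> x) y = cinner x (C \<cdot> y)" for C
    by (rule bop_eqI_cinner) (metis that B cinner_commute)
  ultimately show ?thesis by blast
qed

lemma cinner_cadjoint: "cinner (A \<cdot> x) y = cinner x (cadjoint A \<cdot> y)"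
  unfolding cadjoint_def using theI'[OF cadjoint_ex1[of A]] by blast

lemma cinner_cadjoint': "cinner x (A \<cdot> y) = cinner (cadjoint A \<cdot> x) y"
  by (metis cinner_cadjoint cinner_commute)

lemma cadjointI: "(\<And>x y. cinner (A \<cdot> x) y = cinner x (B \<cdot> y)) \<Longrightarrow> cadjoint A = B"
  using cadjoint_ex1[of A] cinner_cadjoint[of A] by blast

lemma cadjoint_cadjoint [simp]: "cadjoint (cadjoint A) = A"
  by (rule cadjointI) (simp add: cinner_cadjoint')

lemma cadjoint_mult: "cadjoint (A * B) = cadjoint B * cadjoint A"
  by (rule cadjointI) (simp add: cinner_cadjoint)

lemma cadjoint_add: "cadjoint (A + B) = cadjoint A + cadjoint B"
  by (rule cadjointI) (simp add: cinner_simps cinner_cadjoint)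

lemma cadjoint_diff: "cadjoint (A - B) = cadjoint A - cadjoint B"
  by (rule cadjointI) (simp add: cinner_simps cinner_cadjoint)

lemma cadjoint_scaleC: "cadjoint (c *\<^sub>C A) = cnj c *\<^sub>C cadjoint A"
  by (rule cadjointI) (simp add: cinner_simps cinner_cadjoint)

text \<open>Cauchy-Schwarz applied to \<open>cinner (A \<cdot> cadjoint A \<cdot> x) x\<close>,
  which is the squared norm of \<open>cadjoint A \<cdot> x\<close>. Keeping the constant K lets
  right multiplication of Hilbert-Schmidt operators inherit its bound from left
  multiplication.\<close>

lemma cadjoint_bounded:
  assumes "\<And>x. norm (A \<cdot> x) \<le> K * norm x" "0 \<le> K"
  shows "norm (cadjoint A \<cdot> x) \<le> K * norm x"
proof -
  let ?y = "cadjoint A \<cdot> x"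
  have "norm ?y * norm ?y = cmod (cinner (A \<cdot> ?y) x)"
    by (metis cinner_cadjoint power2_norm_eq_cinner norm_of_real power2_eq_square abs_of_nonneg zero_le_power2)
  also have "\<dots> \<le> norm (A \<cdot> ?y) * norm x" by (rule norm_cinner_le)
  also have "\<dots> \<le> K * norm ?y * norm x" by (simp add: assms mult_right_mono)
  finally have "norm ?y * norm ?y \<le> (K * norm x) * norm ?y" by (simp add: mult_ac)
  then show ?thesis using assms(2) by (cases "?y = 0") auto
qed

section \<open>Positive operators and square roots\<close>

lemma positive_opD: "positive_op A \<Longrightarrow> 0 \<le> Re (cinner (A \<cdot> x) x)"
  by (auto simp: positive_op_def complex_nonneg_Reals_iff)

text \<open>Over the complex scalars a real quadratic form is symmetric: reality at x + y determines
  the imaginary parts, reality at x + i y the real parts.\<close>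

lemma positive_op_cadjoint:
  assumes "positive_op A" shows "cadjoint A = A"
proof (rule cadjointI)
  fix x y
  have real: "Im (cinner (A \<cdot> z) z) = 0" for z
    using assms by (auto simp: positive_op_def complex_nonneg_Reals_iff)
  define p where "p = cinner (A \<cdot> x) y"
  define r where "r = cinner (A \<cdot> y) x"
  have "Im (p + r) = 0"
    using real[of "x + y"] real[of x] real[of y] by (simp add: bop_add cinner_simps p_def r_def)
  moreover have "Im (- \<i> * p + \<i> * r) = 0"
    using real[of "x + \<i> *\<^sub>C y"] real[of x] real[of y]
    by (simp add: bop_add cinner_simps p_def r_def)
  ultimately have "p = cnj r" by (simp add: complex_eq_iff)
  then show "cinner (A \<cdot> x) y = cinner x (A \<cdot> y)"
    unfolding p_def r_def by (metis cinner_commute)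
qed

lemma positive_op_cinner_commute: "positive_op A \<Longrightarrow> cinner (A \<cdot> x) y = cinner x (A \<cdot> y)"
  by (metis cinner_cadjoint positive_op_cadjoint)

lemma positive_op_Cauchy_Schwarz:
  assumes "positive_op A"
  shows "(cmod (cinner (A \<cdot> x) y))\<^sup>2 \<le> Re (cinner (A \<cdot> x) x) * Re (cinner (A \<cdot> y) y)"
proof (rule sesquilinear_Cauchy_Schwarz)
  show "cinner (A \<cdot> x) y = cnj (cinner (A \<cdot> y) x)" for x y
    by (metis assms cinner_commute positive_op_cinner_commute)
qed (simp_all add: assms bop_add cinner_simps positive_opD)

lemma positive_op_eq_0:
  assumes "positive_op A" "Re (cinner (A \<cdot> x) x) = 0"
  shows "A \<cdot> x = 0"
  using positive_op_Cauchy_Schwarz[OF assms(1), of x "A \<cdot> x"] assms(2)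
  by (simp add: cinner_eq_zero_iff)

lemma positive_op_cadjoint_mult: "positive_op (cadjoint A * A)"
  unfolding positive_op_def
  by (simp add: complex_nonneg_Reals_iff flip: cinner_cadjoint' power2_norm_eq_cinner)

text \<open>The scalar recursion dominating the iteration \<open>Y (n + 1) = (X + (Y n)\<^sup>2) / 2\<close>, whose limit \<open>Y\<close>
  satisfies \<open>(1 - Y)\<^sup>2 = 1 - X\<close>.\<close>

primrec sqrt_bound :: "nat \<Rightarrow> real" where
  "sqrt_bound 0 = 0"
| "sqrt_bound (Suc n) = (1 + (sqrt_bound n)\<^sup>2) / 2"

lemma sqrt_bound_01: "0 \<le> sqrt_bound n \<and> sqrt_bound n \<le> 1"
  by (induction n) (auto simp: power_le_one)

lemma sqrt_bound_mono: "sqrt_bound n \<le> sqrt_bound (Suc n)"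
  using zero_le_power2[of "sqrt_bound n - 1"] by (simp add: power2_diff)

lemma sqrt_bound_convergent: "convergent sqrt_bound"
proof -
  have "incseq sqrt_bound" using sqrt_bound_mono by (rule incseq_SucI)
  then show ?thesis
    using incseq_convergent[of sqrt_bound 1] sqrt_bound_01 convergent_def by metis
qed

lemma sqrt_bound_Cauchy: "Cauchy sqrt_bound"
  using sqrt_bound_convergent by (rule convergent_Cauchy)

primrec sqrt_iter :: "'h::chilbert_space bop \<Rightarrow> nat \<Rightarrow> 'h bop" where
  "sqrt_iter X 0 = 0"
| "sqrt_iter X (Suc n) = (1/2) *\<^sub>C (X + sqrt_iter X n * sqrt_iter X n)"

text \<open>Serves twice: successive iterates commute, so differences of their squares factor, and
  in the limit the root commutes with everything that commutes with X.\<close>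

lemma sqrt_iter_commute:
  assumes "B * X = X * B"
  shows "B * sqrt_iter X n = sqrt_iter X n * B"
proof (induction n)
  case (Suc n)
  have "B * (sqrt_iter X n * sqrt_iter X n) = sqrt_iter X n * sqrt_iter X n * B"
    by (metis Suc mult.assoc)
  then show ?case by (simp add: bop_mult_scaleC distrib_left distrib_right assms)
qed simp

lemma sqrt_iter_cadjoint:
  assumes "cadjoint X = X"
  shows "cadjoint (sqrt_iter X n) = sqrt_iter X n"
proof (induction n)
  case 0 show ?case by (rule cadjointI) simp
qed (simp add: cadjoint_scaleC cadjoint_add cadjoint_mult assms)

lemma sqrt_iter_bound:
  assumes "\<And>x. norm (X \<cdot> x) \<le> norm x"
  shows "norm (sqrt_iter X n \<cdot> x) \<le> sqrt_bound n * norm x"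
proof (induction n arbitrary: x)
  case (Suc n)
  let ?Y = "sqrt_iter X n"
  have "norm (?Y \<cdot> ?Y \<cdot> x) \<le> sqrt_bound n * norm (?Y \<cdot> x)" by (rule Suc)
  also have "\<dots> \<le> sqrt_bound n * (sqrt_bound n * norm x)"
    using Suc[of x] sqrt_bound_01 mult_left_mono by blast
  finally have "norm (X \<cdot> x + ?Y \<cdot> ?Y \<cdot> x) \<le> norm x + (sqrt_bound n)\<^sup>2 * norm x"
    using norm_triangle_ineq[of "X \<cdot> x" "?Y \<cdot> ?Y \<cdot> x"] assms[of x] by (simp add: power2_eq_square mult_ac)
  moreover have "norm (sqrt_iter X (Suc n) \<cdot> x) = norm (X \<cdot> x + ?Y \<cdot> ?Y \<cdot> x) / 2"
    by (simp only: sqrt_iter.simps scaleC_bop.rep_eq plus_bop.rep_eq times_bop.rep_eq norm_scaleC)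
      (simp add: norm_divide)
  ultimately show ?case by (simp add: distrib_right add_divide_distrib)
qed simp

text \<open>Successive iterates Y and Z commute, so the next increment is (Z + Y)(Z - Y)/2. The
  increments of \<open>sqrt_bound\<close> satisfy the same identity, hence they dominate by
  induction.\<close>

lemma sqrt_iter_diff:
  assumes "\<And>x. norm (X \<cdot> x) \<le> norm x"
  shows "norm ((sqrt_iter X (Suc n) - sqrt_iter X n) \<cdot> x) \<le> (sqrt_bound (Suc n) - sqrt_bound n) * norm x"
proof (induction n arbitrary: x)
  case 0
  then show ?case using assms by (simp add: norm_scaleC norm_divide)
next
  case (Suc n)
  let ?Y = "sqrt_iter X n" and ?Z = "sqrt_iter X (Suc n)"
  have "?Y * X = X * ?Y" by (metis sqrt_iter_commute)
  then have comm: "?Y * ?Z = ?Z * ?Y" by (rule sqrt_iter_commute)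
  have "sqrt_iter X (Suc (Suc n)) - ?Z = (1/2) *\<^sub>C (?Z * ?Z - ?Y * ?Y)"
    unfolding sqrt_iter.simps(2)[of X "Suc n"] by (subst (3) sqrt_iter.simps(2))
      (simp add: complex_vector.scale_right_diff_distrib[symmetric] del: sqrt_iter.simps)
  also have "?Z * ?Z - ?Y * ?Y = (?Z + ?Y) * (?Z - ?Y)"
    using comm by (simp add: algebra_simps del: sqrt_iter.simps)
  finally have eq: "sqrt_iter X (Suc (Suc n)) - ?Z = (1/2) *\<^sub>C ((?Z + ?Y) * (?Z - ?Y))" .
  define w where "w = (?Z - ?Y) \<cdot> x"
  have "norm (?Z \<cdot> w + ?Y \<cdot> w) \<le> sqrt_bound (Suc n) * norm w + sqrt_bound n * norm w"
    using norm_triangle_ineq[of "?Z \<cdot> w" "?Y \<cdot> w"] sqrt_iter_bound[OF assms, of n w]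
      sqrt_iter_bound[OF assms, of "Suc n" w] by linarith
  also have "\<dots> = (sqrt_bound (Suc n) + sqrt_bound n) * norm w"
    by (simp add: distrib_right)
  also have "\<dots> \<le> (sqrt_bound (Suc n) + sqrt_bound n) * ((sqrt_bound (Suc n) - sqrt_bound n) * norm x)"
    unfolding w_def by (intro mult_left_mono Suc add_nonneg_nonneg) (use sqrt_bound_01 in blast)+
  also have "\<dots> = ((sqrt_bound (Suc n))\<^sup>2 - (sqrt_bound n)\<^sup>2) * norm x"
    by (simp add: algebra_simps power2_eq_square del: sqrt_bound.simps)
  also have "\<dots> = 2 * (sqrt_bound (Suc (Suc n)) - sqrt_bound (Suc n)) * norm x"
  proof -
    have "2 * sqrt_bound (Suc (Suc n)) = 1 + (sqrt_bound (Suc n))\<^sup>2" "2 * sqrt_bound (Suc n) = 1 + (sqrt_bound n)\<^sup>2"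
      by simp_all
    then show ?thesis by (simp add: right_diff_distrib del: sqrt_bound.simps)
  qed
  finally have "norm (?Z \<cdot> w + ?Y \<cdot> w)
      \<le> 2 * (sqrt_bound (Suc (Suc n)) - sqrt_bound (Suc n)) * norm x" .
  moreover have "norm ((sqrt_iter X (Suc (Suc n)) - ?Z) \<cdot> x) = norm (?Z \<cdot> w + ?Y \<cdot> w) / 2"
    unfolding eq w_def by (simp add: norm_scaleC norm_divide del: sqrt_iter.simps)
  ultimately show ?case by linarith
qed

lemma sqrt_iter_Cauchy:
  assumes "\<And>x. norm (X \<cdot> x) \<le> norm x"
  shows "Cauchy (\<lambda>n. sqrt_iter X n \<cdot> x)"
proof -
  have le: "norm (sqrt_iter X (n + k) \<cdot> x - sqrt_iter X n \<cdot> x) \<le> (sqrt_bound (n + k) - sqrt_bound n) * norm x" for n k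
  proof (induction k)
    case (Suc k)
    have "norm (sqrt_iter X (Suc (n + k)) \<cdot> x - sqrt_iter X (n + k) \<cdot> x)
      \<le> (sqrt_bound (Suc (n + k)) - sqrt_bound (n + k)) * norm x"
      using sqrt_iter_diff[OF assms, of "n + k" x] by simp
    then show ?case
      using Suc norm_triangle_ineq[of "sqrt_iter X (Suc (n + k)) \<cdot> x - sqrt_iter X (n + k) \<cdot> x"
        "sqrt_iter X (n + k) \<cdot> x - sqrt_iter X n \<cdot> x"]
      by (simp add: algebra_simps del: sqrt_iter.simps sqrt_bound.simps)
  qed simp
  have le': "dist (sqrt_iter X m \<cdot> x) (sqrt_iter X n \<cdot> x) \<le> dist (sqrt_bound m) (sqrt_bound n) * norm x" for m n
  proof (cases "m \<le> n")
    case True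
    then show ?thesis using le[of m "n - m"]
      by (simp add: dist_norm norm_minus_commute)
        (metis abs_ge_self abs_minus_commute mult_right_mono norm_ge_zero order_trans)
  next
    case False
    then show ?thesis using le[of n "m - n"]
      by (simp add: dist_norm)
        (metis abs_ge_self mult_right_mono norm_ge_zero order_trans)
  qed
  show ?thesis
  proof (rule metric_CauchyI)
    fix e :: real assume e: "e > 0"
    then have "e / (norm x + 1) > 0" by (simp add: add_nonneg_pos)
    from metric_CauchyD[OF sqrt_bound_Cauchy this]
    obtain M where M: "\<And>m n. m \<ge> M \<Longrightarrow> n \<ge> M \<Longrightarrow> dist (sqrt_bound m) (sqrt_bound n) < e / (norm x + 1)"
      by blast
    have "dist (sqrt_iter X m \<cdot> x) (sqrt_iter X n \<cdot> x) < e" if "m \<ge> M" "n \<ge> M" for m n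
    proof -
      have "dist (sqrt_bound m) (sqrt_bound n) * norm x \<le> dist (sqrt_bound m) (sqrt_bound n) * (norm x + 1)"
        by (intro mult_left_mono) auto
      also have "\<dots> < e" using M[OF that] by (simp add: pos_less_divide_eq add_nonneg_pos)
      finally show ?thesis using le'[of m n] by simp
    qed
    then show "\<exists>M. \<forall>m\<ge>M. \<forall>n\<ge>M. dist (sqrt_iter X m \<cdot> x) (sqrt_iter X n \<cdot> x) < e" by blast
  qed
qed

lemma ex_sqrt_contraction:
  fixes X :: "'h::chilbert_space bop"
  assumes X: "\<And>x. norm (X \<cdot> x) \<le> norm x" and self: "cadjoint X = X"
  obtains Y where "2 *\<^sub>C Y = X + Y * Y" "\<And>x. norm (Y \<cdot> x) \<le> norm x" "cadjoint Y = Y"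
    "\<And>B. B * X = X * B \<Longrightarrow> B * Y = Y * B"
proof -
  define y where "y x = lim (\<lambda>n. sqrt_iter X n \<cdot> x)" for x
  have lim: "(\<lambda>n. sqrt_iter X n \<cdot> x) \<longlonglongrightarrow> y x" for x
    using sqrt_iter_Cauchy[OF X] by (simp add: y_def Cauchy_convergent_iff convergent_LIMSEQ_iff)
  have le1: "norm (sqrt_iter X n \<cdot> x) \<le> norm x" for n x
    using sqrt_iter_bound[OF X, of n x] sqrt_bound_01[of n] mult_right_mono[of "sqrt_bound n" 1 "norm x"] by simp
  have y_le: "norm (y x) \<le> norm x" for x
    using LIMSEQ_le_const2[OF tendsto_norm[OF lim]] le1 by blast
  have "y (x + z) = y x + y z" for x z
    by (rule LIMSEQ_unique[OF lim]) (auto simp: bop_add intro: tendsto_add lim)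
  moreover have "y (c *\<^sub>C x) = c *\<^sub>C y x" for c x
    by (rule LIMSEQ_unique[OF lim]) (auto intro: bounded_linear.tendsto[OF bounded_linear_scaleC] lim)
  ultimately obtain Y where Y: "\<And>x. Y \<cdot> x = y x"
    by (rule ex_bop[of y 1]) (use y_le in auto)
  have limY: "(\<lambda>n. sqrt_iter X n \<cdot> x) \<longlonglongrightarrow> Y \<cdot> x" for x using lim Y by simp
  \<comment> \<open>Pointwise limits need not respect products; the uniform bound \<open>le1\<close>
    on the iterates makes this one converge.\<close>
  have limYY: "(\<lambda>n. sqrt_iter X n \<cdot> sqrt_iter X n \<cdot> x) \<longlonglongrightarrow> Y \<cdot> Y \<cdot> x" for x
  proof -
    have "(\<lambda>n. sqrt_iter X n \<cdot> (sqrt_iter X n \<cdot> x - Y \<cdot> x)) \<longlonglongrightarrow> 0"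
    proof (rule Lim_null_comparison)
      show "\<forall>\<^sub>F n in sequentially. norm (sqrt_iter X n \<cdot> (sqrt_iter X n \<cdot> x - Y \<cdot> x)) \<le> norm (sqrt_iter X n \<cdot> x - Y \<cdot> x)"
        using le1 by simp
      show "(\<lambda>n. norm (sqrt_iter X n \<cdot> x - Y \<cdot> x)) \<longlonglongrightarrow> 0"
        using limY[of x] by (simp add: LIM_zero tendsto_norm_zero)
    qed
    from tendsto_add[OF this limY[of "Y \<cdot> x"]] show ?thesis by (simp add: bop_diff)
  qed
  have "2 *\<^sub>C Y = X + Y * Y"
  proof (rule bop_eqI)
    fix x
    have "(\<lambda>n. 2 *\<^sub>C (sqrt_iter X (Suc n) \<cdot> x)) \<longlonglongrightarrow> 2 *\<^sub>C (Y \<cdot> x)"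
      by (intro bounded_linear.tendsto[OF bounded_linear_scaleC] LIMSEQ_Suc[OF limY])
    moreover have "(\<lambda>n. 2 *\<^sub>C (sqrt_iter X (Suc n) \<cdot> x)) \<longlonglongrightarrow> X \<cdot> x + Y \<cdot> Y \<cdot> x"
      by (simp add: scaleC_scaleC scaleC_one) (intro tendsto_intros limYY)
    ultimately show "(2 *\<^sub>C Y) \<cdot> x = (X + Y * Y) \<cdot> x"
      using LIMSEQ_unique by simp blast
  qed
  moreover have "norm (Y \<cdot> x) \<le> norm x" for x by (simp add: Y y_le)
  moreover have "cadjoint Y = Y"
  proof (rule cadjointI)
    fix x z
    have "(\<lambda>n. cinner (sqrt_iter X n \<cdot> x) z) \<longlonglongrightarrow> cinner (Y \<cdot> x) z" by (intro tendsto_intros limY)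
    moreover have "cinner (sqrt_iter X n \<cdot> x) z = cinner x (sqrt_iter X n \<cdot> z)" for n
      by (metis cinner_cadjoint sqrt_iter_cadjoint self)
    moreover have "(\<lambda>n. cinner x (sqrt_iter X n \<cdot> z)) \<longlonglongrightarrow> cinner x (Y \<cdot> z)" by (intro tendsto_intros limY)
    ultimately show "cinner (Y \<cdot> x) z = cinner x (Y \<cdot> z)" using LIMSEQ_unique by simp blast
  qed
  moreover have "B * Y = Y * B" if B: "B * X = X * B" for B
  proof (rule bop_eqI)
    fix x
    have "(\<lambda>n. (B * sqrt_iter X n) \<cdot> x) \<longlonglongrightarrow> B \<cdot> Y \<cdot> x" by (simp, intro tendsto_intros limY)
    moreover have "(\<lambda>n. (B * sqrt_iter X n) \<cdot> x) \<longlonglongrightarrow> Y \<cdot> B \<cdot> x"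
      unfolding sqrt_iter_commute[OF B] by (simp add: limY)
    ultimately show "(B * Y) \<cdot> x = (Y * B) \<cdot> x" using LIMSEQ_unique by simp blast
  qed
  ultimately show ?thesis by (rule that)
qed

text \<open>After scaling \<open>A\<close> into the unit ball, \<open>1 - A\<close> is a contraction and \<open>1 - Y\<close> is the root.\<close>

lemma ex_sqrt:
  fixes A :: "'h::chilbert_space bop"
  assumes A: "positive_op A"
  obtains B where "positive_op B" "B * B = A" "\<And>C. C * A = A * C \<Longrightarrow> C * B = B * C"
proof -
  obtain K0 where K0: "0 \<le> K0" "\<And>x. norm (A \<cdot> x) \<le> K0 * norm x" using bop_bounded by blast
  \<comment> \<open>A strictly positive bound, since A is going to be divided by it.\<close>
  define K where "K = K0 + 1"
  have K: "0 < K" "\<And>x. norm (A \<cdot> x) \<le> K * norm x"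
    using K0 by (auto simp: K_def distrib_right intro: order_trans add_increasing2)
  obtain I :: "'h bop" where I: "\<And>x. I \<cdot> x = x" "\<And>A. I * A = A" "\<And>A. A * I = A" using ex_bop_id by blast
  define X where "X = I - complex_of_real (1/K) *\<^sub>C A"
  have cX: "cinner (X \<cdot> x) y = cinner x y - of_real (1/K) * cinner (A \<cdot> x) y" for x y
    by (simp add: X_def I cinner_simps)
  have pos: "0 \<le> Re (cinner (X \<cdot> x) x)" for x
  proof -
    have "Re (cinner (A \<cdot> x) x) \<le> norm (A \<cdot> x) * norm x"
      using norm_cinner_le complex_Re_le_cmod order_trans by blast
    also have "\<dots> \<le> K * (norm x)\<^sup>2"
      using mult_right_mono[OF K(2)[of x], of "norm x"] by (simp add: power2_eq_square)
    finally show ?thesis using K(1) unfolding cX power2_norm_eq_Re_cinner by (simp add: field_simps)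
  qed
  have herm: "cinner (X \<cdot> x) y = cinner x (X \<cdot> y)" for x y
    using positive_op_cinner_commute[OF A] by (simp add: X_def I cinner_simps)
  then have "cadjoint X = X" by (rule cadjointI)
  have "norm (X \<cdot> x) \<le> norm x" for x
  proof -
    \<comment> \<open>X lies between 0 and the identity as a quadratic form. Cauchy-Schwarz for this
      form at x and \<open>X \<cdot> x\<close> turns that into a norm bound.\<close>
    have le: "Re (cinner (X \<cdot> z) z) \<le> (norm z)\<^sup>2" for z
      using positive_opD[OF A, of z] K(1) unfolding cX power2_norm_eq_Re_cinner by simp
    have "(cmod (cinner (X \<cdot> x) (X \<cdot> x)))\<^sup>2 \<le> Re (cinner (X \<cdot> x) x) * Re (cinner (X \<cdot> X \<cdot> x) (X \<cdot> x))"
    proof (rule sesquilinear_Cauchy_Schwarz[of "\<lambda>x y. cinner (X \<cdot> x) y"])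
      show "cinner (X \<cdot> x) y = cnj (cinner (X \<cdot> y) x)" for x y by (metis herm cinner_commute)
    qed (simp_all add: bop_add cinner_simps pos)
    also have "\<dots> \<le> (norm x)\<^sup>2 * (norm (X \<cdot> x))\<^sup>2" by (intro mult_mono le pos) auto
    also have "cmod (cinner (X \<cdot> x) (X \<cdot> x)) = (norm (X \<cdot> x))\<^sup>2"
      by (simp flip: power2_norm_eq_cinner add: norm_power)
    finally have "(norm (X \<cdot> x))\<^sup>2 * (norm (X \<cdot> x))\<^sup>2 \<le> (norm x)\<^sup>2 * (norm (X \<cdot> x))\<^sup>2"
      by (simp add: power2_eq_square)
    then have "(norm (X \<cdot> x))\<^sup>2 \<le> (norm x)\<^sup>2" if "X \<cdot> x \<noteq> 0"
      using that by (meson mult_right_le_imp_le zero_less_norm_iff zero_less_power)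
    then show ?thesis by (cases "X \<cdot> x = 0") (simp, rule power2_le_imp_le, simp_all)
  qed
  then obtain Y where Y: "2 *\<^sub>C Y = X + Y * Y" "\<And>x. norm (Y \<cdot> x) \<le> norm x" "cadjoint Y = Y"
    "\<And>B. B * X = X * B \<Longrightarrow> B * Y = Y * B"
    using ex_sqrt_contraction \<open>cadjoint X = X\<close> by blast
  \<comment> \<open>The square of I - Y is I - X, which is A divided by K; the factor
    \<open>sqrt K\<close> undoes the scaling.\<close>
  define B where "B = complex_of_real (sqrt K) *\<^sub>C (I - Y)"
  have "positive_op B"
    unfolding positive_op_def
  proof
    fix x
    have "cnj (cinner (Y \<cdot> x) x) = cinner (Y \<cdot> x) x"
      by (metis Y(3) cinner_cadjoint cinner_commute)
    then have "Im (cinner (Y \<cdot> x) x) = 0" by (simp add: complex_eq_iff)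
    moreover have "Im (cinner x x) = 0" by (simp flip: power2_norm_eq_cinner)
    moreover have "Re (cinner (Y \<cdot> x) x) \<le> Re (cinner x x)"
    proof -
      have "Re (cinner (Y \<cdot> x) x) \<le> norm (Y \<cdot> x) * norm x"
        using norm_cinner_le complex_Re_le_cmod order_trans by blast
      also have "\<dots> \<le> norm x * norm x" by (intro mult_right_mono Y) auto
      finally show ?thesis by (simp add: power2_eq_square flip: power2_norm_eq_Re_cinner)
    qed
    ultimately show "cinner (B \<cdot> x) x \<in> \<real>\<^sub>\<ge>\<^sub>0"
      using K(1) by (simp add: B_def I cinner_simps complex_nonneg_Reals_iff)
  qed
  moreover have "B * B = A"
  proof -
    have "2 *\<^sub>C Y = Y + Y" by (metis one_add_one scaleC_add_left scaleC_one)
    then have YY: "Y * Y = Y + Y - X" using Y(1) by (simp add: eq_diff_eq add.commute)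
    have "(I - Y) * (I - Y) = I - Y - Y + Y * Y" by (simp add: algebra_simps I)
    then have "(I - Y) * (I - Y) = I - X" by (simp add: YY)
    then have "B * B = complex_of_real K *\<^sub>C (I - X)"
      using K(1) unfolding B_def bop_mult_scaleC by (simp add: scaleC_scaleC flip: of_real_mult)
    also have "\<dots> = A"
      using K(1) by (simp add: X_def scaleC_scaleC scaleC_one flip: of_real_mult)
    finally show ?thesis .
  qed
  moreover have "C * B = B * C" if C: "C * A = A * C" for C
  proof -
    have "C * X = X * C"
      by (simp add: X_def bop_mult_scaleC right_diff_distrib left_diff_distrib I C)
    then have "C * Y = Y * C" by (rule Y(4))
    then show ?thesis by (simp add: B_def bop_mult_scaleC right_diff_distrib left_diff_distrib I)
  qed
  ultimately show ?thesis using that by blast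
qed

text \<open>A competing root C commutes with A = C C and hence with B, so (C + B)(C - B) = 0. By
  positivity both C and B vanish on the range of C - B, and self-adjointness then makes C - B itself
  vanish.\<close>

lemma sqrt_op_ex1:
  assumes A: "positive_op A"
  shows "\<exists>!B. positive_op B \<and> B * B = A"
proof -
  obtain B where B: "positive_op B" "B * B = A" "\<And>C. C * A = A * C \<Longrightarrow> C * B = B * C"
    using ex_sqrt[OF A] by blast
  have "C = B" if C: "positive_op C" "C * C = A" for C
  proof (rule bop_eqI)
    fix x
    have "C * A = A * C" using C(2) by (metis mult.assoc)
    then have comm: "C * B = B * C" by (rule B(3))
    define y where "y = (C - B) \<cdot> x"
    have "(C + B) * (C - B) = 0" using comm by (simp add: algebra_simps B(2) C(2))
    then have "(C + B) \<cdot> y = 0" unfolding y_def by (metis times_bop.rep_eq zero_bop.rep_eq)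
    then have "Re (cinner (C \<cdot> y) y) + Re (cinner (B \<cdot> y) y) = 0"
      by (metis cinner_add_left cinner_zero_left plus_bop.rep_eq plus_complex.sel(1) zero_complex.sel(1))
    then have "Re (cinner (C \<cdot> y) y) = 0" "Re (cinner (B \<cdot> y) y) = 0"
      using positive_opD[OF B(1), of y] positive_opD[OF C(1), of y] by linarith+
    then have "C \<cdot> y = 0" "B \<cdot> y = 0" using positive_op_eq_0 B(1) C(1) by blast+
    then have "(C - B) \<cdot> y = 0" by simp
    moreover have "cinner y y = cinner x ((C - B) \<cdot> y)"
    proof -
      have "cinner y y = cinner (C \<cdot> x) y - cinner (B \<cdot> x) y"
        by (subst (1) y_def) (simp add: cinner_simps)
      then show ?thesis
        by (simp add: positive_op_cinner_commute[OF B(1)] positive_op_cinner_commute[OF C(1)] cinner_simps)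
    qed
    ultimately have "y = 0" by (simp add: cinner_eq_zero_iff)
    then show "C \<cdot> x = B \<cdot> x" by (simp add: y_def)
  qed
  then show ?thesis using B by blast
qed

lemma sqrt_op:
  assumes "positive_op A"
  shows "positive_op (sqrt_op A)" "sqrt_op A * sqrt_op A = A"
  using theI'[OF sqrt_op_ex1[OF assms]] by (auto simp: sqrt_op_def)

lemma abs_op: "positive_op (abs_op A)" "abs_op A * abs_op A = cadjoint A * A"
  unfolding abs_op_def by (simp_all add: sqrt_op positive_op_cadjoint_mult)

text \<open>\<open>V\<close> is the adjoint of the partial isometry of the polar decomposition of \<open>A\<close>; it is obtained
  by representing \<open>|A| x \<mapsto> \<langle>A x, y\<rangle>\<close> on the range of \<open>|A|\<close>.\<close>

lemma polar_decomposition: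
  fixes A :: "'h::chilbert_space bop"
  obtains V where "V * A = abs_op A" "cadjoint V * abs_op A = A"
    "\<And>x. norm (V \<cdot> x) \<le> norm x" "\<And>x. norm (cadjoint V \<cdot> x) \<le> norm x"
proof -
  let ?P = "abs_op A"
  define R where "R = range (bop_apply ?P)"
  have R: "complex_vector.subspace R"
  proof (rule complex_vector.subspaceI)
    show "0 \<in> R" unfolding R_def by (rule range_eqI[of _ _ 0]) simp
    show "x + y \<in> R" if "x \<in> R" "y \<in> R" for x y
      using that by (auto simp: R_def simp flip: bop_add)
    show "c *\<^sub>C x \<in> R" if "x \<in> R" for c x
      using that by (auto simp: R_def simp flip: bop_scaleC)
  qed
  have inner: "cinner (?P \<cdot> x) (?P \<cdot> y) = cinner (A \<cdot> x) (A \<cdot> y)" for x y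
    by (metis abs_op cinner_cadjoint' positive_op_cadjoint times_bop.rep_eq)
  then have normeq: "norm (?P \<cdot> x) = norm (A \<cdot> x)" for x
    by (simp add: norm_eq_sqrt_cinner)
  have wd: "A \<cdot> x = A \<cdot> x'" if "?P \<cdot> x = ?P \<cdot> x'" for x x'
    using normeq[of "x - x'"] that by (simp add: bop_diff)
  have "\<exists>u. u \<in> closure R \<and> (\<forall>x. cinner (A \<cdot> x) y = cinner (?P \<cdot> x) u) \<and> norm u \<le> norm y" for y
  proof -
    \<comment> \<open>The choice of the preimage is harmless by \<open>wd\<close>: since
      \<open>?P\<close> and A have equal norms at every vector, they have the same kernel.\<close>
    define f where "f v = cinner (A \<cdot> (SOME x. ?P \<cdot> x = v)) y" for v
    have f: "f (?P \<cdot> x) = cinner (A \<cdot> x) y" for x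
      unfolding f_def using someI[of "\<lambda>z. ?P \<cdot> z = ?P \<cdot> x" x] wd by metis
    obtain u where "u \<in> closure R" "\<And>v. v \<in> R \<Longrightarrow> f v = cinner v u" "norm u \<le> norm y"
    proof (rule Riesz_subspace[OF R, of f "norm y"])
      fix v w c assume "v \<in> R" "w \<in> R"
      then obtain x z where [simp]: "v = ?P \<cdot> x" "w = ?P \<cdot> z" by (auto simp: R_def)
      show "f (v + w) = f v + f w"
        using f[of "x + z"] by (simp add: bop_add cinner_simps f)
    next
      fix v c assume "v \<in> R"
      then obtain x where [simp]: "v = ?P \<cdot> x" by (auto simp: R_def)
      show "f (c *\<^sub>C v) = c * f v"
        using f[of "c *\<^sub>C x"] by (simp add: cinner_simps f)
      show "cmod (f v) \<le> norm y * norm v"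
        using norm_cinner_le[of "A \<cdot> x" y] by (simp add: f normeq mult.commute)
    qed auto
    then show ?thesis using f by (metis R_def rangeI)
  qed
  then obtain v where v: "\<And>y. v y \<in> closure R" "\<And>x y. cinner (A \<cdot> x) y = cinner (?P \<cdot> x) (v y)"
    "\<And>y. norm (v y) \<le> norm y" by metis
  have clR: "complex_vector.subspace (closure R)" using R by (rule subspace_closure)
  \<comment> \<open>Vectors in the closure of R are determined by their inner products with R; this
    makes the chosen v linear.\<close>
  have uniq: "u = w" if "u \<in> closure R" "w \<in> closure R" "\<And>x. cinner (?P \<cdot> x) u = cinner (?P \<cdot> x) w" for u w
  proof -
    have "cinner (u - w) (u - w) = 0"
      by (rule orthogonal_closure[of R]) (use that clR in \<open>auto simp: R_def cinner_simps intro: complex_vector.subspace_diff\<close>)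
    then show ?thesis by (simp add: cinner_eq_zero_iff)
  qed
  have "v (y + z) = v y + v z" for y z
    by (rule uniq[OF v(1) complex_vector.subspace_add[OF clR v(1) v(1)]]) (simp add: cinner_simps flip: v(2))
  moreover have "v (c *\<^sub>C y) = c *\<^sub>C v y" for c y
    by (rule uniq[OF v(1) complex_vector.subspace_scale[OF clR v(1)]]) (simp add: cinner_simps flip: v(2))
  ultimately obtain V where V: "\<And>x. V \<cdot> x = v x"
    by (rule ex_bop[of v 1]) (use v(3) in auto)
  have "V * A = ?P"
  proof (rule bop_eqI)
    fix x
    have "?P \<cdot> x \<in> closure R" using closure_subset[of R] by (auto simp: R_def)
    then show "(V * A) \<cdot> x = ?P \<cdot> x"
      using uniq[OF v(1), of "?P \<cdot> x" "A \<cdot> x"] by (simp add: V inner flip: v(2))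
  qed
  moreover have "cadjoint V * ?P = A"
    by (rule bop_eqI_cinner) (simp add: V v(2) flip: cinner_cadjoint')
  moreover have "norm (V \<cdot> x) \<le> norm x" for x by (simp add: V v(3))
  moreover from this have "norm (cadjoint V \<cdot> x) \<le> norm x" for x
    using cadjoint_bounded[of V 1] by simp
  ultimately show ?thesis using that by blast
qed

section \<open>Orthonormal bases\<close>

text \<open>A maximal orthonormal set has dense span: otherwise Riesz on the span yields the
  projection u of some x outside its closure, and the normalised remainder x - u could be
  adjoined.\<close>

lemma ex_onb: "\<exists>E :: 'h::chilbert_space set. is_onb E"
proof -
  define ortho :: "'h set set"
    where "ortho = {E. (\<forall>x\<in>E. norm x = 1) \<and> (\<forall>x\<in>E. \<forall>y\<in>E. x \<noteq> y \<longrightarrow> cinner x y = 0)}"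
  have "\<exists>E\<in>ortho. \<forall>X\<in>ortho. E \<subseteq> X \<longrightarrow> X = E"
  proof (rule subset_Zorn')
    fix C assume "subset.chain ortho C"
    then have C: "C \<subseteq> ortho" "\<And>X Y. X \<in> C \<Longrightarrow> Y \<in> C \<Longrightarrow> X \<subseteq> Y \<or> Y \<subseteq> X"
      by (auto simp: subset_chain_def)
    have "cinner x y = 0" if "X \<in> C" "x \<in> X" "Y \<in> C" "y \<in> Y" "x \<noteq> y" for x y X Y
    proof -
      obtain Z where "Z \<in> C" "x \<in> Z" "y \<in> Z" using C(2)[of X Y] \<open>X \<in> C\<close> \<open>x \<in> X\<close> \<open>Y \<in> C\<close> \<open>y \<in> Y\<close> by blast
      then show ?thesis using C(1) \<open>x \<noteq> y\<close> by (auto simp: ortho_def)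
    qed
    then show "\<Union>C \<in> ortho" using C(1) unfolding ortho_def by blast
  qed
  then obtain E where E: "E \<in> ortho" and max: "\<And>X. X \<in> ortho \<Longrightarrow> E \<subseteq> X \<Longrightarrow> X = E" by blast
  have "closure (complex_vector.span E) = UNIV"
  proof (rule ccontr)
    assume "closure (complex_vector.span E) \<noteq> UNIV"
    then obtain x where x: "x \<notin> closure (complex_vector.span E)" by blast
    obtain u where u: "u \<in> closure (complex_vector.span E)"
      "\<And>v. v \<in> complex_vector.span E \<Longrightarrow> cinner v x = cinner v u"
      by (rule Riesz_subspace[of "complex_vector.span E" "\<lambda>v. cinner v x" "norm x"])
        (auto simp: cinner_simps norm_cinner_le mult.commute[of "norm x"])
    define z where "z = x - u"
    have "z \<noteq> 0" using x u(1) by (auto simp: z_def)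
    define e where "e = complex_of_real (1 / norm z) *\<^sub>C z"
    have e1: "norm e = 1" using \<open>z \<noteq> 0\<close> by (simp add: e_def norm_scaleC norm_divide)
    have e0: "cinner v e = 0" if "v \<in> E" for v
      using u(2)[OF complex_vector.span_base[OF that]] by (simp add: e_def z_def cinner_simps)
    then have e0': "cinner e v = 0" if "v \<in> E" for v
      using that by (metis cinner_commute complex_cnj_zero)
    have "insert e E \<in> ortho" using E e1 e0 e0' by (auto simp: ortho_def)
    then have "e \<in> E" using max by blast
    then have "cinner e e = 0" by (rule e0)
    then show False using e1 by (simp add: cinner_eq_zero_iff)
  qed
  with E have "is_onb E" by (simp add: is_onb_def ortho_def)
  then show ?thesis ..
qed

lemma is_onb_some_onb: "is_onb (some_onb :: 'h::chilbert_space set)"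
  unfolding some_onb_def by (rule someI_ex[OF ex_onb])

lemma norm_onb: "e \<in> some_onb \<Longrightarrow> norm e = 1"
  using is_onb_some_onb by (auto simp: is_onb_def)

lemma cinner_onb: "e \<in> some_onb \<Longrightarrow> f \<in> some_onb \<Longrightarrow> cinner e f = (if e = f then 1 else 0)"
  using is_onb_some_onb by (auto simp: is_onb_def norm_onb simp flip: power2_norm_eq_cinner)

lemma closure_span_onb: "closure (complex_vector.span some_onb) = UNIV"
  using is_onb_some_onb by (auto simp: is_onb_def)

lemma bop_eq_0_onb:
  fixes A :: "'h::chilbert_space bop"
  assumes "\<And>e. e \<in> some_onb \<Longrightarrow> A \<cdot> e = 0"
  shows "A = 0"
proof (rule bop_eqI)
  fix x :: 'h
  have 0: "A \<cdot> y = 0" if "y \<in> complex_vector.span some_onb" for y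
    using that by (induction rule: complex_vector.span_induct_alt) (simp_all add: bop_add assms)
  obtain f where f: "\<And>n. f n \<in> complex_vector.span some_onb" "f \<longlonglongrightarrow> x"
    using closure_span_onb closure_sequential[of x] by (metis UNIV_I)
  have "(\<lambda>n. A \<cdot> f n) \<longlonglongrightarrow> A \<cdot> x" by (intro tendsto_intros f)
  then show "A \<cdot> x = 0 \<cdot> x" using 0[OF f(1)] by (simp add: LIMSEQ_const_iff)
qed

section \<open>Finite projections, Bessel and Parseval\<close>

definition onb_proj :: "'h::chilbert_space set \<Rightarrow> 'h \<Rightarrow> 'h"
  where "onb_proj F x = (\<Sum>e\<in>F. cinner x e *\<^sub>C e)"

lemma cinner_onb_proj:
  assumes "finite F" "F \<subseteq> some_onb" "e \<in> F"
  shows "cinner (onb_proj F x) e = cinner x e"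
proof -
  have "cinner (onb_proj F x) e = (\<Sum>f\<in>F. cinner x f * cinner f e)"
    by (simp add: onb_proj_def cinner_sum_left cinner_simps)
  also have "\<dots> = (\<Sum>f\<in>F. if f = e then cinner x f else 0)"
    by (intro sum.cong) (use assms in \<open>auto simp: cinner_onb subset_iff\<close>)
  also have "\<dots> = cinner x e" using assms by simp
  finally show ?thesis .
qed

lemma norm_onb_proj:
  assumes "finite F" "F \<subseteq> some_onb"
  shows "(norm (onb_proj F x))\<^sup>2 = (\<Sum>e\<in>F. (cmod (cinner x e))\<^sup>2)"
proof -
  have "complex_of_real ((norm (onb_proj F x))\<^sup>2) = (\<Sum>e\<in>F. cinner x e * cinner e (onb_proj F x))"
    unfolding power2_norm_eq_cinner
    by (subst (1) onb_proj_def) (simp add: cinner_sum_left cinner_simps)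
  also have "\<dots> = (\<Sum>e\<in>F. complex_of_real ((cmod (cinner x e))\<^sup>2))"
  proof (rule sum.cong[OF refl])
    fix e assume "e \<in> F"
    then have "cinner e (onb_proj F x) = cnj (cinner x e)"
      using cinner_onb_proj[OF assms] by (metis cinner_commute)
    then show "cinner x e * cinner e (onb_proj F x) = complex_of_real ((cmod (cinner x e))\<^sup>2)"
      by (simp only: complex_norm_square)
  qed
  finally show ?thesis by (simp only: of_real_sum[symmetric] of_real_eq_iff)
qed

text \<open>Pythagoras at the projection. Taking y to be the projection gives Bessel; taking y close
  to x gives Parseval.\<close>

lemma norm_diff_onb_proj:
  assumes F: "finite F" "F \<subseteq> some_onb" and y: "y \<in> complex_vector.span F"
  shows "(norm (x - y))\<^sup>2 = (norm x)\<^sup>2 - (\<Sum>e\<in>F. (cmod (cinner x e))\<^sup>2) + (norm (onb_proj F x - y))\<^sup>2"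
proof -
  have 0: "cinner (x - onb_proj F x) v = 0" if "v \<in> complex_vector.span F" for v
    using that
    by (induction rule: complex_vector.span_induct_alt) (simp_all add: cinner_simps cinner_onb_proj[OF F])
  have P: "onb_proj F x \<in> complex_vector.span F"
    unfolding onb_proj_def
    by (intro complex_vector.span_sum complex_vector.span_scale complex_vector.span_base)
  have "(norm (x - v))\<^sup>2 = (norm (x - onb_proj F x))\<^sup>2 + (norm (onb_proj F x - v))\<^sup>2"
    if "v \<in> complex_vector.span F" for v
    using power2_norm_add[of "x - onb_proj F x" "onb_proj F x - v"]
      0[OF complex_vector.span_diff[OF P that]] by simp
  \<comment> \<open>The instance at 0 evaluates the distance from x to its projection.\<close>
  from this[OF y] this[OF complex_vector.span_zero] show ?thesis
    by (simp add: norm_onb_proj[OF F])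
qed

lemma Bessel:
  assumes "finite F" "F \<subseteq> some_onb"
  shows "(\<Sum>e\<in>F. (cmod (cinner x e))\<^sup>2) \<le> (norm x)\<^sup>2"
proof -
  have "onb_proj F x \<in> complex_vector.span F"
    unfolding onb_proj_def
    by (intro complex_vector.span_sum complex_vector.span_scale complex_vector.span_base)
  from norm_diff_onb_proj[OF assms this, of x] show ?thesis
    using zero_le_power2[of "norm (x - onb_proj F x)"] by simp
qed

text \<open>A vector of the span close to x involves finitely many basis vectors, and it stays in
  the span of every larger finite set; from there on the deficit in Bessel is at most its squared
  distance from x.\<close>

lemma Parseval: "((\<lambda>e. (cmod (cinner x e))\<^sup>2) has_sum (norm x)\<^sup>2) some_onb"
  unfolding has_sum_def tendsto_iff eventually_finite_subsets_at_top
proof (intro allI impI)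
  fix \<epsilon> :: real assume "\<epsilon> > 0"
  then have "sqrt \<epsilon> > 0" by simp
  moreover have "x \<in> closure (complex_vector.span some_onb)" by (simp add: closure_span_onb)
  ultimately obtain y where y: "y \<in> complex_vector.span some_onb" "dist y x < sqrt \<epsilon>"
    unfolding closure_approachable by blast
  then have y': "norm (x - y) < sqrt \<epsilon>" by (simp add: dist_norm norm_minus_commute)
  obtain F r where F: "finite F" "F \<subseteq> some_onb" "y = (\<Sum>a\<in>F. r a *\<^sub>C a)"
    using y(1) unfolding complex_vector.span_explicit by blast
  have yF: "y \<in> complex_vector.span F"
    unfolding F(3) by (intro complex_vector.span_sum complex_vector.span_scale complex_vector.span_base)
  have sq: "(norm (x - y))\<^sup>2 < \<epsilon>"
    using power_strict_mono[OF y', of 2] \<open>\<epsilon> > 0\<close> by simp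
  show "\<exists>X. finite X \<and> X \<subseteq> some_onb \<and> (\<forall>Y. finite Y \<and> X \<subseteq> Y \<and> Y \<subseteq> some_onb \<longrightarrow>
      dist (\<Sum>e\<in>Y. (cmod (cinner x e))\<^sup>2) ((norm x)\<^sup>2) < \<epsilon>)"
  proof (intro exI conjI allI impI, rule F(1), rule F(2))
    fix Y assume Y: "finite Y \<and> F \<subseteq> Y \<and> Y \<subseteq> some_onb"
    then have "y \<in> complex_vector.span Y" using yF complex_vector.span_mono by blast
    then have "(norm (x - y))\<^sup>2 \<ge> (norm x)\<^sup>2 - (\<Sum>e\<in>Y. (cmod (cinner x e))\<^sup>2)"
      using norm_diff_onb_proj[of Y y x] Y by simp
    then show "dist (\<Sum>e\<in>Y. (cmod (cinner x e))\<^sup>2) ((norm x)\<^sup>2) < \<epsilon>"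
      using Bessel[of Y x] Y sq by (simp add: dist_real_def)
  qed
qed

section \<open>Hilbert--Schmidt operators\<close>

text \<open>The sums here are sums of squares, hence open to Parseval and Cauchy-Schwarz. They are
  tied to \<open>some_onb\<close> because the trace is computed in that basis.\<close>

definition hilbert_schmidt :: "'h::chilbert_space bop set"
  where "hilbert_schmidt = {T. (\<lambda>e. (norm (T \<cdot> e))\<^sup>2) summable_on some_onb}"

definition hs_norm :: "'h::chilbert_space bop \<Rightarrow> real"
  where "hs_norm T = sqrt (\<Sum>\<^sub>\<infinity>e\<in>some_onb. (norm (T \<cdot> e))\<^sup>2)"

lemma hs_norm_nonneg [simp]: "0 \<le> hs_norm T"
  by (simp add: hs_norm_def infsum_nonneg)

lemma hs_norm_power2: "(hs_norm T)\<^sup>2 = (\<Sum>\<^sub>\<infinity>e\<in>some_onb. (norm (T \<cdot> e))\<^sup>2)"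
  by (simp add: hs_norm_def infsum_nonneg)

lemma hilbert_schmidtI:
  assumes "\<And>F. finite F \<Longrightarrow> F \<subseteq> some_onb \<Longrightarrow> (\<Sum>e\<in>F. (norm (T \<cdot> e))\<^sup>2) \<le> c\<^sup>2" "0 \<le> c"
  shows "T \<in> hilbert_schmidt" "hs_norm T \<le> c"
proof -
  have "(\<lambda>e. (norm (T \<cdot> e))\<^sup>2) summable_on some_onb"
    by (rule nonneg_bdd_above_summable_on) (auto intro!: bdd_aboveI2 assms)
  then show "T \<in> hilbert_schmidt" by (simp add: hilbert_schmidt_def)
  have "(\<Sum>\<^sub>\<infinity>e\<in>some_onb. (norm (T \<cdot> e))\<^sup>2) \<le> c\<^sup>2"
    by (rule infsum_le_finite_sums) (use \<open>_ summable_on _\<close> assms in auto)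
  then show "hs_norm T \<le> c"
    unfolding hs_norm_def using assms(2) real_le_lsqrt by blast
qed

lemma hs_sum_le:
  assumes "T \<in> hilbert_schmidt" "finite F" "F \<subseteq> some_onb"
  shows "(\<Sum>e\<in>F. (norm (T \<cdot> e))\<^sup>2) \<le> (hs_norm T)\<^sup>2"
  unfolding hs_norm_power2
  by (rule finite_sum_le_infsum) (use assms in \<open>auto simp: hilbert_schmidt_def\<close>)

text \<open>Both \<open>\<parallel>T\<parallel>\<^sub>2\<^sup>2\<close> and \<open>\<parallel>T\<^sup>*\<parallel>\<^sub>2\<^sup>2\<close> are the sum of all \<open>|\<langle>T e, f\<rangle>|\<^sup>2\<close>.\<close>

lemma hs_cadjoint_le:
  assumes T: "T \<in> hilbert_schmidt"
  shows "cadjoint T \<in> hilbert_schmidt" "hs_norm (cadjoint T) \<le> hs_norm T"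
proof -
  have "(\<Sum>f\<in>F. (norm (cadjoint T \<cdot> f))\<^sup>2) \<le> (hs_norm T)\<^sup>2" if F: "finite F" "F \<subseteq> some_onb" for F
  \<comment> \<open>Only finitely many f are summed: Parseval evaluates the sum over e, and Bessel
    for \<open>T \<cdot> e\<close> bounds each term. This avoids interchanging two infinite
    sums.\<close>
  proof (rule has_sum_mono)
    show "((\<lambda>e. \<Sum>f\<in>F. (cmod (cinner (cadjoint T \<cdot> f) e))\<^sup>2) has_sum (\<Sum>f\<in>F. (norm (cadjoint T \<cdot> f))\<^sup>2)) some_onb"
      using F(1) by (induction F rule: finite_induct) (auto intro: has_sum_add Parseval)
    show "((\<lambda>e. (norm (T \<cdot> e))\<^sup>2) has_sum (hs_norm T)\<^sup>2) some_onb"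
      using T unfolding hs_norm_power2 by (simp add: hilbert_schmidt_def)
    fix e :: 'a
    show "(\<Sum>f\<in>F. (cmod (cinner (cadjoint T \<cdot> f) e))\<^sup>2) \<le> (norm (T \<cdot> e))\<^sup>2"
      using Bessel[OF F, of "T \<cdot> e"] by (simp add: cmod_cinner_commute[of "cadjoint T \<cdot> _"] flip: cinner_cadjoint)
  qed
  then show "cadjoint T \<in> hilbert_schmidt" "hs_norm (cadjoint T) \<le> hs_norm T"
    using hilbert_schmidtI[of "cadjoint T" "hs_norm T"] by auto
qed

lemma hs_cadjoint [simp]: "cadjoint T \<in> hilbert_schmidt \<longleftrightarrow> T \<in> hilbert_schmidt"
  using hs_cadjoint_le(1) cadjoint_cadjoint by metis

lemma hs_norm_cadjoint: "T \<in> hilbert_schmidt \<Longrightarrow> hs_norm (cadjoint T) = hs_norm T"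
  using hs_cadjoint_le(2)[of T] hs_cadjoint_le(2)[of "cadjoint T"] by simp

lemma hs_mult_left:
  assumes T: "T \<in> hilbert_schmidt" and X: "\<And>x. norm (X \<cdot> x) \<le> K * norm x" "0 \<le> K"
  shows "X * T \<in> hilbert_schmidt" "hs_norm (X * T) \<le> K * hs_norm T"
proof -
  have "(\<Sum>e\<in>F. (norm ((X * T) \<cdot> e))\<^sup>2) \<le> (K * hs_norm T)\<^sup>2" if F: "finite F" "F \<subseteq> some_onb" for F
  proof -
    have "(\<Sum>e\<in>F. (norm ((X * T) \<cdot> e))\<^sup>2) \<le> (\<Sum>e\<in>F. K\<^sup>2 * (norm (T \<cdot> e))\<^sup>2)"
      by (intro sum_mono) (simp add: X power_mono flip: power_mult_distrib)
    also have "\<dots> \<le> K\<^sup>2 * (hs_norm T)\<^sup>2"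
      using hs_sum_le[OF T F] by (simp add: mult_left_mono flip: sum_distrib_left)
    finally show ?thesis by (simp add: power_mult_distrib)
  qed
  then show "X * T \<in> hilbert_schmidt" "hs_norm (X * T) \<le> K * hs_norm T"
    using hilbert_schmidtI[of "X * T" "K * hs_norm T"] X(2) by auto
qed

text \<open>X moves the basis vectors before T acts, so the sums cannot be compared term by term;
  taking adjoints turns this into a left multiplication.\<close>

lemma hs_mult_right:
  assumes T: "T \<in> hilbert_schmidt" and X: "\<And>x. norm (X \<cdot> x) \<le> K * norm x" "0 \<le> K"
  shows "T * X \<in> hilbert_schmidt" "hs_norm (T * X) \<le> K * hs_norm T"
proof -
  have eq: "T * X = cadjoint (cadjoint X * cadjoint T)" by (simp add: cadjoint_mult)
  note * = hs_mult_left[of "cadjoint T" "cadjoint X" K, OF _ cadjoint_bounded[OF X] X(2)]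
  show "T * X \<in> hilbert_schmidt" unfolding eq using T * by simp
  show "hs_norm (T * X) \<le> K * hs_norm T"
    unfolding eq using T * by (simp add: hs_norm_cadjoint)
qed

lemma hs_summable:
  assumes S: "S \<in> hilbert_schmidt" and T: "T \<in> hilbert_schmidt"
  shows "(\<lambda>e. cmod (cinner (T \<cdot> e) (S \<cdot> e))) summable_on some_onb"
    "cmod (\<Sum>\<^sub>\<infinity>e\<in>some_onb. cinner (T \<cdot> e) (S \<cdot> e)) \<le> hs_norm T * hs_norm S"
proof -
  have le: "(\<Sum>e\<in>F. cmod (cinner (T \<cdot> e) (S \<cdot> e))) \<le> hs_norm T * hs_norm S"
    if F: "finite F" "F \<subseteq> some_onb" for F
  proof -
    have "(\<Sum>e\<in>F. cmod (cinner (T \<cdot> e) (S \<cdot> e))) \<le> (\<Sum>e\<in>F. \<bar>norm (T \<cdot> e)\<bar> * \<bar>norm (S \<cdot> e)\<bar>)"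
      by (intro sum_mono) (simp add: norm_cinner_le)
    also have "\<dots> \<le> L2_set (\<lambda>e. norm (T \<cdot> e)) F * L2_set (\<lambda>e. norm (S \<cdot> e)) F"
      by (rule L2_set_mult_ineq)
    also have "\<dots> \<le> hs_norm T * hs_norm S"
      unfolding L2_set_def
      by (intro mult_mono real_le_lsqrt hs_sum_le S T F) (auto intro: sum_nonneg)
    finally show ?thesis .
  qed
  show abs: "(\<lambda>e. cmod (cinner (T \<cdot> e) (S \<cdot> e))) summable_on some_onb"
    by (rule nonneg_bdd_above_summable_on) (auto intro!: bdd_aboveI2 le)
  have "cmod (\<Sum>\<^sub>\<infinity>e\<in>some_onb. cinner (T \<cdot> e) (S \<cdot> e)) \<le> (\<Sum>\<^sub>\<infinity>e\<in>some_onb. cmod (cinner (T \<cdot> e) (S \<cdot> e)))"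
    by (rule norm_infsum_bound[OF abs])
  also have "\<dots> \<le> hs_norm T * hs_norm S"
    by (rule infsum_le_finite_sums[OF abs]) (rule le)
  finally show "cmod (\<Sum>\<^sub>\<infinity>e\<in>some_onb. cinner (T \<cdot> e) (S \<cdot> e)) \<le> hs_norm T * hs_norm S" .
qed

lemma hs_add:
  assumes S: "S \<in> hilbert_schmidt" and T: "T \<in> hilbert_schmidt"
  shows "S + T \<in> hilbert_schmidt"
proof -
  have "(\<lambda>e. 2 * (norm (S \<cdot> e))\<^sup>2 + 2 * (norm (T \<cdot> e))\<^sup>2) summable_on some_onb"
    using S T by (auto simp: hilbert_schmidt_def intro!: summable_on_add summable_on_cmult_right)
  then have "(\<lambda>e. (norm ((S + T) \<cdot> e))\<^sup>2) summable_on some_onb"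
  proof (rule summable_on_comparison_test)
    fix e :: 'a
    show "(norm ((S + T) \<cdot> e))\<^sup>2 \<le> 2 * (norm (S \<cdot> e))\<^sup>2 + 2 * (norm (T \<cdot> e))\<^sup>2"
      using power2_norm_add[of "S \<cdot> e" "T \<cdot> e"] power2_norm_diff[of "S \<cdot> e" "T \<cdot> e"]
        zero_le_power2[of "norm (S \<cdot> e - T \<cdot> e)"] by simp
  qed simp
  then show ?thesis by (simp add: hilbert_schmidt_def)
qed

lemma hs_scaleC:
  assumes T: "T \<in> hilbert_schmidt"
  shows "c *\<^sub>C T \<in> hilbert_schmidt" "hs_norm (c *\<^sub>C T) = cmod c * hs_norm T"
proof -
  have *: "(norm ((c *\<^sub>C T) \<cdot> e))\<^sup>2 = (cmod c)\<^sup>2 * (norm (T \<cdot> e))\<^sup>2" for e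
    by (simp add: norm_scaleC power_mult_distrib)
  show "c *\<^sub>C T \<in> hilbert_schmidt"
    using T unfolding hilbert_schmidt_def mem_Collect_eq * by (rule summable_on_cmult_right)
  show "hs_norm (c *\<^sub>C T) = cmod c * hs_norm T"
    unfolding hs_norm_def * by (simp add: infsum_cmult_right' real_sqrt_mult)
qed

lemma hs_diff: "S \<in> hilbert_schmidt \<Longrightarrow> T \<in> hilbert_schmidt \<Longrightarrow> S - T \<in> hilbert_schmidt"
  using hs_add[of S "(-1) *\<^sub>C T"] hs_scaleC(1)[of T "-1"] by simp

lemma cinner_polarization:
  "4 * cinner x y = of_real ((norm (x + y))\<^sup>2) - of_real ((norm (x - y))\<^sup>2)
    + \<i> * of_real ((norm (x + \<i> *\<^sub>C y))\<^sup>2) - \<i> * of_real ((norm (x - \<i> *\<^sub>C y))\<^sup>2)"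
  unfolding power2_norm_eq_cinner by (simp add: cinner_simps algebra_simps)

text \<open>By polarization, the inner product of Hilbert--Schmidt operators is determined by the norm,
  and the norm is invariant under taking adjoints.\<close>

lemma hs_cinner_polarization:
  assumes S: "S \<in> hilbert_schmidt" and T: "T \<in> hilbert_schmidt"
  shows "4 * (\<Sum>\<^sub>\<infinity>e\<in>some_onb. cinner (S \<cdot> e) (T \<cdot> e))
    = of_real ((hs_norm (S + T))\<^sup>2) - of_real ((hs_norm (S - T))\<^sup>2)
    + \<i> * of_real ((hs_norm (S + \<i> *\<^sub>C T))\<^sup>2) - \<i> * of_real ((hs_norm (S - \<i> *\<^sub>C T))\<^sup>2)"
proof -
  have hs: "((\<lambda>e. of_real ((norm (U \<cdot> e))\<^sup>2)) has_sum complex_of_real ((hs_norm U)\<^sup>2)) some_onb"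
    if "U \<in> hilbert_schmidt" for U :: "'a bop"
    using that unfolding hs_norm_power2 by (intro has_sum_of_real has_sum_infsum) (simp add: hilbert_schmidt_def)
  have diff: "((\<lambda>e. f e - g e) has_sum (a - b)) some_onb"
    if "(f has_sum a) some_onb" "(g has_sum b) some_onb" for f g :: "'a \<Rightarrow> complex" and a b
    using has_sum_add[OF that(1), of "\<lambda>e. - g e" "- b"] that(2) by (simp add: has_sum_uminus)
  have "S + T \<in> hilbert_schmidt" "S - T \<in> hilbert_schmidt"
    "S + \<i> *\<^sub>C T \<in> hilbert_schmidt" "S - \<i> *\<^sub>C T \<in> hilbert_schmidt"
    by (intro hs_add hs_diff hs_scaleC S T)+
  note this[THEN hs]
  from diff[OF has_sum_add[OF diff[OF this(1,2)] has_sum_cmult_right[OF this(3)]] has_sum_cmult_right[OF this(4)]]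
  have "((\<lambda>e. 4 * cinner (S \<cdot> e) (T \<cdot> e)) has_sum
    of_real ((hs_norm (S + T))\<^sup>2) - of_real ((hs_norm (S - T))\<^sup>2)
    + \<i> * of_real ((hs_norm (S + \<i> *\<^sub>C T))\<^sup>2) - \<i> * of_real ((hs_norm (S - \<i> *\<^sub>C T))\<^sup>2)) some_onb"
    unfolding cinner_polarization bop_rep_eq .
  from infsumI[OF this]
  show ?thesis by (simp add: infsum_cmult_right')
qed

text \<open>Adjunction carries the four operators of the polarization identity for S, T into those
  for the adjoints of T, S, up to factors 1, -1, i and -i. With \<open>cadjoint S\<close> in place
  of S this is cyclicity of the trace.\<close>

lemma hs_cinner_cadjoint:
  assumes S: "S \<in> hilbert_schmidt" and T: "T \<in> hilbert_schmidt"
  shows "(\<Sum>\<^sub>\<infinity>e\<in>some_onb. cinner (S \<cdot> e) (T \<cdot> e))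
    = (\<Sum>\<^sub>\<infinity>e\<in>some_onb. cinner (cadjoint T \<cdot> e) (cadjoint S \<cdot> e))"
proof -
  have adj: "hs_norm U = hs_norm V" if "U \<in> hilbert_schmidt" "V = c *\<^sub>C cadjoint U" "cmod c = 1" for U V :: "'a bop" and c
    using that by (simp add: hs_scaleC hs_norm_cadjoint)
  have 1: "hs_norm (S + T) = hs_norm (cadjoint T + cadjoint S)"
    by (rule adj[where c=1]) (simp_all add: hs_add S T cadjoint_add scaleC_one add.commute)
  have 2: "hs_norm (S - T) = hs_norm (cadjoint T - cadjoint S)"
    by (rule adj[where c="-1"])
      (simp_all add: hs_diff S T cadjoint_diff scaleC_one)
  have 3: "hs_norm (S + \<i> *\<^sub>C T) = hs_norm (cadjoint T + \<i> *\<^sub>C cadjoint S)"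
    by (rule adj[where c="\<i>"])
      (simp_all add: hs_add hs_scaleC S T cadjoint_add cadjoint_scaleC scaleC_add_right
        complex_vector.scale_right_diff_distrib scaleC_scaleC scaleC_one add.commute)
  have 4: "hs_norm (S - \<i> *\<^sub>C T) = hs_norm (cadjoint T - \<i> *\<^sub>C cadjoint S)"
    by (rule adj[where c="-\<i>"])
      (simp_all add: hs_diff hs_scaleC S T cadjoint_diff cadjoint_scaleC scaleC_add_right complex_vector.scale_right_diff_distrib scaleC_scaleC scaleC_one)
  have "4 * (\<Sum>\<^sub>\<infinity>e\<in>some_onb. cinner (S \<cdot> e) (T \<cdot> e))
    = 4 * (\<Sum>\<^sub>\<infinity>e\<in>some_onb. cinner (cadjoint T \<cdot> e) (cadjoint S \<cdot> e))"
    unfolding hs_cinner_polarization[OF S T]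
    by (subst hs_cinner_polarization) (simp_all add: S T 1 2 3 4)
  then show ?thesis by simp
qed

section \<open>Trace-class operators\<close>

text \<open>Ties the series that define trace class and trace norm to the Hilbert-Schmidt sums of
  the square root of |A|.\<close>

lemma cinner_abs_op_sqrt:
  "cinner (abs_op A \<cdot> e) e = of_real ((norm (sqrt_op (abs_op A) \<cdot> e))\<^sup>2)"
proof -
  let ?P = "sqrt_op (abs_op A)"
  have P: "positive_op ?P" "?P * ?P = abs_op A" using sqrt_op abs_op(1) by blast+
  then have "cinner (abs_op A \<cdot> e) e = cinner (?P \<cdot> ?P \<cdot> e) e" by (metis times_bop.rep_eq)
  also have "\<dots> = cinner (?P \<cdot> e) (?P \<cdot> e)" by (rule positive_op_cinner_commute[OF P(1)])
  finally show ?thesis by (simp only: power2_norm_eq_cinner)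
qed

lemma trace_class_iff: "A \<in> trace_class \<longleftrightarrow> sqrt_op (abs_op A) \<in> hilbert_schmidt"
proof -
  have "((\<lambda>e. complex_of_real (f e)) summable_on some_onb) \<longleftrightarrow> f summable_on some_onb" for f :: "'a \<Rightarrow> real"
    using summable_on_of_real summable_on_Re[of "\<lambda>e. complex_of_real (f e)" some_onb] by auto
  then show ?thesis
    by (simp only: trace_class_def hilbert_schmidt_def mem_Collect_eq cinner_abs_op_sqrt)
qed

lemma trace_norm_hs_norm:
  assumes "A \<in> trace_class"
  shows "trace_norm A = (hs_norm (sqrt_op (abs_op A)))\<^sup>2"
proof -
  have "((\<lambda>e. (norm (sqrt_op (abs_op A) \<cdot> e))\<^sup>2) has_sum (hs_norm (sqrt_op (abs_op A)))\<^sup>2) some_onb"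
    unfolding hs_norm_power2 using assms by (simp add: trace_class_iff hilbert_schmidt_def)
  from infsumI[OF has_sum_of_real[OF this, where 'a = complex]] show ?thesis
    by (simp add: trace_norm_def tr_def cinner_abs_op_sqrt)
qed

lemma trace_norm_nonneg: "A \<in> trace_class \<Longrightarrow> 0 \<le> trace_norm A"
  by (simp add: trace_norm_hs_norm)

text \<open>\<open>A = (V\<^sup>* P) P\<close> with \<open>P = \<surd>|A|\<close> and \<open>V\<^sup>*\<close> the partial isometry of the polar decomposition.\<close>

lemma trace_class_factor:
  assumes A: "A \<in> trace_class"
  obtains S T where "S \<in> hilbert_schmidt" "T \<in> hilbert_schmidt" "A = S * T"
    "hs_norm S * hs_norm T \<le> trace_norm A"
proof -
  let ?P = "sqrt_op (abs_op A)"
  have P: "?P * ?P = abs_op A" "?P \<in> hilbert_schmidt"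
    using sqrt_op abs_op(1) A trace_class_iff by blast+
  obtain V where V: "cadjoint V * abs_op A = A" "\<And>x. norm (cadjoint V \<cdot> x) \<le> norm x"
    using polar_decomposition by metis
  define S where "S = cadjoint V * ?P"
  have S: "S \<in> hilbert_schmidt" "hs_norm S \<le> 1 * hs_norm ?P"
    using hs_mult_left[OF P(2), of "cadjoint V" 1] V(2) by (auto simp: S_def)
  have "A = S * ?P" unfolding S_def using V(1) P(1) by (metis mult.assoc)
  moreover have "hs_norm S * hs_norm ?P \<le> trace_norm A"
    using S mult_right_mono[of "hs_norm S" "hs_norm ?P" "hs_norm ?P"]
    by (simp add: trace_norm_hs_norm[OF A] power2_eq_square)
  ultimately show ?thesis using that S P by blast
qed

lemma hs_mult_summable:
  assumes S: "S \<in> hilbert_schmidt" and T: "T \<in> hilbert_schmidt"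
  shows "(\<lambda>e. cinner ((S * T) \<cdot> e) e) summable_on some_onb"
    "cmod (tr (S * T)) \<le> hs_norm S * hs_norm T"
proof -
  have eq: "cinner ((S * T) \<cdot> e) e = cinner (T \<cdot> e) (cadjoint S \<cdot> e)" for e
    by (simp add: cinner_cadjoint)
  show "(\<lambda>e. cinner ((S * T) \<cdot> e) e) summable_on some_onb"
    unfolding eq by (rule abs_summable_summable, rule hs_summable) (use S T in simp_all)
  show "cmod (tr (S * T)) \<le> hs_norm S * hs_norm T"
    unfolding tr_def eq using hs_summable(2)[of "cadjoint S" T] S T
    by (simp add: hs_norm_cadjoint mult.commute)
qed

lemma abs_op_mult_summable:
  assumes "(\<lambda>e. cinner (abs_op A \<cdot> e) e) summable_on some_onb" "cmod (tr (abs_op A)) \<le> K"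
  shows "A \<in> trace_class" "trace_norm A \<le> K"
  using assms complex_Re_le_cmod order_trans by (auto simp: trace_class_def trace_norm_def)

text \<open>Converse of \<open>trace_class_factor\<close>: the polar decomposition writes |S T| as
  (V S) T with a contraction V, again a product of Hilbert-Schmidt operators, so its trace is under
  control.\<close>

lemma hs_mult_trace_class:
  assumes S: "S \<in> hilbert_schmidt" and T: "T \<in> hilbert_schmidt"
  shows "S * T \<in> trace_class" "trace_norm (S * T) \<le> hs_norm S * hs_norm T"
proof -
  obtain V where V: "V * (S * T) = abs_op (S * T)" "\<And>x. norm (V \<cdot> x) \<le> norm x"
    using polar_decomposition by metis
  have VS: "V * S \<in> hilbert_schmidt" "hs_norm (V * S) \<le> 1 * hs_norm S"
    using hs_mult_left[OF S, of V 1] V(2) by auto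
  have eq: "abs_op (S * T) = (V * S) * T" using V(1) by (simp add: mult.assoc)
  have "cmod (tr (abs_op (S * T))) \<le> hs_norm (V * S) * hs_norm T"
    unfolding eq by (rule hs_mult_summable(2)[OF VS(1) T])
  also have "\<dots> \<le> hs_norm S * hs_norm T" using VS(2) by (simp add: mult_right_mono)
  finally show "S * T \<in> trace_class" "trace_norm (S * T) \<le> hs_norm S * hs_norm T"
    using abs_op_mult_summable hs_mult_summable(1)[OF VS(1) T] eq by metis+
qed

lemma trace_class_summable:
  assumes A: "A \<in> trace_class"
  shows "(\<lambda>e. cinner (A \<cdot> e) e) summable_on some_onb" "cmod (tr A) \<le> trace_norm A"
  using trace_class_factor[OF A] hs_mult_summable order_trans by metis+

text \<open>X is absorbed into the left one of the two Hilbert-Schmidt factors, which grows by at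
  most K.\<close>

lemma trace_class_mult_left:
  assumes A: "A \<in> trace_class" and X: "\<And>x. norm (X \<cdot> x) \<le> K * norm x" "0 \<le> K"
  shows "X * A \<in> trace_class" "trace_norm (X * A) \<le> K * trace_norm A"
proof -
  obtain S T where ST: "S \<in> hilbert_schmidt" "T \<in> hilbert_schmidt" "A = S * T"
    "hs_norm S * hs_norm T \<le> trace_norm A" using trace_class_factor[OF A] by blast
  have eq: "X * A = (X * S) * T" by (simp add: ST(3) mult.assoc)
  note XS = hs_mult_left[OF ST(1) X]
  show "X * A \<in> trace_class" unfolding eq by (rule hs_mult_trace_class[OF XS(1) ST(2)])
  have "trace_norm (X * A) \<le> hs_norm (X * S) * hs_norm T"
    unfolding eq by (rule hs_mult_trace_class(2)[OF XS(1) ST(2)])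
  also have "\<dots> \<le> (K * hs_norm S) * hs_norm T" by (intro mult_right_mono XS) simp
  also have "\<dots> \<le> K * trace_norm A" using mult_left_mono[OF ST(4) X(2)] by (simp add: mult.assoc)
  finally show "trace_norm (X * A) \<le> K * trace_norm A" .
qed

lemma trace_class_mult_right:
  assumes A: "A \<in> trace_class" and X: "\<And>x. norm (X \<cdot> x) \<le> K * norm x" "0 \<le> K"
  shows "A * X \<in> trace_class" "trace_norm (A * X) \<le> K * trace_norm A"
proof -
  obtain S T where ST: "S \<in> hilbert_schmidt" "T \<in> hilbert_schmidt" "A = S * T"
    "hs_norm S * hs_norm T \<le> trace_norm A" using trace_class_factor[OF A] by blast
  have eq: "A * X = S * (T * X)" by (simp add: ST(3) mult.assoc)
  note TX = hs_mult_right[OF ST(2) X]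
  show "A * X \<in> trace_class" unfolding eq by (rule hs_mult_trace_class[OF ST(1) TX(1)])
  have "trace_norm (A * X) \<le> hs_norm S * hs_norm (T * X)"
    unfolding eq by (rule hs_mult_trace_class(2)[OF ST(1) TX(1)])
  also have "\<dots> \<le> hs_norm S * (K * hs_norm T)" by (intro mult_left_mono TX) simp
  also have "\<dots> \<le> K * trace_norm A" using mult_left_mono[OF ST(4) X(2)] by (simp add: mult_ac)
  finally show "trace_norm (A * X) \<le> K * trace_norm A" .
qed

lemma trace_class_mult:
  assumes "A \<in> trace_class"
  shows "X * A \<in> trace_class" "A * X \<in> trace_class"
  using bop_bounded[of X] trace_class_mult_left(1)[OF assms] trace_class_mult_right(1)[OF assms] by metis+

lemma tr_add:
  assumes "A \<in> trace_class" "B \<in> trace_class"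
  shows "tr (A + B) = tr A + tr B"
  unfolding tr_def using trace_class_summable(1)[OF assms(1)] trace_class_summable(1)[OF assms(2)]
  by (simp add: cinner_add_left infsum_add)

lemma tr_scaleC: "tr (c *\<^sub>C A) = c * tr A"
  by (simp add: tr_def cinner_scaleC_left infsum_cmult_right')

lemma tr_0 [simp]: "tr 0 = 0"
  by (simp add: tr_def)

text \<open>The absolute value is not additive, but |A + B| = V A + V B for a contraction V; this
  reduces the triangle inequality to additivity of the trace and the bound |tr X| \<le>
  ||X||_1.\<close>

lemma trace_class_add:
  fixes A B :: "'h::chilbert_space bop"
  assumes A: "A \<in> trace_class" and B: "B \<in> trace_class"
  shows "A + B \<in> trace_class" "trace_norm (A + B) \<le> trace_norm A + trace_norm B"
proof -
  obtain V where V: "V * (A + B) = abs_op (A + B)" "\<And>x. norm (V \<cdot> x) \<le> norm x"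
    using polar_decomposition by metis
  then have V1: "norm (V \<cdot> x) \<le> 1 * norm x" for x by simp
  have eq: "abs_op (A + B) = V * A + V * B" using V(1) by (simp add: distrib_left)
  note VA = trace_class_mult_left[OF A V1] and VB = trace_class_mult_left[OF B V1]
  have "cmod (tr (abs_op (A + B))) \<le> cmod (tr (V * A)) + cmod (tr (V * B))"
    unfolding eq by (subst tr_add) (use VA VB norm_triangle_ineq in auto)
  also have "\<dots> \<le> trace_norm A + trace_norm B"
    using VA VB trace_class_summable(2)[of "V * A"] trace_class_summable(2)[of "V * B"] by simp
  finally have le: "cmod (tr (abs_op (A + B))) \<le> trace_norm A + trace_norm B" .
  have "(\<lambda>e. cinner ((V * A) \<cdot> e) e + cinner ((V * B) \<cdot> e) e) summable_on some_onb"
    using VA VB by (intro summable_on_add trace_class_summable) auto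
  then have "(\<lambda>e. cinner (abs_op (A + B) \<cdot> e) e) summable_on some_onb"
    by (simp add: eq cinner_add_left)
  then show "A + B \<in> trace_class" "trace_norm (A + B) \<le> trace_norm A + trace_norm B"
    using abs_op_mult_summable le by blast+
qed

lemma trace_class_scaleC:
  fixes A :: "'h::chilbert_space bop"
  assumes A: "A \<in> trace_class"
  shows "c *\<^sub>C A \<in> trace_class" "trace_norm (c *\<^sub>C A) \<le> cmod c * trace_norm A"
proof -
  obtain I :: "'h bop" where I: "\<And>x. I \<cdot> x = x" "\<And>A. I * A = A" "\<And>A. A * I = A" using ex_bop_id by blast
  have "c *\<^sub>C A = (c *\<^sub>C I) * A" by (simp add: bop_mult_scaleC I)
  moreover have "norm ((c *\<^sub>C I) \<cdot> x) \<le> cmod c * norm x" for x by (simp add: I norm_scaleC)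
  ultimately show "c *\<^sub>C A \<in> trace_class" "trace_norm (c *\<^sub>C A) \<le> cmod c * trace_norm A"
    using trace_class_mult_left[OF A, of "c *\<^sub>C I" "cmod c"] by auto
qed

lemma hs_zero: "0 \<in> hilbert_schmidt" "hs_norm 0 = 0"
  by (simp_all add: hilbert_schmidt_def hs_norm_def)

lemma zero_trace_class [simp]: "0 \<in> trace_class"
  using hs_mult_trace_class(1)[OF hs_zero(1) hs_zero(1)] by simp

lemma trace_norm_0 [simp]: "trace_norm (0 :: 'h::chilbert_space bop) = 0"
proof -
  have "trace_norm (0 * 0 :: 'h bop) \<le> hs_norm (0 :: 'h bop) * hs_norm (0 :: 'h bop)"
    by (intro hs_mult_trace_class hs_zero)
  moreover have "0 \<le> trace_norm (0 :: 'h bop)" by (intro trace_norm_nonneg zero_trace_class)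
  ultimately show ?thesis by (simp add: hs_zero)
qed

lemma subspace_trace_class: "complex_vector.subspace trace_class"
  by (rule complex_vector.subspaceI) (simp_all add: trace_class_add trace_class_scaleC)

lemmas trace_class_diff = complex_vector.subspace_diff[OF subspace_trace_class]

lemma trace_norm_scaleC:
  assumes "A \<in> trace_class"
  shows "trace_norm (c *\<^sub>C A) = cmod c * trace_norm A"
proof (cases "c = 0")
  case False
  have "trace_norm ((1/c) *\<^sub>C c *\<^sub>C A) \<le> cmod (1/c) * trace_norm (c *\<^sub>C A)"
    by (intro trace_class_scaleC assms)
  then have "cmod c * trace_norm A \<le> trace_norm (c *\<^sub>C A)"
    using False by (simp add: scaleC_scaleC scaleC_one norm_divide field_simps)
  then show ?thesis using trace_class_scaleC(2)[OF assms, of c] by simp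
qed simp

lemma trace_norm_minus_commute:
  assumes "A \<in> trace_class" "B \<in> trace_class"
  shows "trace_norm (A - B) = trace_norm (B - A)"
  using trace_norm_scaleC[OF trace_class_diff[OF assms], of "-1"] by simp

text \<open>The trace norm is the squared Hilbert-Schmidt norm of the root of |A|, so this root
  vanishes on the basis; the polar decomposition recovers A from |A|.\<close>

lemma trace_norm_eq_0:
  assumes A: "A \<in> trace_class" and 0: "trace_norm A = 0"
  shows "A = 0"
proof -
  let ?P = "sqrt_op (abs_op A)"
  have P: "?P \<in> hilbert_schmidt" "hs_norm ?P = 0" using A 0 by (simp_all add: trace_class_iff trace_norm_hs_norm)
  have "?P = 0"
  proof (rule bop_eq_0_onb)
    fix e :: 'a assume "e \<in> some_onb"
    then show "?P \<cdot> e = 0" using hs_sum_le[OF P(1), of "{e}"] P(2) by simp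
  qed
  then have "abs_op A = 0" using sqrt_op(2)[OF abs_op(1)] by (metis mult_zero_left)
  moreover obtain V where "cadjoint V * abs_op A = A" using polar_decomposition by metis
  ultimately show ?thesis by (metis mult_zero_right)
qed

lemma tr_hs_commute:
  assumes S: "S \<in> hilbert_schmidt" and T: "T \<in> hilbert_schmidt"
  shows "tr (S * T) = tr (T * S)"
  using hs_cinner_cadjoint[of T "cadjoint S"] S T by (simp add: tr_def cinner_cadjoint)

text \<open>X itself need not be Hilbert-Schmidt, so it is attached to one factor of A = S T at a
  time: tr (X S T) = tr (T X S) = tr (S T X), where each swap exchanges two Hilbert-Schmidt
  operators.\<close>

lemma tr_commute:
  assumes A: "A \<in> trace_class"
  shows "tr (X * A) = tr (A * X)"
proof -
  obtain S T where ST: "S \<in> hilbert_schmidt" "T \<in> hilbert_schmidt" "A = S * T"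
    using trace_class_factor[OF A] by blast
  obtain K where K: "\<And>x. norm (X \<cdot> x) \<le> K * norm x" "0 \<le> K" using bop_bounded by metis
  have "tr (X * A) = tr (X * S * T)" by (simp add: ST mult.assoc)
  also have "\<dots> = tr (T * (X * S))" by (rule tr_hs_commute) (use ST K hs_mult_left in blast)+
  also have "\<dots> = tr (T * X * S)" by (simp add: mult.assoc)
  also have "\<dots> = tr (S * (T * X))" by (rule tr_hs_commute) (use ST K hs_mult_right in blast)+
  finally show ?thesis by (simp add: ST mult.assoc)
qed

section \<open>Rank-one operators and the dual of the trace class\<close>

lift_definition rank_one :: "'h::chilbert_space \<Rightarrow> 'h \<Rightarrow> 'h bop" is "\<lambda>x y z. cinner z y *\<^sub>C x"
proof
  fix x y :: 'h
  show "bounded_linear (\<lambda>z. cinner z y *\<^sub>C x)"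
  proof (rule bounded_linear_intro)
    show "norm (cinner z y *\<^sub>C x) \<le> norm z * (norm y * norm x)" for z
      using mult_right_mono[OF norm_cinner_le[of z y], of "norm x"] by (simp add: norm_scaleC mult.assoc)
  qed (simp_all add: cinner_add_left cinner_scaleC_left scaleC_add_left scaleR_scaleC scaleC_scaleC)
qed (simp add: cinner_simps scaleC_scaleC)

lemmas rank_one_apply [simp] = rank_one.rep_eq

lemma hs_rank_one: "rank_one x y \<in> hilbert_schmidt" "hs_norm (rank_one x y) \<le> norm x * norm y"
proof -
  have "(\<Sum>e\<in>F. (norm (rank_one x y \<cdot> e))\<^sup>2) \<le> (norm x * norm y)\<^sup>2"
    if "finite F" "F \<subseteq> some_onb" for F
  proof -
    have "(\<Sum>e\<in>F. (norm (rank_one x y \<cdot> e))\<^sup>2) = (\<Sum>e\<in>F. (cmod (cinner y e))\<^sup>2) * (norm x)\<^sup>2"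
      by (simp add: norm_scaleC power_mult_distrib cmod_cinner_commute[of _ y] flip: sum_distrib_right)
    also have "\<dots> \<le> (norm y)\<^sup>2 * (norm x)\<^sup>2" using Bessel[OF that] by (simp add: mult_right_mono)
    finally show ?thesis by (simp add: power_mult_distrib mult.commute)
  qed
  then show "rank_one x y \<in> hilbert_schmidt" "hs_norm (rank_one x y) \<le> norm x * norm y"
    using hilbert_schmidtI[of "rank_one x y" "norm x * norm y"] by auto
qed

text \<open>Composing with the projection onto the line of y exhibits a product of two
  Hilbert-Schmidt operators with the right norms.\<close>

lemma trace_class_rank_one:
  "rank_one x y \<in> trace_class" "trace_norm (rank_one x y) \<le> norm x * norm y"
proof -
  \<comment> \<open>For y = 0, division by zero gives u = 0, and both sides of \<open>eq\<close>
    vanish.\<close>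
  define u where "u = complex_of_real (1 / norm y) *\<^sub>C y"
  have u: "norm u \<le> 1" by (simp add: u_def norm_scaleC norm_divide)
  have eq: "rank_one x y = rank_one x y * rank_one u u"
  proof (cases "y = 0")
    case False
    have zy: "cinner z y = cinner z u * cinner u y" for z
      using False by (simp add: u_def cinner_simps power2_eq_square flip: power2_norm_eq_cinner)
    show ?thesis
    proof (rule bop_eqI)
      fix z
      have "(rank_one x y * rank_one u u) \<cdot> z = (cinner z u * cinner u y) *\<^sub>C x"
        by (simp add: cinner_simps)
      then show "rank_one x y \<cdot> z = (rank_one x y * rank_one u u) \<cdot> z"
        by (simp only: zy[of z, symmetric] rank_one_apply)
    qed
  qed (auto intro: bop_eqI)
  note hs = hs_mult_trace_class[OF hs_rank_one(1)[of x y] hs_rank_one(1)[of u u]]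
  show "rank_one x y \<in> trace_class" using hs(1) eq by simp
  have "trace_norm (rank_one x y) \<le> hs_norm (rank_one x y) * hs_norm (rank_one u u)"
    using hs(2) eq by simp
  also have "\<dots> \<le> (norm x * norm y) * (norm u * norm u)"
    by (intro mult_mono hs_rank_one) auto
  also have "\<dots> \<le> (norm x * norm y) * 1" using u by (intro mult_left_mono mult_le_one) auto
  finally show "trace_norm (rank_one x y) \<le> norm x * norm y" by simp
qed

lemma trace_class_sum: "(\<And>i. i \<in> F \<Longrightarrow> A i \<in> trace_class) \<Longrightarrow> (\<Sum>i\<in>F. A i) \<in> trace_class"
  by (induction F rule: infinite_finite_induct) (auto simp: trace_class_add)

text \<open>With C = S T, cutting C off to finitely many basis vectors leaves the error S D, where D
  is T cut off to the remaining ones. The Hilbert-Schmidt norm of D is the root of a tail of a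
  convergent series.\<close>

lemma rank_one_approx:
  fixes C :: "'h::chilbert_space bop"
  assumes C: "C \<in> trace_class"
  shows "((\<lambda>F. trace_norm (C - (\<Sum>e\<in>F. rank_one (C \<cdot> e) e))) \<longlongrightarrow> 0) (finite_subsets_at_top some_onb)"
proof -
  obtain S T where ST: "S \<in> hilbert_schmidt" "T \<in> hilbert_schmidt" "C = S * T"
    using trace_class_factor[OF C] by blast
  define D where "D F = T - (\<Sum>e\<in>F. rank_one (T \<cdot> e) e)" for F :: "'h set"
  have eq: "C - (\<Sum>e\<in>F. rank_one (C \<cdot> e) e) = S * D F" for F
    by (rule bop_eqI) (simp add: D_def ST bop_sum_apply bop_diff bop_sum)
  have Tsum: "((\<lambda>e. (norm (T \<cdot> e))\<^sup>2) has_sum (hs_norm T)\<^sup>2) some_onb"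
    unfolding hs_norm_power2 using ST(2) by (simp add: hilbert_schmidt_def)
  have D: "D F \<in> hilbert_schmidt \<and> hs_norm (D F) \<le> sqrt ((hs_norm T)\<^sup>2 - (\<Sum>e\<in>F. (norm (T \<cdot> e))\<^sup>2))"
    if F: "finite F" "F \<subseteq> some_onb" for F
  proof -
    let ?c = "(hs_norm T)\<^sup>2 - (\<Sum>e\<in>F. (norm (T \<cdot> e))\<^sup>2)"
    have c: "?c \<ge> 0" using hs_sum_le[OF ST(2) F] by simp
    have De: "D F \<cdot> e = (if e \<in> F then 0 else T \<cdot> e)" if "e \<in> some_onb" for e
    proof -
      have "(\<Sum>f\<in>F. cinner e f *\<^sub>C T \<cdot> f) = (\<Sum>f\<in>F. if f = e then T \<cdot> e else 0)"
        by (intro sum.cong) (use that F in \<open>auto simp: cinner_onb subset_iff scaleC_one\<close>)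
      then show ?thesis using F(1) by (simp add: D_def bop_sum_apply)
    qed
    have "(\<Sum>e\<in>G. (norm (D F \<cdot> e))\<^sup>2) \<le> (sqrt ?c)\<^sup>2" if G: "finite G" "G \<subseteq> some_onb" for G
    proof -
      have "(\<Sum>e\<in>G. (norm (D F \<cdot> e))\<^sup>2) = (\<Sum>e\<in>G - F. (norm (T \<cdot> e))\<^sup>2)"
        by (rule sum.mono_neutral_cong_right) (use G De in \<open>auto simp: subset_iff\<close>)
      also have "\<dots> = (\<Sum>e\<in>(G - F) \<union> F. (norm (T \<cdot> e))\<^sup>2) - (\<Sum>e\<in>F. (norm (T \<cdot> e))\<^sup>2)"
        using G F by (subst sum.union_disjoint) auto
      also have "\<dots> \<le> ?c" using hs_sum_le[OF ST(2), of "(G - F) \<union> F"] G F by (auto simp: diff_right_mono)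
      finally show ?thesis using c by simp
    qed
    then show ?thesis using hilbert_schmidtI[of "D F" "sqrt ?c"] c by auto
  qed
  show ?thesis
  proof (rule tendsto_sandwich)
    show "\<forall>\<^sub>F F in finite_subsets_at_top some_onb. 0 \<le> trace_norm (C - (\<Sum>e\<in>F. rank_one (C \<cdot> e) e))"
      by (intro always_eventually allI trace_norm_nonneg trace_class_diff C trace_class_sum trace_class_rank_one)
    show "\<forall>\<^sub>F F in finite_subsets_at_top some_onb. trace_norm (C - (\<Sum>e\<in>F. rank_one (C \<cdot> e) e))
      \<le> hs_norm S * sqrt ((hs_norm T)\<^sup>2 - (\<Sum>e\<in>F. (norm (T \<cdot> e))\<^sup>2))"
    proof (rule eventually_finite_subsets_at_top_weakI)
      fix F :: "'h set" assume F: "finite F" "F \<subseteq> some_onb"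
      have "trace_norm (S * D F) \<le> hs_norm S * hs_norm (D F)"
        using hs_mult_trace_class(2)[OF ST(1)] D[OF F] by blast
      also have "\<dots> \<le> hs_norm S * sqrt ((hs_norm T)\<^sup>2 - (\<Sum>e\<in>F. (norm (T \<cdot> e))\<^sup>2))"
        using D[OF F] by (intro mult_left_mono) auto
      finally show "trace_norm (C - (\<Sum>e\<in>F. rank_one (C \<cdot> e) e))
        \<le> hs_norm S * sqrt ((hs_norm T)\<^sup>2 - (\<Sum>e\<in>F. (norm (T \<cdot> e))\<^sup>2))" by (simp only: eq)
    qed
    have "((\<lambda>F. hs_norm S * sqrt ((hs_norm T)\<^sup>2 - (\<Sum>e\<in>F. (norm (T \<cdot> e))\<^sup>2)))
      \<longlongrightarrow> hs_norm S * sqrt ((hs_norm T)\<^sup>2 - (hs_norm T)\<^sup>2)) (finite_subsets_at_top some_onb)"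
      using Tsum unfolding has_sum_def by (intro tendsto_intros)
    then show "((\<lambda>F. hs_norm S * sqrt ((hs_norm T)\<^sup>2 - (\<Sum>e\<in>F. (norm (T \<cdot> e))\<^sup>2))) \<longlongrightarrow> 0)
      (finite_subsets_at_top some_onb)" by simp
  qed simp
qed

text \<open>The operator is read off from the values of \<open>f\<close> on rank-one operators, whose span is dense.\<close>

lemma trace_class_functional:
  fixes f :: "'h::chilbert_space bop \<Rightarrow> complex"
  assumes add: "\<And>C D. C \<in> trace_class \<Longrightarrow> D \<in> trace_class \<Longrightarrow> f (C + D) = f C + f D"
    and scale: "\<And>c C. C \<in> trace_class \<Longrightarrow> f (c *\<^sub>C C) = c * f C"
    and bound: "\<And>C. C \<in> trace_class \<Longrightarrow> cmod (f C) \<le> K * trace_norm C" and K: "0 \<le> K"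
  obtains A where "\<And>C. C \<in> trace_class \<Longrightarrow> f C = tr (A * C)"
proof -
  have r1: "rank_one (x + x') y = rank_one x y + rank_one x' y" for x x' y :: 'h
    by (rule bop_eqI) (simp add: scaleC_add_right)
  have r2: "rank_one (c *\<^sub>C x) y = c *\<^sub>C rank_one x y" for c and x y :: 'h
    by (rule bop_eqI) (simp add: scaleC_scaleC mult.commute)
  have r3: "rank_one x (y + y') = rank_one x y + rank_one x y'" for x y y' :: 'h
    by (rule bop_eqI) (simp add: scaleC_add_left cinner_simps)
  have r4: "rank_one x (c *\<^sub>C y) = cnj c *\<^sub>C rank_one x y" for c and x y :: 'h
    by (rule bop_eqI) (simp add: scaleC_scaleC cinner_simps)
  have r5: "cmod (f (rank_one x y)) \<le> K * norm x * norm y" for x y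
    using bound[OF trace_class_rank_one(1), of x y] mult_left_mono[OF trace_class_rank_one(2) K, of x y]
    by (simp add: mult.assoc)
  obtain A where A: "\<And>x y. cinner (A \<cdot> x) y = f (rank_one x y)"
    by (rule ex_bop_form[of "\<lambda>x y. f (rank_one x y)" K])
      (auto simp: r1 r2 r3 r4 r5 add scale trace_class_rank_one K)
  have f0: "f 0 = 0" using scale[of 0 0] by simp
  have "f C = tr (A * C)" if C: "C \<in> trace_class" for C
  proof -
    let ?C = "\<lambda>F. \<Sum>e\<in>F. rank_one (C \<cdot> e) e" and ?L = "finite_subsets_at_top (some_onb :: 'h set)"
    have tc: "?C F \<in> trace_class" for F by (intro trace_class_sum trace_class_rank_one)
    \<comment> \<open>On the truncations f yields exactly the partial sums of
      \<open>tr (A * C)\<close>; continuity of f in the trace norm does the rest.\<close>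
    have fC: "f (?C F) = (\<Sum>e\<in>F. cinner ((A * C) \<cdot> e) e)" for F
      by (induction F rule: infinite_finite_induct) (auto simp: f0 add tc trace_class_rank_one A)
    have "((\<lambda>F. f C - f (?C F)) \<longlongrightarrow> 0) ?L"
    proof (rule Lim_null_comparison)
      show "\<forall>\<^sub>F F in ?L. norm (f C - f (?C F)) \<le> K * trace_norm (C - ?C F)"
      proof (intro always_eventually allI)
        fix F
        have "f C = f ((C - ?C F) + ?C F)" by simp
        also have "\<dots> = f (C - ?C F) + f (?C F)" by (intro add trace_class_diff C tc)
        finally have "f C - f (?C F) = f (C - ?C F)" by simp
        then show "norm (f C - f (?C F)) \<le> K * trace_norm (C - ?C F)"
          using bound[OF trace_class_diff[OF C tc]] by simp
      qed
      show "((\<lambda>F. K * trace_norm (C - ?C F)) \<longlongrightarrow> 0) ?L"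
        using tendsto_mult_left[OF rank_one_approx[OF C], of K] by simp
    qed
    moreover have "((\<lambda>F. \<Sum>e\<in>F. cinner ((A * C) \<cdot> e) e) \<longlongrightarrow> tr (A * C)) ?L"
      using has_sum_infsum[OF trace_class_summable(1)[OF trace_class_mult(1)[OF C]]]
      unfolding tr_def has_sum_def .
    ultimately have "((\<lambda>F. (f C - f (?C F)) + f (?C F)) \<longlongrightarrow> 0 + tr (A * C)) ?L"
      unfolding fC[symmetric] by (rule tendsto_add)
    then show ?thesis by (simp add: tendsto_const_iff)
  qed
  then show ?thesis using that by blast
qed

section \<open>The Hahn--Banach theorem\<close>

text \<open>Used for infima of sublinear functionals and again for the distance from a
  subspace.\<close>

lemma le_INF_add:
  fixes f :: "'a \<Rightarrow> real" and g :: "'b \<Rightarrow> real"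
  assumes "I \<noteq> {}" "J \<noteq> {}" "\<And>i j. i \<in> I \<Longrightarrow> j \<in> J \<Longrightarrow> a \<le> f i + g j"
  shows "a \<le> (INF i\<in>I. f i) + (INF j\<in>J. g j)"
proof -
  have "a - f i \<le> (INF j\<in>J. g j)" if "i \<in> I" for i
    by (rule cINF_greatest) (use assms that in \<open>auto simp: algebra_simps\<close>)
  then have "a - (INF j\<in>J. g j) \<le> (INF i\<in>I. f i)"
    by (intro cINF_greatest) (use assms in \<open>auto simp: algebra_simps\<close>)
  then show ?thesis by simp
qed

lemma le_mult_INF:
  fixes f :: "'a \<Rightarrow> real"
  assumes "I \<noteq> {}" "0 < r" "\<And>i. i \<in> I \<Longrightarrow> a \<le> r * f i"
  shows "a \<le> r * (INF i\<in>I. f i)"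
proof -
  have "a / r \<le> (INF i\<in>I. f i)"
    by (rule cINF_greatest) (use assms in \<open>auto simp: field_simps\<close>)
  then show ?thesis using assms(2) by (simp add: field_simps)
qed

text \<open>Positive homogeneity is put as an inequality, the form that infima of families deliver;
  scaling back by 1/r gives equality. Real scalars enter through \<open>complex_of_real\<close>
  because \<open>complex_vector\<close> provides complex ones.\<close>

definition sublinear_on :: "'v::complex_vector set \<Rightarrow> ('v \<Rightarrow> real) \<Rightarrow> bool"
  where "sublinear_on V p \<longleftrightarrow> (\<forall>x\<in>V. \<forall>y\<in>V. p (x + y) \<le> p x + p y) \<and>
    (\<forall>x\<in>V. \<forall>r>0. p (complex_of_real r *\<^sub>C x) \<le> r * p x)"

lemma sublinear_on_scale:
  assumes p: "sublinear_on V p" and V: "complex_vector.subspace V" and x: "x \<in> V" and r: "0 < r"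
  shows "p (complex_of_real r *\<^sub>C x) = r * p x"
proof (rule antisym)
  show "p (complex_of_real r *\<^sub>C x) \<le> r * p x" using assms by (auto simp: sublinear_on_def)
  have "complex_of_real (1/r) *\<^sub>C complex_of_real r *\<^sub>C x = x"
    using r by (simp add: scaleC_scaleC scaleC_one flip: of_real_mult)
  then have "p x \<le> (1/r) * p (complex_of_real r *\<^sub>C x)"
    using p complex_vector.subspace_scale[OF V x, of "complex_of_real r"] r unfolding sublinear_on_def
    by (metis zero_less_divide_1_iff)
  then show "r * p x \<le> p (complex_of_real r *\<^sub>C x)" using r by (simp add: field_simps)
qed

lemma sublinear_on_0:
  assumes p: "sublinear_on V p" and V: "complex_vector.subspace V"
  shows "p 0 = 0"
  using sublinear_on_scale[OF p V complex_vector.subspace_0[OF V], of 2] by simp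

lemma sublinear_on_neg:
  assumes p: "sublinear_on V p" and V: "complex_vector.subspace V" and x: "x \<in> V"
  shows "- p (- x) \<le> p x"
proof -
  have "p (x + - x) \<le> p x + p (- x)"
    using p x complex_vector.subspace_neg[OF V x] unfolding sublinear_on_def by blast
  then show ?thesis using sublinear_on_0[OF p V] by simp
qed

text \<open>Made for two infima: the one-parameter family in \<open>sublinear_on_lower\<close> and
  the chains in Zorn's lemma. The witness k is a shifted parameter in the former and the smaller of
  two comparable functionals in the latter.\<close>

lemma sublinear_on_INF:
  fixes g :: "'i \<Rightarrow> 'v::complex_vector \<Rightarrow> real"
  assumes V: "complex_vector.subspace V" and I: "I \<noteq> {}"
    and lower: "\<And>i x. i \<in> I \<Longrightarrow> x \<in> V \<Longrightarrow> L x \<le> g i x"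
    and add: "\<And>i j x y. i \<in> I \<Longrightarrow> j \<in> I \<Longrightarrow> x \<in> V \<Longrightarrow> y \<in> V \<Longrightarrow> \<exists>k\<in>I. g k (x + y) \<le> g i x + g j y"
    and scale: "\<And>i x r. i \<in> I \<Longrightarrow> x \<in> V \<Longrightarrow> 0 < r \<Longrightarrow> \<exists>k\<in>I. g k (complex_of_real r *\<^sub>C x) \<le> r * g i x"
  shows "sublinear_on V (\<lambda>x. INF i\<in>I. g i x)"
    "\<And>i x. i \<in> I \<Longrightarrow> x \<in> V \<Longrightarrow> (INF i\<in>I. g i x) \<le> g i x"
proof -
  show le: "(INF i\<in>I. g i x) \<le> g i x" if "i \<in> I" "x \<in> V" for i x
    by (rule cINF_lower) (use lower that in \<open>auto intro!: bdd_belowI2[where m = "L x"]\<close>)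
  show "sublinear_on V (\<lambda>x. INF i\<in>I. g i x)"
    unfolding sublinear_on_def
  proof (intro conjI ballI allI impI)
    fix x y assume xy: "x \<in> V" "y \<in> V"
    show "(INF i\<in>I. g i (x + y)) \<le> (INF i\<in>I. g i x) + (INF i\<in>I. g i y)"
    proof (rule le_INF_add[OF I I])
      fix i j assume "i \<in> I" "j \<in> I"
      then obtain k where "k \<in> I" "g k (x + y) \<le> g i x + g j y" using add xy by blast
      then show "(INF i\<in>I. g i (x + y)) \<le> g i x + g j y"
        using le[of k "x + y"] complex_vector.subspace_add[OF V xy] by linarith
    qed
  next
    fix x and r :: real assume x: "x \<in> V" and r: "0 < r"
    show "(INF i\<in>I. g i (complex_of_real r *\<^sub>C x)) \<le> r * (INF i\<in>I. g i x)"
    proof (rule le_mult_INF[OF I r])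
      fix i assume "i \<in> I"
      then obtain k where "k \<in> I" "g k (complex_of_real r *\<^sub>C x) \<le> r * g i x" using scale x r by blast
      then show "(INF i\<in>I. g i (complex_of_real r *\<^sub>C x)) \<le> r * g i x"
        using le[of k] complex_vector.subspace_scale[OF V x] by (meson order_trans)
    qed
  qed
qed

text \<open>This lowers every sublinear functional that is not additive, so that minimal ones are linear.\<close>

lemma sublinear_on_lower:
  assumes p: "sublinear_on V p" and V: "complex_vector.subspace V" and z: "z \<in> V"
  obtains q where "sublinear_on V q" "\<And>x. x \<in> V \<Longrightarrow> q x \<le> p x" "\<And>x. x \<in> V \<Longrightarrow> q x \<le> p (x + z) - p z"
proof -
  \<comment> \<open>The new functional is the infimum of \<open>g t\<close> over t \<ge> 0; t = 0
    shows that it is below p, and t = 1 gives the last claim.\<close>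
  define g where "g t x = p (x + complex_of_real t *\<^sub>C z) - t * p z" for t x
  have mem: "x + complex_of_real t *\<^sub>C z \<in> V" if "x \<in> V" for x t
    using that z V by (simp add: complex_vector.subspace_add complex_vector.subspace_scale)
  have sub: "p (x + y) \<le> p x + p y" if "x \<in> V" "y \<in> V" for x y using p that by (auto simp: sublinear_on_def)
  have pt: "p (complex_of_real t *\<^sub>C z) = t * p z" if "t \<ge> 0" for t
    using that sublinear_on_scale[OF p V z, of t] sublinear_on_0[OF p V] by (cases "t = 0") auto
  have lower: "- p (- x) \<le> g t x" if "t \<in> {0..}" "x \<in> V" for t x
    using sub[OF mem[OF that(2)] complex_vector.subspace_neg[OF V that(2)], of t] that pt[of t]
    by (simp add: g_def)
  have add: "\<exists>k\<in>{0..}. g k (x + y) \<le> g t x + g s y"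
    if "t \<in> {0..}" "s \<in> {0..}" "x \<in> V" "y \<in> V" for t s x y
  proof (rule bexI[of _ "t + s"])
    have eq: "x + y + complex_of_real (t + s) *\<^sub>C z = (x + complex_of_real t *\<^sub>C z) + (y + complex_of_real s *\<^sub>C z)"
      by (simp add: scaleC_add_left)
    show "g (t + s) (x + y) \<le> g t x + g s y"
      unfolding g_def eq distrib_right
      using sub[OF mem[OF that(3), of t] mem[OF that(4), of s]] by linarith
  qed (use that in auto)
  have scale: "\<exists>k\<in>{0..}. g k (complex_of_real r *\<^sub>C x) \<le> r * g t x"
    if "t \<in> {0..}" "x \<in> V" "0 < r" for t x r
  proof (rule bexI[of _ "r * t"])
    have "complex_of_real r *\<^sub>C x + complex_of_real (r * t) *\<^sub>C z
      = complex_of_real r *\<^sub>C (x + complex_of_real t *\<^sub>C z)"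
      by (simp add: scaleC_add_right scaleC_scaleC)
    then show "g (r * t) (complex_of_real r *\<^sub>C x) \<le> r * g t x"
      using sublinear_on_scale[OF p V mem[OF that(2), of t] that(3)] by (simp add: g_def right_diff_distrib)
  qed (use that in auto)
  note q = sublinear_on_INF[of V "{0..}" "\<lambda>x. - p (- x)" g, OF V _ lower add scale]
  show ?thesis
  proof (rule that)
    show "sublinear_on V (\<lambda>x. INF i\<in>{0..}. g i x)" using q(1) by blast
    show "(INF i\<in>{0..}. g i x) \<le> p x" if "x \<in> V" for x
      using q(2)[of 0 x] that by (simp add: g_def)
    show "(INF i\<in>{0..}. g i x) \<le> p (x + z) - p z" if "x \<in> V" for x
      using q(2)[of 1 x] that by (simp add: g_def scaleC_one)
  qed
qed

text \<open>Before Zorn's lemma is applied, p is lowered at z to q. Then q (- z) \<le> - p z, so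
  every linear functional below q reaches p at z.\<close>

lemma Hahn_Banach_real:
  fixes p :: "'v::complex_vector \<Rightarrow> real"
  assumes p: "sublinear_on V p" and V: "complex_vector.subspace V" and z: "z \<in> V"
  obtains f where "\<And>x y. x \<in> V \<Longrightarrow> y \<in> V \<Longrightarrow> f (x + y) = f x + f y"
    "\<And>x r. x \<in> V \<Longrightarrow> f (complex_of_real r *\<^sub>C x) = r * f x"
    "\<And>x. x \<in> V \<Longrightarrow> f x \<le> p x" "p z \<le> f z"
proof -
  obtain q where q: "sublinear_on V q" "\<And>x. x \<in> V \<Longrightarrow> q x \<le> p x" "\<And>x. x \<in> V \<Longrightarrow> q x \<le> p (x + z) - p z"
    using sublinear_on_lower[OF p V z] by blast
  \<comment> \<open>Members vanish off V, so that agreement on V is equality and the order below is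
    antisymmetric.\<close>
  define A where "A = {f. sublinear_on V f \<and> (\<forall>x\<in>V. f x \<le> q x) \<and> (\<forall>x. x \<notin> V \<longrightarrow> f x = 0)}"
  \<comment> \<open>The pointwise order reversed: the maximal element produced by Zorn's lemma is a
    minimal functional.\<close>
  define P where "P f g \<longleftrightarrow> (\<forall>x\<in>V. g x \<le> f x)" for f g :: "'v \<Rightarrow> real"
  have ext: "f = g" if "f \<in> A" "g \<in> A" "\<And>x. x \<in> V \<Longrightarrow> f x = g x" for f g
    using that by (auto simp: A_def fun_eq_iff) metis
  have restr: "\<exists>g\<in>A. \<forall>x\<in>V. g x = f x" if "sublinear_on V f" "\<And>x. x \<in> V \<Longrightarrow> f x \<le> q x" for f
  proof (rule bexI[of _ "\<lambda>x. if x \<in> V then f x else 0"])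
    show "(\<lambda>x. if x \<in> V then f x else 0) \<in> A"
      using that V by (auto simp: A_def sublinear_on_def complex_vector.subspace_add complex_vector.subspace_scale)
  qed simp
  have "\<exists>m\<in>A. \<forall>a\<in>A. P m a \<longrightarrow> a = m"
  proof (rule predicate_Zorn)
    show "partial_order_on A (relation_of P A)"
    proof (rule partial_order_on_relation_ofI)
      show "P a b \<Longrightarrow> P b c \<Longrightarrow> P a c" for a b c unfolding P_def by (meson order_trans)
      show "a = b" if "a \<in> A" "b \<in> A" "P a b" "P b a" for a b
        using that ext[of a b] unfolding P_def by (meson order_antisym)
    qed (simp add: P_def)
    fix C assume C: "C \<in> Chains (relation_of P A)"
    show "\<exists>u\<in>A. \<forall>a\<in>C. P a u"
    proof (cases "C = {}")
      case True
      then show ?thesis using restr[OF q(1)] by blast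
    next
      case False
      have CA: "f \<in> A" if "f \<in> C" for f using C that by (auto simp: Chains_def relation_of_def)
      have tot: "P f g \<or> P g f" if "f \<in> C" "g \<in> C" for f g using C that by (auto simp: Chains_def relation_of_def)
      have lower: "- q (- x) \<le> f x" if "f \<in> C" "x \<in> V" for f x
      proof -
        have "- f (- x) \<le> f x" using CA[OF that(1)] V that(2) by (auto simp: A_def intro: sublinear_on_neg)
        moreover have "f (- x) \<le> q (- x)"
          using CA[OF that(1)] complex_vector.subspace_neg[OF V that(2)] by (auto simp: A_def)
        ultimately show ?thesis by linarith
      qed
      have add: "\<exists>k\<in>C. k (x + y) \<le> f x + g y" if "f \<in> C" "g \<in> C" "x \<in> V" "y \<in> V" for f g x y
      proof -
        have sub: "h (x + y) \<le> h x + h y" if "h \<in> C" for h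
          using CA[OF that] \<open>x \<in> V\<close> \<open>y \<in> V\<close> by (auto simp: A_def sublinear_on_def)
        from tot[OF that(1,2)] show ?thesis
        proof
          assume "P f g"
          then show ?thesis using sub[OF that(2)] that by (intro bexI[of _ g]) (auto simp: P_def intro: order_trans add_right_mono)
        next
          assume "P g f"
          then show ?thesis using sub[OF that(1)] that by (intro bexI[of _ f]) (auto simp: P_def intro: order_trans add_left_mono)
        qed
      qed
      have scale: "\<exists>k\<in>C. k (complex_of_real r *\<^sub>C x) \<le> r * f x" if "f \<in> C" "x \<in> V" "0 < r" for f x r
        using CA[OF that(1)] that by (intro bexI[of _ f]) (auto simp: A_def sublinear_on_def)
      have u: "sublinear_on V (\<lambda>x. INF f\<in>C. f x)"
        using V False lower add scale by (rule sublinear_on_INF(1)[where L = "\<lambda>x. - q (- x)"])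
      have u_le: "(INF f\<in>C. f x) \<le> f x" if "f \<in> C" "x \<in> V" for f x
        using V False lower add scale that
        by (rule sublinear_on_INF(2)[where L = "\<lambda>x. - q (- x)" and g = "\<lambda>f x. f x"])
      obtain f where "f \<in> C" using False by blast
      then have "(INF f\<in>C. f x) \<le> q x" if "x \<in> V" for x
        by (rule order_trans[OF u_le]) (use that CA \<open>f \<in> C\<close> in \<open>auto simp: A_def\<close>)
      from restr[OF u this] obtain h where h: "h \<in> A" "\<forall>x\<in>V. h x = (INF f\<in>C. f x)" by blast
      then have "\<forall>a\<in>C. P a h" using u_le by (auto simp: P_def)
      then show ?thesis using h(1) by blast
    qed
  qed
  then obtain m where m: "m \<in> A" and min: "\<And>a. a \<in> A \<Longrightarrow> P m a \<Longrightarrow> a = m" by blast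
  have sm: "sublinear_on V m" using m by (simp add: A_def)
  have mq: "m x \<le> q x" if "x \<in> V" for x using m that by (simp add: A_def)
  have add: "m (x + y) = m x + m y" if x: "x \<in> V" and y: "y \<in> V" for x y
  proof (rule antisym)
    show "m (x + y) \<le> m x + m y" using sm x y by (auto simp: sublinear_on_def)
    \<comment> \<open>Lowering m at y cannot change m, by minimality; this is the missing half of
      additivity.\<close>
    obtain h where h: "sublinear_on V h" "\<And>x. x \<in> V \<Longrightarrow> h x \<le> m x" "\<And>x. x \<in> V \<Longrightarrow> h x \<le> m (x + y) - m y"
      using sublinear_on_lower[OF sm V y] by blast
    then obtain h' where h': "h' \<in> A" "\<forall>x\<in>V. h' x = h x"
      using restr[of h] mq by (metis order_trans)
    then have "h' = m" using h(2) by (intro min) (auto simp: P_def)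
    then show "m x + m y \<le> m (x + y)" using h(3)[OF x] h'(2) x by auto
  qed
  have neg: "m (- x) = - m x" if "x \<in> V" for x
    using add[OF that complex_vector.subspace_neg[OF V that]] sublinear_on_0[OF sm V] by simp
  have scale: "m (complex_of_real r *\<^sub>C x) = r * m x" if x: "x \<in> V" for x r
  proof -
    consider "r = 0" | "0 < r" | "0 < - r" by linarith
    then show ?thesis
    proof cases
      case 3
      have "m (complex_of_real (- r) *\<^sub>C x) = - r * m x" by (rule sublinear_on_scale[OF sm V x 3])
      then show ?thesis using neg[OF complex_vector.subspace_scale[OF V x, of "complex_of_real r"]] by simp
    qed (use sublinear_on_scale[OF sm V x] sublinear_on_0[OF sm V] in auto)
  qed
  have "m (- z) \<le> - p z"
    using mq[of "- z"] q(3)[of "- z"] complex_vector.subspace_neg[OF V z] sublinear_on_0[OF p V] by simp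
  then have "p z \<le> m z" using neg[OF z] by simp
  moreover have "m x \<le> p x" if "x \<in> V" for x using mq[OF that] q(2)[OF that] by simp
  ultimately show ?thesis using that add scale by blast
qed

text \<open>The factor 2 comes from estimating |f| by |Re f| + |Im f|. The separation argument uses
  only that f is bounded by a multiple of p and is nonzero at z when \<open>p z\<close> is
  positive.\<close>

lemma Hahn_Banach_complex:
  fixes p :: "'v::complex_vector \<Rightarrow> real"
  assumes V: "complex_vector.subspace V" and z: "z \<in> V"
    and p_add: "\<And>x y. x \<in> V \<Longrightarrow> y \<in> V \<Longrightarrow> p (x + y) \<le> p x + p y"
    and p_scale: "\<And>c x. x \<in> V \<Longrightarrow> p (c *\<^sub>C x) = cmod c * p x"
  obtains f where "\<And>x y. x \<in> V \<Longrightarrow> y \<in> V \<Longrightarrow> f (x + y) = f x + f y"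
    "\<And>x c. x \<in> V \<Longrightarrow> f (c *\<^sub>C x) = c * f x"
    "\<And>x. x \<in> V \<Longrightarrow> cmod (f x) \<le> 2 * p x" "p z \<le> cmod (f z)"
proof -
  have "sublinear_on V p" by (auto simp: sublinear_on_def p_add p_scale)
  from Hahn_Banach_real[OF this V z] obtain g where
    g: "\<And>x y. x \<in> V \<Longrightarrow> y \<in> V \<Longrightarrow> g (x + y) = g x + g y"
      "\<And>x r. x \<in> V \<Longrightarrow> g (complex_of_real r *\<^sub>C x) = r * g x"
      "\<And>x. x \<in> V \<Longrightarrow> g x \<le> p x" "p z \<le> g z" by blast
  have abs_g: "\<bar>g x\<bar> \<le> p x" if "x \<in> V" for x
  proof -
    have "g (- x) = - g x" using g(2)[OF that, of "-1"] by simp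
    moreover have "p (- x) = p x" using p_scale[OF that, of "-1"] by simp
    ultimately show ?thesis using g(3)[OF that] g(3)[OF complex_vector.subspace_neg[OF V that]] by simp
  qed
  \<comment> \<open>The unique complex-linear functional with real part g: f x = g x - i g (i
    x).\<close>
  define f where "f x = Complex (g x) (- g (\<i> *\<^sub>C x))" for x
  have iV: "c *\<^sub>C x \<in> V" if "x \<in> V" for x c using complex_vector.subspace_scale[OF V that] .
  have "f (x + y) = f x + f y" if "x \<in> V" "y \<in> V" for x y
    using that by (simp add: f_def g iV scaleC_add_right complex_eq_iff)
  moreover have "f (c *\<^sub>C x) = c * f x" if "x \<in> V" for c x
  proof -
    have lin: "g (d *\<^sub>C x) = Re d * g x + Im d * g (\<i> *\<^sub>C x)" for d
    proof -
      have "d *\<^sub>C x = complex_of_real (Re d) *\<^sub>C x + complex_of_real (Im d) *\<^sub>C \<i> *\<^sub>C x"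
        unfolding scaleC_scaleC scaleC_add_left[symmetric]
        by (metis complex_eq mult.commute)
      then show ?thesis by (simp add: g iV that del: complex_vector.scale_scale)
    qed
    show ?thesis
      using lin[of c] lin[of "\<i> * c"] by (simp add: f_def scaleC_scaleC complex_eq_iff algebra_simps)
  qed
  moreover have "cmod (f x) \<le> 2 * p x" if "x \<in> V" for x
    using cmod_le[of "f x"] abs_g[OF that] abs_g[OF iV[OF that, of \<i>]] p_scale[OF that, of \<i>]
    by (simp add: f_def)
  moreover have "p z \<le> cmod (f z)"
    using complex_Re_le_cmod[of "f z"] g(4) by (simp add: f_def)
  ultimately show ?thesis using that by blast
qed

section \<open>The trace pairing and the bipolar theorems\<close>

text \<open>The argument consists of arbitrary bounded operators, but it may also be a set of
  trace-class operators; the couple map compares the two polars of such a set.\<close>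

definition tc_polar :: "'h::chilbert_space bop set \<Rightarrow> 'h bop set"
  where "tc_polar a = {C \<in> trace_class. \<forall>A\<in>a. tr (A * C) = 0}"

definition bop_polar :: "'h::chilbert_space bop set \<Rightarrow> 'h bop set"
  where "bop_polar c = {A. \<forall>C\<in>c. tr (A * C) = 0}"

lemma tr_mult_linear:
  assumes "C \<in> trace_class"
  shows "tr ((A + B) * C) = tr (A * C) + tr (B * C)"
    "tr ((A - B) * C) = tr (A * C) - tr (B * C)"
    "tr ((k *\<^sub>C A) * C) = k * tr (A * C)"
proof -
  show add: "tr ((A + B) * C) = tr (A * C) + tr (B * C)" for A B
    by (simp add: distrib_right tr_add trace_class_mult assms)
  show scale: "tr ((k *\<^sub>C A) * C) = k * tr (A * C)" for A k
    by (simp add: bop_mult_scaleC tr_scaleC)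
  show "tr ((A - B) * C) = tr (A * C) - tr (B * C)"
    using add[of "A - B" B] by simp
qed

lemma tr_mult_linear_right:
  assumes "C \<in> trace_class" "D \<in> trace_class"
  shows "tr (A * (C + D)) = tr (A * C) + tr (A * D)"
    "tr (A * (C - D)) = tr (A * C) - tr (A * D)"
    "tr (A * (k *\<^sub>C C)) = k * tr (A * C)"
proof -
  have add: "tr (A * (X + D)) = tr (A * X) + tr (A * D)" if "X \<in> trace_class" for X
    by (simp add: distrib_left tr_add trace_class_mult assms that)
  then show "tr (A * (C + D)) = tr (A * C) + tr (A * D)" using assms by blast
  show "tr (A * (k *\<^sub>C C)) = k * tr (A * C)"
    by (simp add: bop_mult_scaleC tr_scaleC)
  show "tr (A * (C - D)) = tr (A * C) - tr (A * D)"
    using add[of "C - D"] assms by (simp add: trace_class_diff)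
qed

lemma subspace_tc_polar: "complex_vector.subspace (tc_polar a)"
  by (rule complex_vector.subspaceI)
    (auto simp: tc_polar_def tr_mult_linear_right trace_class_add trace_class_scaleC)

lemma subspace_bop_polar: "c \<subseteq> trace_class \<Longrightarrow> complex_vector.subspace (bop_polar c)"
  by (rule complex_vector.subspaceI) (auto simp: bop_polar_def tr_mult_linear subset_iff)

section \<open>The trace norm topology\<close>

lemma trace_norm_not_trace_class: "A \<notin> trace_class \<Longrightarrow> trace_norm A = 0"
  by (simp add: trace_class_def trace_norm_def tr_def infsum_not_exists)

lemma Metric_space_trace_norm:
  "Metric_space (trace_class :: 'h::chilbert_space bop set) (\<lambda>A B. trace_norm (A - B))"
proof
  fix A B C :: "'h bop"
  \<comment> \<open>\<open>Metric_space\<close> asks for nonnegativity and symmetry at all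
    operators, also outside the carrier, where \<open>trace_norm\<close> takes the default value 0
    of a divergent \<open>infsum\<close>.\<close>
  show "0 \<le> trace_norm (A - B)"
    using trace_norm_nonneg trace_norm_not_trace_class by (metis order_refl)
  show "trace_norm (A - B) = trace_norm (B - A)"
  proof (cases "A - B \<in> trace_class")
    case True
    then show ?thesis using trace_norm_minus_commute[of "A - B" 0] by simp
  next
    case False
    then have "B - A \<notin> trace_class" using complex_vector.subspace_neg[OF subspace_trace_class, of "B - A"] by auto
    then show ?thesis using False by (simp add: trace_norm_not_trace_class)
  qed
  assume AB: "A \<in> trace_class" "B \<in> trace_class"
  show "trace_norm (A - B) = 0 \<longleftrightarrow> A = B"
    using trace_norm_eq_0[OF trace_class_diff[OF AB]] by auto
  assume C: "C \<in> trace_class"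
  show "trace_norm (A - C) \<le> trace_norm (A - B) + trace_norm (B - C)"
    using trace_class_add(2)[OF trace_class_diff[OF AB] trace_class_diff[OF AB(2) C]] by simp
qed

lemma topspace_trace_norm [simp]: "topspace trace_norm_topology = trace_class"
  unfolding trace_norm_topology_def
  using Metric_space.topspace_mtopology[OF Metric_space_trace_norm] .

lemma closure_of_trace_norm:
  "trace_norm_topology closure_of S
    = {C \<in> trace_class. \<forall>r>0. \<exists>D\<in>S. D \<in> trace_class \<and> trace_norm (C - D) < r}"
  unfolding trace_norm_topology_def Metric_space.metric_closure_of[OF Metric_space_trace_norm]
    Metric_space.in_mball[OF Metric_space_trace_norm] by auto

text \<open>For the inclusion from right to left, Hahn--Banach is applied to the distance from \<open>S\<close>.\<close>

lemma trace_norm_bipolar: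
  fixes S :: "'h::chilbert_space bop set"
  assumes S: "complex_vector.subspace S" "S \<subseteq> trace_class"
  shows "trace_norm_topology closure_of S = tc_polar (bop_polar S)"
proof
  show "trace_norm_topology closure_of S \<subseteq> tc_polar (bop_polar S)"
  proof
    fix C assume "C \<in> trace_norm_topology closure_of S"
    then have C: "C \<in> trace_class" and near: "\<And>r. r > 0 \<Longrightarrow> \<exists>D\<in>S. trace_norm (C - D) < r"
      by (auto simp: closure_of_trace_norm)
    have "tr (A * C) = 0" if A: "A \<in> bop_polar S" for A
    proof -
      obtain K where K: "0 \<le> K" "\<And>x. norm (A \<cdot> x) \<le> K * norm x" using bop_bounded by blast
      have "cmod (tr (A * C)) \<le> 0 + e" if "e > 0" for e
      proof -
        obtain D where D: "D \<in> S" "trace_norm (C - D) < e / (K + 1)"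
          using near[of "e / (K + 1)"] \<open>e > 0\<close> K(1) by auto
        have CD: "C - D \<in> trace_class" using C D(1) S(2) trace_class_diff by blast
        have "tr (A * C) = tr (A * (C - D))"
          using A D(1) C S(2) by (simp add: tr_mult_linear_right subset_iff bop_polar_def)
        also have "cmod \<dots> \<le> trace_norm (A * (C - D))"
          by (intro trace_class_summable trace_class_mult CD)
        also have "\<dots> \<le> K * trace_norm (C - D)" by (rule trace_class_mult_left(2)[OF CD K(2,1)])
        also have "\<dots> \<le> (K + 1) * trace_norm (C - D)" using trace_norm_nonneg[OF CD] by (simp add: distrib_right)
        also have "\<dots> \<le> e" using D(2) K(1) by (simp add: pos_less_divide_eq mult.commute)
        finally show ?thesis by simp
      qed
      then have "cmod (tr (A * C)) \<le> 0" by (rule field_le_epsilon)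
      then show ?thesis by simp
    qed
    then show "C \<in> tc_polar (bop_polar S)" using C by (simp add: tc_polar_def)
  qed
  show "tc_polar (bop_polar S) \<subseteq> trace_norm_topology closure_of S"
  proof (rule ccontr)
    assume "\<not> tc_polar (bop_polar S) \<subseteq> trace_norm_topology closure_of S"
    then obtain C r where C: "C \<in> tc_polar (bop_polar S)" "C \<in> trace_class" and r: "r > 0"
      and far: "\<And>D. D \<in> S \<Longrightarrow> r \<le> trace_norm (C - D)"
      using S(2) by (auto simp: closure_of_trace_norm tc_polar_def not_less) (metis not_less subsetD)
    \<comment> \<open>A seminorm that vanishes on S and is at least r at C.\<close>
    define p where "p X = (INF D\<in>S. trace_norm (X - D))" for X
    have S0: "S \<noteq> {}" "0 \<in> S" using complex_vector.subspace_0[OF S(1)] by auto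
    have SD: "X - D \<in> trace_class" if "X \<in> trace_class" "D \<in> S" for X D
      using that S(2) trace_class_diff by blast
    have p_le: "p X \<le> trace_norm (X - D)" if "X \<in> trace_class" "D \<in> S" for X D
      unfolding p_def
      by (rule cINF_lower) (use that SD trace_norm_nonneg in \<open>auto intro!: bdd_belowI2[where m = 0]\<close>)
    have p_nonneg: "0 \<le> p X" if "X \<in> trace_class" for X
      unfolding p_def by (rule cINF_greatest) (use that S0 SD trace_norm_nonneg in auto)
    have p_add: "p (X + Y) \<le> p X + p Y" if XY: "X \<in> trace_class" "Y \<in> trace_class" for X Y
    proof -
      have "p (X + Y) \<le> trace_norm (X - D) + trace_norm (Y - E)" if "D \<in> S" "E \<in> S" for D E
      proof -
        have "p (X + Y) \<le> trace_norm ((X + Y) - (D + E))"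
          using that XY S(1) by (intro p_le) (auto intro: trace_class_add complex_vector.subspace_add)
        also have "(X + Y) - (D + E) = (X - D) + (Y - E)" by simp
        also have "trace_norm \<dots> \<le> trace_norm (X - D) + trace_norm (Y - E)"
          by (intro trace_class_add SD XY that)
        finally show ?thesis .
      qed
      then show ?thesis unfolding p_def[of X] p_def[of Y] by (intro le_INF_add S0)
    qed
    have p_scale_le: "p (k *\<^sub>C X) \<le> cmod k * p X" if X: "X \<in> trace_class" and "k \<noteq> 0" for k X
    proof -
      have "p (k *\<^sub>C X) \<le> cmod k * trace_norm (X - D)" if "D \<in> S" for D
      proof -
        have "p (k *\<^sub>C X) \<le> trace_norm (k *\<^sub>C X - k *\<^sub>C D)"
          using that X S(1) by (intro p_le) (auto intro: trace_class_scaleC complex_vector.subspace_scale)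
        also have "k *\<^sub>C X - k *\<^sub>C D = k *\<^sub>C (X - D)" by (simp add: complex_vector.scale_right_diff_distrib)
        also have "trace_norm \<dots> \<le> cmod k * trace_norm (X - D)" by (intro trace_class_scaleC SD X that)
        finally show ?thesis .
      qed
      then show ?thesis unfolding p_def[of X] by (intro le_mult_INF S0) (use \<open>k \<noteq> 0\<close> in auto)
    qed
    have p_S: "p D = 0" if "D \<in> S" for D
      using p_le[of D D] p_nonneg[of D] that S(2) by auto
    have p_scale: "p (k *\<^sub>C X) = cmod k * p X" if X: "X \<in> trace_class" for k X
    proof (cases "k = 0")
      case True
      then show ?thesis using p_S[OF S0(2)] by simp
    next
      case False
      have "p ((1/k) *\<^sub>C k *\<^sub>C X) \<le> cmod (1/k) * p (k *\<^sub>C X)"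
        using False by (intro p_scale_le trace_class_scaleC X) auto
      then have "cmod k * p X \<le> p (k *\<^sub>C X)"
        using False by (simp add: scaleC_scaleC scaleC_one norm_divide field_simps)
      then show ?thesis using p_scale_le[OF X False] by simp
    qed
    obtain f where f: "\<And>X Y. X \<in> trace_class \<Longrightarrow> Y \<in> trace_class \<Longrightarrow> f (X + Y) = f X + f Y"
      "\<And>X k. X \<in> trace_class \<Longrightarrow> f (k *\<^sub>C X) = k * f X"
      "\<And>X. X \<in> trace_class \<Longrightarrow> cmod (f X) \<le> 2 * p X" "p C \<le> cmod (f C)"
      using Hahn_Banach_complex[OF subspace_trace_class C(2) p_add p_scale] by blast
    have f_bound: "cmod (f X) \<le> 2 * trace_norm X" if "X \<in> trace_class" for X
      using f(3)[OF that] p_le[OF that S0(2)] by simp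
    obtain A where A: "\<And>X. X \<in> trace_class \<Longrightarrow> f X = tr (A * X)"
      using trace_class_functional[OF f(1,2) f_bound] by auto
    \<comment> \<open>f vanishes wherever p does, in particular on S. Hence it kills C as well,
      against \<open>p C \<le> cmod (f C)\<close>.\<close>
    have "A \<in> bop_polar S"
      unfolding bop_polar_def using A f(3) p_S S(2) by (auto simp: subset_iff) (metis norm_le_zero_iff mult_zero_right)
    then have "f C = 0" using C A by (auto simp: tc_polar_def)
    moreover have "r \<le> p C" unfolding p_def by (rule cINF_greatest) (use S0 far in auto)
    ultimately show False using f(4) r by simp
  qed
qed

section \<open>The ultraweak topology\<close>

lemma topspace_ultraweak [simp]: "topspace ultraweak_topology = UNIV"
proof -
  have "openin ultraweak_topology (UNIV :: 'a bop set)"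
    unfolding ultraweak_topology_def
    by (rule topology_generated_by_Basis) (use zero_trace_class open_UNIV in blast)
  then show ?thesis using openin_subset by blast
qed

text \<open>A neighbourhood of A contains every operator with exactly the same values as A on some
  finite F. No tolerance is kept, because the interpolation below is exact.\<close>

lemma openin_ultraweakD:
  assumes "openin ultraweak_topology T" "A \<in> T"
  shows "\<exists>F. finite F \<and> F \<subseteq> trace_class \<and> (\<forall>B. (\<forall>C\<in>F. tr (B * C) = tr (A * C)) \<longrightarrow> B \<in> T)"
proof -
  have "generate_topology_on {{A. tr (A * C) \<in> U} | C U. C \<in> trace_class \<and> open U} T"
    using assms(1) unfolding ultraweak_topology_def by (rule openin_topology_generated_by)
  then show ?thesis using assms(2)
  proof (induction arbitrary: A rule: generate_topology_on.induct)
    case (Int a b)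
    then have "A \<in> a" "A \<in> b" by auto
    from Int.IH(1)[OF this(1)] obtain F where F: "finite F" "F \<subseteq> trace_class"
      "\<forall>B. (\<forall>C\<in>F. tr (B * C) = tr (A * C)) \<longrightarrow> B \<in> a" by blast
    from Int.IH(2)[OF \<open>A \<in> b\<close>] obtain G where G: "finite G" "G \<subseteq> trace_class"
      "\<forall>B. (\<forall>C\<in>G. tr (B * C) = tr (A * C)) \<longrightarrow> B \<in> b" by blast
    show ?case by (intro exI[of _ "F \<union> G"]) (use F G in blast)
  next
    case (UN K)
    then obtain k where k: "k \<in> K" "A \<in> k" by blast
    from UN.IH[OF this] obtain F where "finite F" "F \<subseteq> trace_class"
      "\<forall>B. (\<forall>C\<in>F. tr (B * C) = tr (A * C)) \<longrightarrow> B \<in> k" by blast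
    then show ?case using k(1) by (intro exI[of _ F]) blast
  next
    case (Basis s)
    then obtain C U where C: "s = {A. tr (A * C) \<in> U}" "C \<in> trace_class" by blast
    show ?case by (intro exI[of _ "{C}"]) (use C Basis(2) in simp)
  qed simp
qed

text \<open>Induction on F with S and A varying. If C does not vanish on S, some R in S is
  normalised to tr (R C) = 1; subtracting a multiple of R from A settles the value at C, and the
  rest is interpolated inside the kernel S' of C in S.\<close>

lemma finite_interpolation:
  fixes S :: "'h::chilbert_space bop set"
  assumes "finite F" "F \<subseteq> trace_class" "complex_vector.subspace S" "A \<in> bop_polar (tc_polar S)"
  shows "\<exists>B\<in>S. \<forall>C\<in>F. tr (B * C) = tr (A * C)"
  using assms
proof (induction F arbitrary: S A rule: finite_induct)
  case empty
  then show ?case using complex_vector.subspace_0 by blast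
next
  case (insert C F)
  have C: "C \<in> trace_class" and F: "F \<subseteq> trace_class" using insert.prems(1) by auto
  note S = insert.prems(2)
  show ?case
  proof (cases "\<forall>B\<in>S. tr (B * C) = 0")
    case True
    then have "C \<in> tc_polar S" using C by (simp add: tc_polar_def)
    then have "tr (A * C) = 0" using insert.prems(3) by (simp add: bop_polar_def)
    moreover obtain B where "B \<in> S" "\<forall>C\<in>F. tr (B * C) = tr (A * C)"
      using insert.IH[OF F S insert.prems(3)] by blast
    ultimately show ?thesis using True by auto
  next
    case False
    then obtain B where B: "B \<in> S" "tr (B * C) \<noteq> 0" by blast
    define R where "R = (1 / tr (B * C)) *\<^sub>C B"
    have R: "R \<in> S" "tr (R * C) = 1"
      using B C S by (auto simp: R_def tr_mult_linear complex_vector.subspace_scale)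
    define S' where "S' = {X\<in>S. tr (X * C) = 0}"
    have S': "complex_vector.subspace S'"
      by (rule complex_vector.subspaceI)
        (use S C in \<open>auto simp: S'_def tr_mult_linear complex_vector.subspace_0 complex_vector.subspace_add complex_vector.subspace_scale\<close>)
    have "A - tr (A * C) *\<^sub>C R \<in> bop_polar (tc_polar S')"
      unfolding bop_polar_def
    proof (intro CollectI ballI)
      fix D assume D: "D \<in> tc_polar S'"
      then have Dt: "D \<in> trace_class" by (simp add: tc_polar_def)
      \<comment> \<open>A functional D that vanishes on S' is, on S, a multiple of C. So D minus
        that multiple lies in the polar of S, where the hypothesis on A applies.\<close>
      have "tr (X * (D - tr (R * D) *\<^sub>C C)) = 0" if X: "X \<in> S" for X
      proof -
        have "X - tr (X * C) *\<^sub>C R \<in> S'"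
          using X R S C by (auto simp: S'_def tr_mult_linear complex_vector.subspace_diff complex_vector.subspace_scale)
        then have "tr ((X - tr (X * C) *\<^sub>C R) * D) = 0" using D by (simp add: tc_polar_def)
        then have "tr (X * D) = tr (X * C) * tr (R * D)" using Dt by (simp add: tr_mult_linear)
        then show ?thesis
          using Dt C by (simp add: tr_mult_linear_right trace_class_scaleC mult.commute)
      qed
      then have "D - tr (R * D) *\<^sub>C C \<in> tc_polar S"
        using Dt C by (simp add: tc_polar_def trace_class_diff trace_class_scaleC)
      then have "tr (A * (D - tr (R * D) *\<^sub>C C)) = 0" using insert.prems(3) by (simp add: bop_polar_def)
      then have "tr (A * D) = tr (R * D) * tr (A * C)"
        using Dt C by (simp add: tr_mult_linear_right trace_class_scaleC)
      then show "tr ((A - tr (A * C) *\<^sub>C R) * D) = 0" using Dt by (simp add: tr_mult_linear)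
    qed
    then obtain B' where B': "B' \<in> S'" "\<forall>D\<in>F. tr (B' * D) = tr ((A - tr (A * C) *\<^sub>C R) * D)"
      using insert.IH[OF F S'] by blast
    have "B' + tr (A * C) *\<^sub>C R \<in> S"
      using B'(1) R S by (auto simp: S'_def complex_vector.subspace_add complex_vector.subspace_scale)
    moreover have "tr ((B' + tr (A * C) *\<^sub>C R) * D) = tr (A * D)" if "D \<in> insert C F" for D
    proof -
      have D: "D \<in> trace_class" using that insert.prems(1) by auto
      show ?thesis
      proof (cases "D = C")
        case True
        then show ?thesis using B'(1) R(2) D by (simp add: tr_mult_linear S'_def)
      next
        case False
        then show ?thesis using B'(2) D that by (auto simp: tr_mult_linear)
      qed
    qed
    ultimately show ?thesis by blast
  qed
qed

lemma ultraweak_bipolar: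
  fixes S :: "'h::chilbert_space bop set"
  assumes S: "complex_vector.subspace S"
  shows "ultraweak_topology closure_of S = bop_polar (tc_polar S)"
proof
  show "ultraweak_topology closure_of S \<subseteq> bop_polar (tc_polar S)"
  proof
    fix A assume A: "A \<in> ultraweak_topology closure_of S"
    have "tr (A * C) = 0" if C: "C \<in> tc_polar S" for C
    proof (rule ccontr)
      assume nz: "tr (A * C) \<noteq> 0"
      have "openin ultraweak_topology {B. tr (B * C) \<in> - {0}}"
        unfolding ultraweak_topology_def
        by (intro topology_generated_by_Basis CollectI exI[of _ C] exI[of _ "- {0}"])
          (use C in \<open>auto simp: tc_polar_def\<close>)
      moreover have "A \<in> {B. tr (B * C) \<in> - {0}}" using nz by simp
      ultimately obtain B where "B \<in> S" "B \<in> {B. tr (B * C) \<in> - {0}}"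
        using A unfolding in_closure_of by meson
      then show False using C by (simp add: tc_polar_def)
    qed
    then show "A \<in> bop_polar (tc_polar S)" by (simp add: bop_polar_def)
  qed
  show "bop_polar (tc_polar S) \<subseteq> ultraweak_topology closure_of S"
  proof
    fix A assume A: "A \<in> bop_polar (tc_polar S)"
    have "\<exists>B. B \<in> S \<and> B \<in> T" if T: "A \<in> T" "openin ultraweak_topology T" for T
    proof -
      obtain F where F: "finite F" "F \<subseteq> trace_class"
        "\<forall>B. (\<forall>C\<in>F. tr (B * C) = tr (A * C)) \<longrightarrow> B \<in> T"
        using openin_ultraweakD[OF T(2,1)] by blast
      obtain B where "B \<in> S" "\<forall>C\<in>F. tr (B * C) = tr (A * C)"
        using finite_interpolation[OF F(1,2) S A] by blast
      then show ?thesis using F(3) by blast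
    qed
    then show "A \<in> ultraweak_topology closure_of S" by (auto simp: in_closure_of)
  qed
qed

section \<open>Polars of products\<close>

text \<open>Polars do not distinguish a set from its span, so products are studied before taking
  spans; there associativity and distribution over unions are immediate.\<close>

definition op_prods :: "'h::chilbert_space bop set \<Rightarrow> 'h bop set \<Rightarrow> 'h bop set"
  where "op_prods a b = {A * B | A B. A \<in> a \<and> B \<in> b}"

abbreviation bop_closure :: "'h::chilbert_space bop set \<Rightarrow> 'h bop set"
  where "bop_closure a \<equiv> bop_polar (tc_polar a)"

abbreviation tc_closure :: "'h::chilbert_space bop set \<Rightarrow> 'h bop set"
  where "tc_closure c \<equiv> tc_polar (bop_polar c)"

lemma tc_polar_subset: "tc_polar a \<subseteq> trace_class"
  by (auto simp: tc_polar_def)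

lemma tc_polar_antimono: "a \<subseteq> b \<Longrightarrow> tc_polar b \<subseteq> tc_polar a"
  by (auto simp: tc_polar_def)

lemma bop_polar_antimono: "c \<subseteq> d \<Longrightarrow> bop_polar d \<subseteq> bop_polar c"
  by (auto simp: bop_polar_def)

lemma subset_bop_closure: "a \<subseteq> bop_closure a"
  by (auto simp: tc_polar_def bop_polar_def)

lemma subset_tc_closure: "c \<subseteq> trace_class \<Longrightarrow> c \<subseteq> tc_closure c"
  by (auto simp: tc_polar_def bop_polar_def)

lemma tc_polar_bop_closure [simp]: "tc_polar (bop_closure a) = tc_polar a"
  using tc_polar_antimono[OF subset_bop_closure] subset_tc_closure[OF tc_polar_subset] by blast

lemma bop_polar_tc_closure [simp]: "c \<subseteq> trace_class \<Longrightarrow> bop_polar (tc_closure c) = bop_polar c"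
  using bop_polar_antimono[OF subset_tc_closure] subset_bop_closure by blast

lemma tc_polar_span: "tc_polar (complex_vector.span a) = tc_polar a"
proof
  show "tc_polar (complex_vector.span a) \<subseteq> tc_polar a"
    by (intro tc_polar_antimono complex_vector.span_superset)
  have "complex_vector.span a \<subseteq> bop_closure a"
    by (intro complex_vector.span_minimal subset_bop_closure subspace_bop_polar tc_polar_subset)
  from tc_polar_antimono[OF this] show "tc_polar a \<subseteq> tc_polar (complex_vector.span a)" by simp
qed

lemma bop_polar_span:
  assumes "c \<subseteq> trace_class" shows "bop_polar (complex_vector.span c) = bop_polar c"
proof
  show "bop_polar (complex_vector.span c) \<subseteq> bop_polar c"
    by (intro bop_polar_antimono complex_vector.span_superset)
  have "complex_vector.span c \<subseteq> tc_closure c"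
    by (intro complex_vector.span_minimal subset_tc_closure subspace_tc_polar assms)
  from bop_polar_antimono[OF this] show "bop_polar c \<subseteq> bop_polar (complex_vector.span c)"
    using assms by simp
qed

lemma tc_polar_subset_bop_polar: "c \<subseteq> trace_class \<Longrightarrow> tc_polar c \<subseteq> bop_polar c"
  by (auto simp: tc_polar_def bop_polar_def subset_iff tr_commute)

text \<open>A trace-class operator D in the polar of c is also a bounded operator orthogonal to c,
  hence to its trace norm closure. This makes the ultraweak closure insensitive to a prior trace
  norm closure, so that the couple map preserves joins and actions.\<close>

lemma tc_polar_tc_closure:
  assumes "c \<subseteq> trace_class" shows "tc_polar (tc_closure c) = tc_polar c"
proof
  show "tc_polar (tc_closure c) \<subseteq> tc_polar c"
    by (intro tc_polar_antimono subset_tc_closure assms)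
  show "tc_polar c \<subseteq> tc_polar (tc_closure c)"
  proof
    fix D assume D: "D \<in> tc_polar c"
    then have "D \<in> bop_polar c" and Dt: "D \<in> trace_class"
      using tc_polar_subset_bop_polar[OF assms] by (auto simp: tc_polar_def)
    then have "tr (C * D) = 0" if "C \<in> tc_closure c" for C
      using that by (auto simp: tc_polar_def tr_commute[OF Dt, of C])
    then show "D \<in> tc_polar (tc_closure c)" using Dt by (simp add: tc_polar_def)
  qed
qed

lemma op_prods_trace_class:
  "c \<subseteq> trace_class \<Longrightarrow> op_prods a c \<subseteq> trace_class"
  "c \<subseteq> trace_class \<Longrightarrow> op_prods c a \<subseteq> trace_class"
  by (auto simp: op_prods_def trace_class_mult)

lemma ball_op_prods: "(\<forall>X\<in>op_prods a b. P X) \<longleftrightarrow> (\<forall>A\<in>a. \<forall>B\<in>b. P (A * B))"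
  by (auto simp: op_prods_def)

lemma op_prods_assoc: "op_prods (op_prods a b) c = op_prods a (op_prods b c)"
  unfolding op_prods_def by (auto simp: mult.assoc) (metis mult.assoc)+

lemma op_prods_Union: "op_prods a (\<Union>B) = (\<Union>b\<in>B. op_prods a b)" "op_prods (\<Union>B) a = (\<Union>b\<in>B. op_prods b a)"
  by (auto simp: op_prods_def)

text \<open>Cyclicity moves either factor next to C. The polar of the products therefore depends on
  each factor only through its own polar, so closing a factor does not change it; the next two
  lemmas do the same for products with trace-class factors.\<close>

lemma tc_polar_op_prods:
  "tc_polar (op_prods a b) = {C \<in> trace_class. \<forall>B\<in>b. B * C \<in> tc_polar a}" (is ?t1)
  "tc_polar (op_prods a b) = {C \<in> trace_class. \<forall>A\<in>a. C * A \<in> tc_polar b}" (is ?t2)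
proof -
  have "tr (B * (C * A)) = tr (A * B * C)" if "C \<in> trace_class" for A B C :: "'a bop"
    using tr_commute[OF trace_class_mult(1)[OF that, of B], of A] by (simp add: mult.assoc)
  then show ?t1 ?t2 by (auto simp: tc_polar_def ball_op_prods trace_class_mult mult.assoc)
qed

lemma bop_polar_op_prods_left:
  assumes "c \<subseteq> trace_class"
  shows "bop_polar (op_prods a c) = {X. \<forall>C\<in>c. C * X \<in> tc_polar a}" (is ?t1)
    "bop_polar (op_prods a c) = {X. \<forall>A\<in>a. X * A \<in> bop_polar c}" (is ?t2)
proof -
  have "tr (A * (C * X)) = tr (X * (A * C))" if "C \<in> c" for A C X
    using tr_commute[OF trace_class_mult(1), of C X A] that assms by (auto simp: mult.assoc)
  then show ?t1 ?t2
    using assms by (auto simp: tc_polar_def bop_polar_def ball_op_prods trace_class_mult mult.assoc subset_iff)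
qed

lemma bop_polar_op_prods_right:
  assumes "c \<subseteq> trace_class"
  shows "bop_polar (op_prods c a) = {X. \<forall>C\<in>c. X * C \<in> tc_polar a}" (is ?t1)
    "bop_polar (op_prods c a) = {X. \<forall>A\<in>a. A * X \<in> bop_polar c}" (is ?t2)
proof -
  have "tr (A * (X * C)) = tr (X * (C * A))" if "C \<in> c" for A C X
    using tr_commute[OF trace_class_mult(1), of C A X] that assms by (auto simp: mult.assoc)
  then show ?t1 ?t2
    using assms by (auto simp: tc_polar_def bop_polar_def ball_op_prods trace_class_mult mult.assoc subset_iff)
qed

lemma tc_polar_op_prods_closure [simp]:
  "tc_polar (op_prods (bop_closure a) b) = tc_polar (op_prods a b)"
  "tc_polar (op_prods a (bop_closure b)) = tc_polar (op_prods a b)"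
proof -
  show "tc_polar (op_prods (bop_closure a) b) = tc_polar (op_prods a b)"
    by (simp only: tc_polar_op_prods(1) tc_polar_bop_closure)
  show "tc_polar (op_prods a (bop_closure b)) = tc_polar (op_prods a b)"
    by (simp only: tc_polar_op_prods(2) tc_polar_bop_closure)
qed

text \<open>Together with \<open>op_prods_assoc\<close> and \<open>op_prods_Union\<close>, these
  rules reduce the laws for products in the trace class to rewriting.\<close>

lemma bop_polar_op_prods_closure:
  assumes "c \<subseteq> trace_class"
  shows "bop_polar (op_prods (bop_closure a) c) = bop_polar (op_prods a c)"
    "bop_polar (op_prods a (tc_closure c)) = bop_polar (op_prods a c)"
    "bop_polar (op_prods c (bop_closure a)) = bop_polar (op_prods c a)"
    "bop_polar (op_prods (tc_closure c) a) = bop_polar (op_prods c a)"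
proof -
  show "bop_polar (op_prods (bop_closure a) c) = bop_polar (op_prods a c)"
    by (simp only: bop_polar_op_prods_left(1)[OF assms] tc_polar_bop_closure)
  show "bop_polar (op_prods a (tc_closure c)) = bop_polar (op_prods a c)"
    by (simp only: bop_polar_op_prods_left(2)[OF assms] bop_polar_op_prods_left(2)[OF tc_polar_subset]
        bop_polar_tc_closure[OF assms])
  show "bop_polar (op_prods c (bop_closure a)) = bop_polar (op_prods c a)"
    by (simp only: bop_polar_op_prods_right(1)[OF assms] tc_polar_bop_closure)
  show "bop_polar (op_prods (tc_closure c) a) = bop_polar (op_prods c a)"
    by (simp only: bop_polar_op_prods_right(2)[OF assms] bop_polar_op_prods_right(2)[OF tc_polar_subset]
        bop_polar_tc_closure[OF assms])
qed

lemma tc_polar_Union: "tc_polar (\<Union>i\<in>I. f i) = trace_class \<inter> (\<Inter>i\<in>I. tc_polar (f i))"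
  by (auto simp: tc_polar_def)

lemma bop_polar_Union: "bop_polar (\<Union>i\<in>I. f i) = (\<Inter>i\<in>I. bop_polar (f i))"
  by (auto simp: bop_polar_def)

section \<open>The quantales and the couple\<close>

text \<open>Instantiated with T all of B(H) and with T the trace class. Idempotence of cl is
  contained in the assumption that its values lie in the carrier.\<close>

lemma closure_system_lattice:
  fixes L :: "('a set, 'r) gorder_scheme"
  assumes L: "eq L = (=)" "le L = (\<subseteq>)" "carrier L = {X. X \<subseteq> T \<and> cl X = X}"
    and mono: "\<And>X Y. X \<subseteq> Y \<Longrightarrow> Y \<subseteq> T \<Longrightarrow> cl X \<subseteq> cl Y"
    and ext: "\<And>X. X \<subseteq> T \<Longrightarrow> X \<subseteq> cl X" and cl: "\<And>X. X \<subseteq> T \<Longrightarrow> cl X \<in> carrier L"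
  shows "complete_lattice L" "\<And>A. A \<subseteq> carrier L \<Longrightarrow> \<Squnion>\<^bsub>L\<^esub>A = cl (\<Union>A)"
proof -
  interpret partial_order L by unfold_locales (auto simp: L)
  have lub: "least L (cl (\<Union>A)) (Upper L A)" if A: "A \<subseteq> carrier L" for A
  proof -
    have T: "\<Union>A \<subseteq> T" using A by (auto simp: L(3))
    show ?thesis
    proof (rule least_UpperI[OF _ _ A cl[OF T]])
      show "X \<sqsubseteq>\<^bsub>L\<^esub> cl (\<Union>A)" if "X \<in> A" for X using ext[OF T] that by (auto simp: L(2))
      show "cl (\<Union>A) \<sqsubseteq>\<^bsub>L\<^esub> Y" if "Y \<in> Upper L A" for Y
      proof -
        have "Y \<in> carrier L" "\<Union>A \<subseteq> Y" using that A by (auto simp: Upper_def L(2))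
        then show ?thesis using mono[of "\<Union>A" Y] by (auto simp: L(2,3))
      qed
    qed
  qed
  show "complete_lattice L"
  proof (rule complete_latticeI)
    fix A assume A: "A \<subseteq> carrier L"
    then show "\<exists>s. least L s (Upper L A)" using lub by blast
    \<comment> \<open>An infimum is the supremum of the set of lower bounds.\<close>
    have "greatest L (cl (\<Union>(Lower L A))) (Lower L A)"
    proof -
      have "Lower L A \<subseteq> carrier L" by (auto simp: Lower_def)
      from lub[OF this] A show ?thesis
        unfolding least_def greatest_def by (auto simp: Lower_def Upper_def L(2))
    qed
    then show "\<exists>i. greatest L i (Lower L A)" by blast
  qed
  then interpret complete_lattice L .
  show "\<Squnion>\<^bsub>L\<^esub>A = cl (\<Union>A)" if "A \<subseteq> carrier L" for A
    using lub[OF that] sup_lub[OF that] least_unique by blast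
qed

text \<open>The bipolar theorem replaces closed subspaces by fixed points of a closure operator, so
  that the algebraic laws become identities between polars.\<close>

lemma carrier_Max_sw: "carrier (Max_sw :: 'h::chilbert_space bop set quantale) = {a. bop_closure a = a}"
proof -
  have "complex_vector.subspace a \<and> closedin ultraweak_topology a \<longleftrightarrow> bop_closure a = a" for a :: "'h bop set"
  proof
    assume a: "complex_vector.subspace a \<and> closedin ultraweak_topology a"
    then have "ultraweak_topology closure_of a = a" by (simp add: closure_of_eq)
    then show "bop_closure a = a" using ultraweak_bipolar a by metis
  next
    assume a: "bop_closure a = a"
    have sub: "complex_vector.subspace a" using subspace_bop_polar[OF tc_polar_subset, of a] a by simp
    then have "ultraweak_topology closure_of a = a" using ultraweak_bipolar a by metis
    then show "complex_vector.subspace a \<and> closedin ultraweak_topology a"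
      using sub by (simp add: closure_of_eq)
  qed
  then show ?thesis by (simp add: Max_sw_def Max_closed_def)
qed

lemma carrier_Max_1: "carrier (Max_1 :: 'h::chilbert_space bop set quantale) = {c. c \<subseteq> trace_class \<and> tc_closure c = c}"
proof -
  have "complex_vector.subspace c \<and> closedin trace_norm_topology c \<longleftrightarrow> c \<subseteq> trace_class \<and> tc_closure c = c"
    for c :: "'h bop set"
  proof
    assume c: "complex_vector.subspace c \<and> closedin trace_norm_topology c"
    then have "c \<subseteq> trace_class" using closedin_subset by fastforce
    moreover have "trace_norm_topology closure_of c = c" using c by (simp add: closure_of_eq)
    ultimately show "c \<subseteq> trace_class \<and> tc_closure c = c" using trace_norm_bipolar c by metis
  next
    assume c: "c \<subseteq> trace_class \<and> tc_closure c = c"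
    then have sub: "complex_vector.subspace c" using subspace_tc_polar[of "bop_polar c"] by simp
    then have "trace_norm_topology closure_of c = c" using trace_norm_bipolar c by metis
    then show "complex_vector.subspace c \<and> closedin trace_norm_topology c"
      using sub closure_of_eq by blast
  qed
  then show ?thesis by (simp add: Max_1_def Max_closed_def)
qed

lemma qmult_Max_sw: "a \<odot>\<^bsub>Max_sw\<^esub> b = bop_closure (op_prods a b)"
  by (simp add: Max_sw_def Max_closed_def span_prod_def op_prods_def ultraweak_bipolar
      complex_vector.subspace_span tc_polar_span)

lemma Max_act_tc_closure:
  assumes "op_prods a b \<subseteq> trace_class"
  shows "Max_act a b = tc_closure (op_prods a b)"
proof -
  have "complex_vector.span (op_prods a b) \<subseteq> trace_class"
    by (intro complex_vector.span_minimal assms subspace_trace_class)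
  then show ?thesis
    using trace_norm_bipolar[OF complex_vector.subspace_span] bop_polar_span[OF assms]
    unfolding Max_act_def span_prod_def op_prods_def[symmetric] by metis
qed

lemma Max_act_left: "c \<subseteq> trace_class \<Longrightarrow> Max_act a c = tc_closure (op_prods a c)"
  and Max_act_right: "c \<subseteq> trace_class \<Longrightarrow> Max_act c a = tc_closure (op_prods c a)"
  by (simp_all add: Max_act_tc_closure op_prods_trace_class)

lemma qmult_Max_1: "c \<odot>\<^bsub>Max_1\<^esub> d = Max_act c d"
  by (simp add: Max_1_def Max_closed_def Max_act_def)

lemma le_Max: "le Max_sw = (\<subseteq>)" "le Max_1 = (\<subseteq>)"
  by (simp_all add: Max_sw_def Max_1_def Max_closed_def)

lemma
  shows complete_lattice_Max_sw: "complete_lattice (Max_sw :: 'h::chilbert_space bop set quantale)"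
    and sup_Max_sw: "A \<subseteq> carrier Max_sw \<Longrightarrow> \<Squnion>\<^bsub>Max_sw :: 'h bop set quantale\<^esub> A = bop_closure (\<Union>A)"
proof -
  let ?L = "Max_sw :: 'h bop set quantale"
  have *: "eq ?L = (=)" "le ?L = (\<subseteq>)" by (simp_all add: Max_sw_def Max_closed_def)
  note lat = closure_system_lattice[OF *, of UNIV bop_closure]
  show "complete_lattice ?L"
    by (rule lat(1)) (auto simp: carrier_Max_sw intro!: bop_polar_antimono tc_polar_antimono subset_bop_closure)
  show "A \<subseteq> carrier Max_sw \<Longrightarrow> \<Squnion>\<^bsub>?L\<^esub> A = bop_closure (\<Union>A)"
    by (rule lat(2)) (auto simp: carrier_Max_sw intro!: bop_polar_antimono tc_polar_antimono subset_bop_closure)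
qed

lemma
  shows complete_lattice_Max_1: "complete_lattice (Max_1 :: 'h::chilbert_space bop set quantale)"
    and sup_Max_1: "A \<subseteq> carrier Max_1 \<Longrightarrow> \<Squnion>\<^bsub>Max_1 :: 'h bop set quantale\<^esub> A = tc_closure (\<Union>A)"
proof -
  let ?L = "Max_1 :: 'h bop set quantale"
  have *: "eq ?L = (=)" "le ?L = (\<subseteq>)" by (simp_all add: Max_1_def Max_closed_def)
  note lat = closure_system_lattice[OF *, of trace_class tc_closure]
  have cl: "tc_closure X \<in> carrier ?L" if "X \<subseteq> trace_class" for X
    using that by (simp add: carrier_Max_1 tc_polar_subset)
  show "complete_lattice ?L"
    by (rule lat(1)) (auto simp: carrier_Max_1 cl[unfolded carrier_Max_1] tc_polar_subset[THEN subsetD]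
      intro!: bop_polar_antimono tc_polar_antimono subset_tc_closure)
  show "A \<subseteq> carrier Max_1 \<Longrightarrow> \<Squnion>\<^bsub>?L\<^esub> A = tc_closure (\<Union>A)"
    by (rule lat(2)) (auto simp: carrier_Max_1 cl[unfolded carrier_Max_1] tc_polar_subset[THEN subsetD]
      intro!: bop_polar_antimono tc_polar_antimono subset_tc_closure)
qed

lemma Max_swD: "a \<in> carrier Max_sw \<Longrightarrow> bop_closure a = a"
  by (simp add: carrier_Max_sw)

lemma Max_1D: "c \<in> carrier Max_1 \<Longrightarrow> c \<subseteq> trace_class" "c \<in> carrier Max_1 \<Longrightarrow> tc_closure c = c"
  by (auto simp: carrier_Max_1)

lemma bop_closure_Max_sw: "bop_closure a \<in> carrier Max_sw"
  by (simp add: carrier_Max_sw)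

lemma tc_closure_Max_1: "c \<subseteq> trace_class \<Longrightarrow> tc_closure c \<in> carrier Max_1"
  by (simp add: carrier_Max_1 tc_polar_subset)

lemma tc_polar_Max_1: "tc_polar a \<in> carrier Max_1"
  using subset_tc_closure[OF tc_polar_subset] tc_polar_antimono[OF subset_bop_closure]
  by (simp add: carrier_Max_1 tc_polar_subset)

lemma bop_polar_Max_sw: "c \<subseteq> trace_class \<Longrightarrow> bop_polar c \<in> carrier Max_sw"
  by (simp add: carrier_Max_sw)

lemma bop_closure_Union: "bop_closure (\<Union>i\<in>I. bop_closure (f i)) = bop_closure (\<Union>i\<in>I. f i)"
  by (simp add: tc_polar_Union)

lemma tc_closure_Union:
  assumes "\<And>i. i \<in> I \<Longrightarrow> f i \<subseteq> trace_class"
  shows "tc_closure (\<Union>i\<in>I. tc_closure (f i)) = tc_closure (\<Union>i\<in>I. f i)"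
  using assms by (simp add: bop_polar_Union)

text \<open>Pattern for all the actions: f is the closure of an operation g on plain sets. The
  assumption on g combines two facts, that closing the argument is invisible after closing the
  result and that g distributes over unions.\<close>

lemma Max_sw_sup_pres:
  fixes f :: "'h::chilbert_space bop set \<Rightarrow> 'h bop set"
  assumes f: "\<And>a. a \<in> carrier Max_sw \<Longrightarrow> f a = bop_closure (g a)"
    and g: "\<And>A. bop_closure (g (bop_closure (\<Union>A))) = bop_closure (\<Union>a\<in>A. g a)"
  shows "sup_pres Max_sw Max_sw f"
  unfolding sup_pres_def
proof (intro conjI allI impI complete_lattice_Max_sw)
  fix A :: "'h bop set set" assume A: "A \<subseteq> carrier Max_sw"
  have fA: "f ` A = (\<lambda>a. bop_closure (g a)) ` A" using A f by (intro image_cong) auto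
  have "f (\<Squnion>\<^bsub>Max_sw\<^esub> A) = bop_closure (\<Union>a\<in>A. g a)"
    by (simp add: sup_Max_sw[OF A] f[OF bop_closure_Max_sw] g)
  also have "\<dots> = bop_closure (\<Union>(f ` A))" by (simp add: fA bop_closure_Union)
  also have "\<dots> = \<Squnion>\<^bsub>Max_sw\<^esub> (f ` A)"
    by (subst sup_Max_sw) (auto simp: fA bop_closure_Max_sw)
  finally show "f (\<Squnion>\<^bsub>Max_sw\<^esub> A) = \<Squnion>\<^bsub>Max_sw\<^esub> (f ` A)" .
qed

lemma Max_1_sup_pres:
  fixes f :: "'h::chilbert_space bop set \<Rightarrow> 'h bop set"
  assumes f: "\<And>a. a \<in> carrier Max_1 \<Longrightarrow> f a = tc_closure (g a)"
    and tc: "\<And>a. a \<subseteq> trace_class \<Longrightarrow> g a \<subseteq> trace_class"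
    and g: "\<And>A. \<Union>A \<subseteq> trace_class \<Longrightarrow> tc_closure (g (tc_closure (\<Union>A))) = tc_closure (\<Union>a\<in>A. g a)"
  shows "sup_pres Max_1 Max_1 f"
  unfolding sup_pres_def
proof (intro conjI allI impI complete_lattice_Max_1)
  fix A :: "'h bop set set" assume A: "A \<subseteq> carrier Max_1"
  then have tcA: "\<Union>A \<subseteq> trace_class" by (auto dest!: Max_1D(1))
  have fA: "f ` A = (\<lambda>a. tc_closure (g a)) ` A" using A f by (intro image_cong) auto
  have gA: "g a \<subseteq> trace_class" if "a \<in> A" for a using tc tcA that by blast
  have "f (\<Squnion>\<^bsub>Max_1\<^esub> A) = tc_closure (\<Union>a\<in>A. g a)"
    by (simp add: sup_Max_1[OF A] f[OF tc_closure_Max_1[OF tcA]] g[OF tcA])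
  also have "\<dots> = tc_closure (\<Union>(f ` A))" using gA by (simp add: fA tc_closure_Union)
  also have "\<dots> = \<Squnion>\<^bsub>Max_1\<^esub> (f ` A)"
    by (subst sup_Max_1) (use gA in \<open>auto simp: fA tc_closure_Max_1\<close>)
  finally show "f (\<Squnion>\<^bsub>Max_1\<^esub> A) = \<Squnion>\<^bsub>Max_1\<^esub> (f ` A)" .
qed

lemma Max_sw_Max_1_sup_pres:
  fixes f :: "'h::chilbert_space bop set \<Rightarrow> 'h bop set"
  assumes f: "\<And>a. a \<in> carrier Max_sw \<Longrightarrow> f a = tc_closure (g a)"
    and tc: "\<And>a. g a \<subseteq> trace_class"
    and g: "\<And>A. tc_closure (g (bop_closure (\<Union>A))) = tc_closure (\<Union>a\<in>A. g a)"
  shows "sup_pres Max_sw Max_1 f"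
  unfolding sup_pres_def
proof (intro conjI allI impI complete_lattice_Max_1 complete_lattice_Max_sw)
  fix A :: "'h bop set set" assume A: "A \<subseteq> carrier Max_sw"
  have fA: "f ` A = (\<lambda>a. tc_closure (g a)) ` A" using A f by (intro image_cong) auto
  have "f (\<Squnion>\<^bsub>Max_sw\<^esub> A) = tc_closure (\<Union>a\<in>A. g a)"
    by (simp add: sup_Max_sw[OF A] f[OF bop_closure_Max_sw] g)
  also have "\<dots> = tc_closure (\<Union>(f ` A))" using tc by (simp add: fA tc_closure_Union)
  also have "\<dots> = \<Squnion>\<^bsub>Max_1\<^esub> (f ` A)"
    by (subst sup_Max_1) (use tc in \<open>auto simp: fA tc_closure_Max_1\<close>)
  finally show "f (\<Squnion>\<^bsub>Max_sw\<^esub> A) = \<Squnion>\<^bsub>Max_1\<^esub> (f ` A)" .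
qed

lemma quantale_Max_sw: "quantale (Max_sw :: 'h::chilbert_space bop set quantale)"
proof (rule quantale.intro[OF complete_lattice_Max_sw], unfold_locales)
  fix a b c :: "'h bop set"
  show "a \<odot>\<^bsub>Max_sw\<^esub> b \<in> carrier Max_sw" by (simp add: qmult_Max_sw bop_closure_Max_sw)
  show "(a \<odot>\<^bsub>Max_sw\<^esub> b) \<odot>\<^bsub>Max_sw\<^esub> c = a \<odot>\<^bsub>Max_sw\<^esub> (b \<odot>\<^bsub>Max_sw\<^esub> c)"
    by (simp add: qmult_Max_sw op_prods_assoc)
  show "sup_pres Max_sw Max_sw (\<lambda>b. a \<odot>\<^bsub>Max_sw\<^esub> b)"
    by (rule Max_sw_sup_pres[where g = "op_prods a"]) (simp_all add: qmult_Max_sw op_prods_Union)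
  show "sup_pres Max_sw Max_sw (\<lambda>a. a \<odot>\<^bsub>Max_sw\<^esub> b)"
    by (rule Max_sw_sup_pres[where g = "\<lambda>a. op_prods a b"]) (simp_all add: qmult_Max_sw op_prods_Union)
qed

lemma Max_act_sup_pres:
  fixes a :: "'h::chilbert_space bop set"
  shows "sup_pres Max_1 Max_1 (\<lambda>c. Max_act a c)" "sup_pres Max_1 Max_1 (\<lambda>c. Max_act c a)"
proof -
  show "sup_pres Max_1 Max_1 (\<lambda>c. Max_act a c)"
    by (rule Max_1_sup_pres[where g = "op_prods a"])
      (simp_all add: Max_act_left Max_1D op_prods_trace_class bop_polar_op_prods_closure op_prods_Union)
  show "sup_pres Max_1 Max_1 (\<lambda>c. Max_act c a)"
    by (rule Max_1_sup_pres[where g = "\<lambda>c. op_prods c a"])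
      (simp_all add: Max_act_right Max_1D op_prods_trace_class bop_polar_op_prods_closure op_prods_Union)
qed

lemma Max_act_closed: "c \<in> carrier Max_1 \<Longrightarrow> Max_act a c \<in> carrier Max_1"
  "c \<in> carrier Max_1 \<Longrightarrow> Max_act c a \<in> carrier Max_1"
  by (simp_all add: Max_act_left Max_act_right Max_1D(1) tc_closure_Max_1 op_prods_trace_class)

lemma quantale_Max_1: "quantale (Max_1 :: 'h::chilbert_space bop set quantale)"
proof (rule quantale.intro[OF complete_lattice_Max_1], unfold_locales)
  fix a b c :: "'h bop set" assume a: "a \<in> carrier Max_1"
  show "sup_pres Max_1 Max_1 (\<lambda>b. a \<odot>\<^bsub>Max_1\<^esub> b)" "sup_pres Max_1 Max_1 (\<lambda>b. b \<odot>\<^bsub>Max_1\<^esub> a)"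
    by (simp_all add: qmult_Max_1 Max_act_sup_pres)
  assume b: "b \<in> carrier Max_1"
  show "a \<odot>\<^bsub>Max_1\<^esub> b \<in> carrier Max_1" using b by (simp add: qmult_Max_1 Max_act_closed)
  assume c: "c \<in> carrier Max_1"
  have tc: "op_prods a b \<subseteq> trace_class" "op_prods b c \<subseteq> trace_class"
    using a b by (simp_all add: Max_1D op_prods_trace_class)
  show "(a \<odot>\<^bsub>Max_1\<^esub> b) \<odot>\<^bsub>Max_1\<^esub> c = a \<odot>\<^bsub>Max_1\<^esub> (b \<odot>\<^bsub>Max_1\<^esub> c)"
    using a b c tc
    by (simp add: qmult_Max_1 Max_act_left Max_act_right Max_1D tc_polar_subset bop_polar_op_prods_closure
        op_prods_assoc)
qed

lemma bimodule_Max_1: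
  "quantale_bimodule (Max_sw :: 'h::chilbert_space bop set quantale) Max_1 Max_act Max_act"
proof (rule quantale_bimodule.intro[OF quantale_Max_sw complete_lattice_Max_1], unfold_locales)
  fix a b m :: "'h bop set"
  show "sup_pres Max_1 Max_1 (\<lambda>m. Max_act a m)" "sup_pres Max_1 Max_1 (\<lambda>m. Max_act m a)"
    by (rule Max_act_sup_pres)+
  assume m: "m \<in> carrier Max_1"
  then have tc: "m \<subseteq> trace_class" "op_prods a m \<subseteq> trace_class" "op_prods m a \<subseteq> trace_class"
    "op_prods b m \<subseteq> trace_class" "op_prods m b \<subseteq> trace_class" for a b
    by (simp_all add: Max_1D op_prods_trace_class)
  show "Max_act a m \<in> carrier Max_1" "Max_act m a \<in> carrier Max_1" using m by (rule Max_act_closed)+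
  show "sup_pres Max_sw Max_1 (\<lambda>a. Max_act a m)"
    by (rule Max_sw_Max_1_sup_pres[where g = "\<lambda>a. op_prods a m"])
      (simp_all add: Max_act_left tc bop_polar_op_prods_closure op_prods_Union)
  show "sup_pres Max_sw Max_1 (\<lambda>a. Max_act m a)"
    by (rule Max_sw_Max_1_sup_pres[where g = "\<lambda>a. op_prods m a"])
      (simp_all add: Max_act_right tc bop_polar_op_prods_closure op_prods_Union)
  show "Max_act (a \<odot>\<^bsub>Max_sw\<^esub> b) m = Max_act a (Max_act b m)"
    by (simp add: Max_act_left tc tc_polar_subset qmult_Max_sw bop_polar_op_prods_closure op_prods_assoc)
  show "Max_act m (a \<odot>\<^bsub>Max_sw\<^esub> b) = Max_act (Max_act m a) b"
    by (simp add: Max_act_right tc tc_polar_subset qmult_Max_sw bop_polar_op_prods_closure op_prods_assoc)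
  show "Max_act (Max_act a m) b = Max_act a (Max_act m b)"
    by (simp add: Max_act_left Max_act_right tc tc_polar_subset bop_polar_op_prods_closure op_prods_assoc)
qed

lemma ultraweak_closure_Max_1:
  "c \<in> carrier Max_1 \<Longrightarrow> ultraweak_topology closure_of c = bop_closure c"
  using ultraweak_bipolar subspace_tc_polar Max_1D(2) by metis

text \<open>The couple identities hold because c and its ultraweak closure have the same trace-class
  polar, so replacing one by the other as a factor leaves the trace norm closure of a product
  unchanged.\<close>

lemma couple_Max_1:
  "couple (Max_1 :: 'h::chilbert_space bop set quantale) Max_sw Max_act Max_act
    (\<lambda>c. ultraweak_topology closure_of c)"
proof (rule couple.intro[OF quantale_Max_1 bimodule_Max_1], unfold_locales)
  show "sup_pres Max_1 (Max_sw :: 'h bop set quantale) (\<lambda>c. ultraweak_topology closure_of c)"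
    unfolding sup_pres_def
  proof (intro conjI allI impI complete_lattice_Max_1 complete_lattice_Max_sw)
    fix A :: "'h bop set set" assume A: "A \<subseteq> carrier Max_1"
    then have tc: "\<Union>A \<subseteq> trace_class" by (auto dest!: Max_1D(1))
    have im: "(\<lambda>c. ultraweak_topology closure_of c) ` A = bop_closure ` A"
      using A by (intro image_cong) (auto simp: ultraweak_closure_Max_1)
    have "ultraweak_topology closure_of (\<Squnion>\<^bsub>Max_1\<^esub> A) = bop_closure (\<Union>A)"
      using tc by (simp add: sup_Max_1[OF A] ultraweak_closure_Max_1 tc_closure_Max_1 tc_polar_tc_closure)
    also have "\<dots> = bop_closure (\<Union>(bop_closure ` A))"
      using bop_closure_Union[of "\<lambda>c. c" A] by simp
    also have "\<dots> = \<Squnion>\<^bsub>Max_sw\<^esub> (bop_closure ` A)"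
      by (subst sup_Max_sw) (auto simp: bop_closure_Max_sw)
    finally show "ultraweak_topology closure_of (\<Squnion>\<^bsub>Max_1\<^esub> A)
      = \<Squnion>\<^bsub>Max_sw\<^esub> ((\<lambda>c. ultraweak_topology closure_of c) ` A)"
      by (simp add: im)
  qed
next
  fix a c d :: "'h bop set" assume c: "c \<in> carrier Max_1"
  then have tc: "c \<subseteq> trace_class" "op_prods a c \<subseteq> trace_class" "op_prods c a \<subseteq> trace_class"
    by (simp_all add: Max_1D op_prods_trace_class)
  show "ultraweak_topology closure_of c \<in> carrier Max_sw"
    using c by (simp add: ultraweak_closure_Max_1 bop_closure_Max_sw)
  show "ultraweak_topology closure_of Max_act a c = a \<odot>\<^bsub>Max_sw\<^esub> (ultraweak_topology closure_of c)"
    using c Max_act_closed(1)[OF c, of a] tc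
    by (simp add: ultraweak_closure_Max_1 Max_act_left qmult_Max_sw tc_polar_tc_closure)
  show "ultraweak_topology closure_of Max_act c a = (ultraweak_topology closure_of c) \<odot>\<^bsub>Max_sw\<^esub> a"
    using c Max_act_closed(2)[OF c, of a] tc
    by (simp add: ultraweak_closure_Max_1 Max_act_right qmult_Max_sw tc_polar_tc_closure)
  assume d: "d \<in> carrier Max_1"
  show "Max_act (ultraweak_topology closure_of c) d = c \<odot>\<^bsub>Max_1\<^esub> d"
    using c Max_1D(1)[OF d]
    by (simp add: ultraweak_closure_Max_1 Max_act_left qmult_Max_1 bop_polar_op_prods_closure)
  show "Max_act c (ultraweak_topology closure_of d) = c \<odot>\<^bsub>Max_1\<^esub> d"
    using d tc
    by (simp add: ultraweak_closure_Max_1 Max_act_right qmult_Max_1 bop_polar_op_prods_closure)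
qed

section \<open>The traceless operators\<close>

abbreviation traceless :: "'h::chilbert_space bop set"
  where "traceless \<equiv> {C \<in> trace_class. tr C = 0}"

text \<open>The traceless operators are the polar of the identity operator, hence closed.\<close>

lemma traceless_Max_1: "(traceless :: 'h::chilbert_space bop set) \<in> carrier Max_1"
proof -
  obtain I :: "'h bop" where "\<And>x. I \<cdot> x = x" "\<And>A. I * A = A" "\<And>A. A * I = A" using ex_bop_id by blast
  then have "traceless = tc_polar {I}" by (simp add: tc_polar_def)
  then show ?thesis using tc_polar_Max_1 by metis
qed

lemma tc_closure_subset_iff:
  assumes "X \<subseteq> trace_class" "d \<in> carrier Max_1"
  shows "tc_closure X \<subseteq> d \<longleftrightarrow> X \<subseteq> d"
  using subset_tc_closure[OF assms(1)] Max_1D(2)[OF assms(2)]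
    tc_polar_antimono[OF bop_polar_antimono, of X d] by blast

text \<open>All conditions say that tr (A C) = 0 throughout a and c. That left and right actions
  agree is cyclicity of d; reading the condition from the side of c or of a gives the two kinds of
  residuals.\<close>

lemma Max_act_subset_traceless:
  assumes "c \<subseteq> trace_class"
  shows "Max_act a c \<subseteq> traceless \<longleftrightarrow> c \<subseteq> tc_polar a" "Max_act c a \<subseteq> traceless \<longleftrightarrow> c \<subseteq> tc_polar a"
    "Max_act a c \<subseteq> traceless \<longleftrightarrow> a \<subseteq> bop_polar c" "Max_act c a \<subseteq> traceless \<longleftrightarrow> a \<subseteq> bop_polar c"
proof -
  have "Max_act a c \<subseteq> traceless \<longleftrightarrow> op_prods a c \<subseteq> traceless"
    by (simp only: Max_act_left[OF assms] tc_closure_subset_iff[OF op_prods_trace_class(1)[OF assms] traceless_Max_1])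
  also have "\<dots> \<longleftrightarrow> (\<forall>A\<in>a. \<forall>C\<in>c. tr (A * C) = 0)"
    using op_prods_trace_class(1)[OF assms, of a]
    by (auto simp: ball_op_prods[of a c "\<lambda>X. tr X = 0", symmetric])
  finally have l: "Max_act a c \<subseteq> traceless \<longleftrightarrow> (\<forall>A\<in>a. \<forall>C\<in>c. tr (A * C) = 0)" .
  have "Max_act c a \<subseteq> traceless \<longleftrightarrow> op_prods c a \<subseteq> traceless"
    by (simp only: Max_act_right[OF assms] tc_closure_subset_iff[OF op_prods_trace_class(2)[OF assms] traceless_Max_1])
  also have "\<dots> \<longleftrightarrow> (\<forall>C\<in>c. \<forall>A\<in>a. tr (C * A) = 0)"
    using op_prods_trace_class(2)[OF assms, of a]
    by (auto simp: ball_op_prods[of c a "\<lambda>X. tr X = 0", symmetric])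
  also have "\<dots> \<longleftrightarrow> (\<forall>A\<in>a. \<forall>C\<in>c. tr (A * C) = 0)"
    using assms tr_commute by (metis subsetD)
  finally have r: "Max_act c a \<subseteq> traceless \<longleftrightarrow> (\<forall>A\<in>a. \<forall>C\<in>c. tr (A * C) = 0)" .
  show "Max_act a c \<subseteq> traceless \<longleftrightarrow> c \<subseteq> tc_polar a" "Max_act c a \<subseteq> traceless \<longleftrightarrow> c \<subseteq> tc_polar a"
    "Max_act a c \<subseteq> traceless \<longleftrightarrow> a \<subseteq> bop_polar c" "Max_act c a \<subseteq> traceless \<longleftrightarrow> a \<subseteq> bop_polar c"
    unfolding l r using assms by (auto simp: tc_polar_def bop_polar_def)
qed

text \<open>The sets whose suprema define the residuals turn out to be principal down-sets, with the
  polar as largest member.\<close>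

lemma sup_Max_1_le:
  assumes "m \<in> carrier Max_1"
  shows "\<Squnion>\<^bsub>Max_1\<^esub> {c \<in> carrier Max_1. c \<subseteq> m} = m"
proof -
  have "\<Union>{c \<in> carrier Max_1. c \<subseteq> m} = m" using assms by auto
  then show ?thesis by (subst sup_Max_1) (simp_all add: Max_1D(2)[OF assms])
qed

lemma sup_Max_sw_le:
  assumes "m \<in> carrier Max_sw"
  shows "\<Squnion>\<^bsub>Max_sw\<^esub> {a \<in> carrier Max_sw. a \<subseteq> m} = m"
proof -
  have "\<Union>{a \<in> carrier Max_sw. a \<subseteq> m} = m" using assms by auto
  then show ?thesis by (subst sup_Max_sw) (simp_all add: Max_swD[OF assms])
qed

theorem theorem3p12:
  shows "girard_couple (Max_1 :: 'h::chilbert_space bop set quantale) Max_sw Max_act Max_act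
      (\<lambda>c. ultraweak_topology closure_of c)
    \<and> couple.cyclic (Max_1 :: 'h bop set quantale) Max_sw Max_act Max_act
      {C \<in> trace_class. tr C = 0}
    \<and> couple.dualizing (Max_1 :: 'h bop set quantale) Max_sw Max_act Max_act
      {C \<in> trace_class. tr C = 0}"
proof -
  interpret couple "Max_1 :: 'h bop set quantale" Max_sw Max_act Max_act "\<lambda>c. ultraweak_topology closure_of c"
    by (rule couple_Max_1)
  have cyc: "cyclic (traceless :: 'h bop set)"
    unfolding cyclic_def by (simp add: traceless_Max_1 le_Max Max_act_subset_traceless Max_1D)
  have Q: "rres_Q a traceless = tc_polar a" "lres_Q traceless a = tc_polar a" for a :: "'h bop set"
  proof -
    have "{c \<in> carrier Max_1. Max_act c a \<subseteq> traceless} = {c \<in> carrier Max_1. c \<subseteq> tc_polar a}"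
      "{c \<in> carrier Max_1. Max_act a c \<subseteq> traceless} = {c \<in> carrier Max_1. c \<subseteq> tc_polar a}"
      by (simp_all add: Max_act_subset_traceless(1,2) Max_1D(1) cong: conj_cong)
    then show "rres_Q a traceless = tc_polar a" "lres_Q traceless a = tc_polar a"
      by (simp_all add: rres_Q_def lres_Q_def le_Max sup_Max_1_le tc_polar_Max_1)
  qed
  have C: "rres_C c traceless = bop_polar c" "lres_C traceless c = bop_polar c" if "c \<subseteq> trace_class" for c :: "'h bop set"
    by (simp_all add: rres_C_def lres_C_def le_Max Max_act_subset_traceless(3,4)[OF that] sup_Max_sw_le bop_polar_Max_sw that)
  have dual: "dualizing (traceless :: 'h bop set)"
    unfolding dualizing_def
    by (simp add: traceless_Max_1 Q C tc_polar_subset Max_swD Max_1D)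
  have "girard_couple (Max_1 :: 'h bop set quantale) Max_sw Max_act Max_act (\<lambda>c. ultraweak_topology closure_of c)"
    by unfold_locales (use cyc dual in blast)
  with cyc dual show ?thesis by blast
qed

end
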